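(* There is a randomized polynomial-time $8k$-approximation algorithm for $k$-CS-PIP: on every instance it outputs a feasible solution $x\in\{0,1\}^n$ with expected weight at least $\mathrm{OPT}/(8k)$.
   Context: $k$-CS-PIP: given $w\in\mathbb{R}^n_+$, $c\in\mathbb{R}^m_+$ and $S=(s_{ij})\in\mathbb{R}^{m\times n}_+$ with at most $k$ nonzero entries in each column, maximize $w^Tx$ subject to $Sx\le c$, $x\in\{0,1\}^n$; $\mathrm{OPT}$ is the optimum value.
   Formalization: Instances are restricted to rational w, c and S, since input length, and hence polynomial time, is undefined for arbitrary real data; and k is at least 1, since OPT/(8k) is undefined for k = 0. *)

theory Defs
  imports
    "HOL-Probability.Probability"
    "HOL-Computational_Algebra.Polynomial"
    "HOL-Library.Log_Nat"
begin

text \<open>Column-sparse packing integer programs. Indices are 0-based: items are \<open>j < items I\<close>, rows are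
  \<open>i < rows I\<close>; values of the data outside these ranges are irrelevant.\<close>

record pip =
  items :: nat
  rows :: nat
  weight :: "nat \<Rightarrow> real"
  capacity :: "nat \<Rightarrow> real"
  demand :: "nat \<Rightarrow> nat \<Rightarrow> real"

definition k_CS_PIP :: "nat \<Rightarrow> pip \<Rightarrow> bool" where
  "k_CS_PIP k I \<longleftrightarrow>
     (\<forall>j<items I. 0 \<le> weight I j) \<and>
     (\<forall>i<rows I. 0 \<le> capacity I i) \<and>
     (\<forall>i<rows I. \<forall>j<items I. 0 \<le> demand I i j) \<and>
     (\<forall>j<items I. card {i. i < rows I \<and> demand I i j \<noteq> 0} \<le> k)"

definition feasible :: "pip \<Rightarrow> (nat \<Rightarrow> nat) \<Rightarrow> bool" where
  "feasible I x \<longleftrightarrow>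
     (\<forall>j<items I. x j \<in> {0, 1}) \<and>
     (\<forall>i<rows I. (\<Sum>j<items I. demand I i j * real (x j)) \<le> capacity I i)"

definition total_weight :: "pip \<Rightarrow> (nat \<Rightarrow> nat) \<Rightarrow> real" where
  "total_weight I x = (\<Sum>j<items I. weight I j * real (x j))"

definition OPT :: "pip \<Rightarrow> real" where
  "OPT I = Max {total_weight I x | x. feasible I x}"

text \<open>Running time is measured in the bit model, so the numbers of an input instance are rationals,
  written as numerator and denominator in lowest terms.\<close>

definition rational_data :: "pip \<Rightarrow> bool" where
  "rational_data I \<longleftrightarrow>
     (\<forall>j<items I. weight I j \<in> \<rat>) \<and>
     (\<forall>i<rows I. capacity I i \<in> \<rat>) \<and>
     (\<forall>i<rows I. \<forall>j<items I. demand I i j \<in> \<rat>)"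

definition encode_number :: "real \<Rightarrow> nat list" where
  "encode_number r = (case quotient_of (inv real_of_rat r) of (a, b) \<Rightarrow> [nat a, nat b])"

definition encode :: "pip \<Rightarrow> nat list" where
  "encode I = [items I, rows I] @
     concat (map encode_number
       (map (weight I) [0..<items I] @
        map (capacity I) [0..<rows I] @
        concat (map (\<lambda>i. map (demand I i) [0..<items I]) [0..<rows I])))"

definition bit_length :: "nat \<Rightarrow> nat" where
  "bit_length n = max 1 (floorlog 2 n)"

definition input_size :: "nat list \<Rightarrow> nat" where
  "input_size xs = sum_list (map bit_length xs)"

text \<open>The machine model is a random access machine with logarithmic cost and fair coin flips,
  presented as a structured language. The memory consists of named arrays of natural numbers; a
  scalar variable is cell 0 of its array. Every operation is charged the bit lengths of all its
  operands (array indices included) and of its result, which makes polynomial time coincide with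
  that of probabilistic Turing machines.\<close>

type_synonym state = "string \<Rightarrow> nat \<Rightarrow> nat"

datatype aexp =
    Const nat
  | Cell string aexp
  | Add aexp aexp
  | Sub aexp aexp
  | Mul aexp aexp
  | Div aexp aexp

datatype bexp =
    Less aexp aexp
  | Not bexp
  | And bexp bexp

datatype com =
    Skip
  | Assign string aexp aexp
  | Flip string
  | Seq com com
  | Cond bexp com com
  | While bexp com

fun aval :: "aexp \<Rightarrow> state \<Rightarrow> nat" where
  "aval (Const n) s = n"
| "aval (Cell x a) s = s x (aval a s)"
| "aval (Add a b) s = aval a s + aval b s"
| "aval (Sub a b) s = aval a s - aval b s"
| "aval (Mul a b) s = aval a s * aval b s"
| "aval (Div a b) s = aval a s div aval b s"

fun acost :: "aexp \<Rightarrow> state \<Rightarrow> nat" where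
  "acost (Const n) s = bit_length n"
| "acost (Cell x a) s = acost a s + bit_length (aval (Cell x a) s)"
| "acost (Add a b) s = acost a s + acost b s + bit_length (aval (Add a b) s)"
| "acost (Sub a b) s = acost a s + acost b s + bit_length (aval (Sub a b) s)"
| "acost (Mul a b) s = acost a s + acost b s + bit_length (aval (Mul a b) s)"
| "acost (Div a b) s = acost a s + acost b s + bit_length (aval (Div a b) s)"

fun bval :: "bexp \<Rightarrow> state \<Rightarrow> bool" where
  "bval (Less a b) s \<longleftrightarrow> aval a s < aval b s"
| "bval (Not b) s \<longleftrightarrow> \<not> bval b s"
| "bval (And b c) s \<longleftrightarrow> bval b s \<and> bval c s"

fun bcost :: "bexp \<Rightarrow> state \<Rightarrow> nat" where
  "bcost (Less a b) s = acost a s + acost b s + 1"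
| "bcost (Not b) s = bcost b s + 1"
| "bcost (And b c) s = bcost b s + bcost c s + 1"

definition store :: "string \<Rightarrow> nat \<Rightarrow> nat \<Rightarrow> state \<Rightarrow> state" where
  "store x i v s = s(x := (s x)(i := v))"

definition delay :: "nat \<Rightarrow> (state \<times> nat) pmf \<Rightarrow> (state \<times> nat) pmf" where
  "delay t D = map_pmf (\<lambda>(s, t'). (s, t + t')) D"

text \<open>\<open>runs c s D\<close>: started in \<open>s\<close>, the program \<open>c\<close> halts for every outcome of its coin flips, and
  \<open>D\<close> is the joint distribution of its final state and its running time. If some outcome leads to
  divergence, no such \<open>D\<close> exists.\<close>

inductive runs :: "com \<Rightarrow> state \<Rightarrow> (state \<times> nat) pmf \<Rightarrow> bool" where
  Skip: "runs Skip s (return_pmf (s, 1))"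
| Assign: "runs (Assign x a e) s
     (return_pmf (store x (aval a s) (aval e s) s, acost a s + acost e s + 1))"
| Flip: "runs (Flip x) s
     (map_pmf (\<lambda>h. (store x 0 (of_bool h) s, 1)) (bernoulli_pmf (1 / 2)))"
| Seq: "\<lbrakk>runs c s D; \<And>s' t. (s', t) \<in> set_pmf D \<Longrightarrow> runs d s' (E s')\<rbrakk> \<Longrightarrow>
     runs (Seq c d) s (bind_pmf D (\<lambda>(s', t). delay t (E s')))"
| CondTrue: "\<lbrakk>bval b s; runs c s D\<rbrakk> \<Longrightarrow> runs (Cond b c d) s (delay (bcost b s) D)"
| CondFalse: "\<lbrakk>\<not> bval b s; runs d s D\<rbrakk> \<Longrightarrow> runs (Cond b c d) s (delay (bcost b s) D)"
| WhileFalse: "\<not> bval b s \<Longrightarrow> runs (While b c) s (return_pmf (s, bcost b s))"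
| WhileTrue: "\<lbrakk>bval b s; runs (Seq c (While b c)) s D\<rbrakk> \<Longrightarrow>
     runs (While b c) s (delay (bcost b s) D)"

inductive_cases runs_SeqE: "runs (Seq c d) s D"

inductive_cases runs_CondE: "runs (Cond b c d) s D"
inductive_cases runs_WhileE: "runs (While b c) s D"

lemma runs_deterministic: "runs c s D \<Longrightarrow> runs c s D' \<Longrightarrow> D = D'"
proof (induction arbitrary: D' rule: runs.induct)
  case (Seq c s D d E)
  from Seq.prems obtain D2 E2 where *: "runs c s D2"
    "\<And>s' t. (s', t) \<in> set_pmf D2 \<Longrightarrow> runs d s' (E2 s')"
    "D' = bind_pmf D2 (\<lambda>(s', t). delay t (E2 s'))"
    by (elim runs_SeqE) blast
  have "D = D2" using Seq.IH(1) *(1) by blast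
  moreover from this have "E s' = E2 s'" if "(s', t) \<in> set_pmf D2" for s' t
    using that Seq.IH(2) *(2) by blast
  ultimately show ?case
    unfolding *(3) by (intro bind_pmf_cong) auto
next
  case (CondTrue b s c D d)
  then show ?case by (metis runs_CondE)
next
  case (CondFalse b s d D c)
  then show ?case by (metis runs_CondE)
next
  case (WhileFalse b s c)
  then show ?case by (metis runs_WhileE)
next
  case (WhileTrue b s c D)
  then show ?case by (metis runs_WhileE)
qed (erule runs.cases; simp; fail)+

definition input_state :: "nat list \<Rightarrow> state" where
  "input_state xs = (\<lambda>x i. if x = ''in'' \<and> i < length xs then xs ! i else 0)"

definition solution :: "state \<Rightarrow> nat \<Rightarrow> nat" where
  "solution s = s ''out''"

text \<open>A bound on the running time has to hold for every outcome of the coin flips.\<close>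

definition randomized_poly_time_on :: "com \<Rightarrow> nat list set \<Rightarrow> bool" where
  "randomized_poly_time_on A X \<longleftrightarrow>
     (\<exists>p :: nat poly. \<forall>xs\<in>X. \<exists>D. runs A (input_state xs) D \<and>
        (\<forall>(s, t)\<in>set_pmf D. t \<le> poly p (input_size xs)))"

end

theory Submission imports Defs begin

text \<open>
  The algorithm is deterministic and avoids linear programming solvers. Scale the data to natural
  numbers, drop the items that do not fit alone, and put \<open>\<phi>\<^sub>i\<^sub>j = min 1 (2 d\<^sub>i\<^sub>j / c\<^sub>i)\<close>. Every
  feasible set \<open>T\<close> satisfies \<open>\<Sum>\<^sub>j\<^sub>\<in>\<^sub>T \<phi>\<^sub>i\<^sub>j \<le> 2\<close>. For the packing linear program with these rows and
  with \<open>x\<^sub>j \<le> 1\<close>, multiplicative weights (prices that grow by a factor of at most 2 per round) yield,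
  after polynomially many rounds, a fractional \<open>x\<close> with \<open>w x \<ge> 5/8 OPT\<close>.

  The fractional point is rounded by the local ratio technique. The kernel of two items adds
  \<open>\<phi>\<^sub>i\<^sub>j + \<phi>\<^sub>i\<^sub>l\<close> over the rows \<open>i\<close> that they share. An item that no longer fits sees kernel mass at
  least 1 in the items already chosen. A large item may meet arbitrarily many small ones, so that
  no fixed order of the items works, but by double counting with weights \<open>x\<close> some remaining item
  always sees \<open>x\<close>-weighted kernel mass at most \<open>4k\<close>. Processing the items in this order loses a
  factor \<open>4k + 1\<close>, and \<open>(4k + 1) \<cdot> 8/5 \<le> 8k\<close>.
\<close>

section \<open>Multiplicative weights\<close>

lemma two_powr_le:
  fixes x :: real
  assumes "0 \<le> x" "x \<le> 1"
  shows "2 powr x \<le> 1 + x"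
proof -
  have "exp ((1 - x) *\<^sub>R 0 + x *\<^sub>R ln 2) \<le> (1 - x) * exp 0 + x * exp (ln 2 :: real)"
    using assms by (intro convex_onD[OF exp_convex]) auto
  then show ?thesis by (simp add: powr_def)
qed

locale packing_lp =
  fixes I :: "'i set" and J :: "'j set" and a :: "'i \<Rightarrow> 'j \<Rightarrow> real" and u :: "'j \<Rightarrow> real"
  assumes finite_rows: "finite I"
    and entry_nonneg: "i \<in> I \<Longrightarrow> j \<in> J \<Longrightarrow> 0 \<le> a i j"
    and entry_le_1: "i \<in> I \<Longrightarrow> j \<in> J \<Longrightarrow> a i j \<le> 1"
    and objective_nonneg: "j \<in> J \<Longrightarrow> 0 \<le> u j"
begin

definition packed :: "'j set \<Rightarrow> bool" where
  "packed T \<longleftrightarrow> T \<subseteq> J \<and> (\<forall>i\<in>I. (\<Sum>j\<in>T. a i j) \<le> 1)"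

definition price :: "(nat \<Rightarrow> 'j) \<Rightarrow> nat \<Rightarrow> 'i \<Rightarrow> real" where
  "price b t i = (\<Prod>s<t. 1 + a i (b s))"

definition cost :: "(nat \<Rightarrow> 'j) \<Rightarrow> nat \<Rightarrow> 'j \<Rightarrow> real" where
  "cost b t j = (\<Sum>i\<in>I. a i j * price b t i)"

definition best_picks :: "(nat \<Rightarrow> 'j) \<Rightarrow> nat \<Rightarrow> bool" where
  "best_picks b t \<longleftrightarrow>
     (\<forall>s<t. b s \<in> J \<and> (\<forall>j\<in>J. u j * cost b s (b s) \<le> u (b s) * cost b s j))"

definition load :: "(nat \<Rightarrow> 'j) \<Rightarrow> nat \<Rightarrow> 'i \<Rightarrow> real" where
  "load b t i = (\<Sum>s<t. a i (b s))"

lemma price_Suc: "price b (Suc t) i = price b t i * (1 + a i (b t))"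
  by (simp add: price_def)

lemma price_fun_upd [simp]: "price (b(t := j)) t i = price b t i"
  by (simp add: price_def)

lemma cost_fun_upd: "s \<le> t \<Longrightarrow> cost (b(t := j)) s = cost b s"
  by (simp add: cost_def price_def fun_eq_iff)

lemma best_picks_0 [simp]: "best_picks b 0"
  by (simp add: best_picks_def)

lemma best_picks_in: "best_picks b t \<Longrightarrow> s < t \<Longrightarrow> b s \<in> J"
  by (simp add: best_picks_def)

lemma best_picks_Suc:
  assumes "best_picks b t" "j \<in> J" "\<And>l. l \<in> J \<Longrightarrow> u l * cost b t j \<le> u j * cost b t l"
  shows "best_picks (b(t := j)) (Suc t)"
  using assms unfolding best_picks_def by (auto simp: less_Suc_eq cost_fun_upd)

lemma price_bounds:
  assumes "best_picks b t" "i \<in> I"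
  shows "1 \<le> price b t i" "price b t i \<le> 2 ^ t"
proof -
  have factor: "1 \<le> 1 + a i (b s)" "1 + a i (b s) \<le> 2" if "s < t" for s
    using entry_nonneg entry_le_1 best_picks_in[OF assms(1) that] assms(2) by force+
  show "1 \<le> price b t i" unfolding price_def using factor(1) by (intro prod_ge_1) auto
  have "price b t i \<le> (\<Prod>s<t. 2)"
    unfolding price_def by (intro prod_mono) (use factor in fastforce)
  then show "price b t i \<le> 2 ^ t" by simp
qed

lemma powr_load_le_price:
  assumes "best_picks b t" "i \<in> I"
  shows "2 powr load b t i \<le> price b t i"
  unfolding load_def price_def powr_sum[of 2, simplified]
  using assms best_picks_in entry_nonneg entry_le_1 by (intro prod_mono) (auto intro!: two_powr_le)

lemma cost_best_pick_le:
  assumes "best_picks b (Suc t)" "packed T" "0 < sum u T"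
  shows "cost b t (b t) \<le> u (b t) / sum u T * (\<Sum>i\<in>I. price b t i)"
proof -
  have pick_in: "b t \<in> J" and best: "\<And>j. j \<in> J \<Longrightarrow> u j * cost b t (b t) \<le> u (b t) * cost b t j"
    using assms(1) by (auto simp: best_picks_def)
  have "best_picks b t" using assms(1) by (simp add: best_picks_def)
  note price_ge_1 = price_bounds(1)[OF this]
  have "sum u T * cost b t (b t) \<le> (\<Sum>j\<in>T. u (b t) * cost b t j)"
    unfolding sum_distrib_right using assms(2) by (intro sum_mono best) (auto simp: packed_def)
  also have "\<dots> = u (b t) * (\<Sum>i\<in>I. price b t i * (\<Sum>j\<in>T. a i j))"
    unfolding cost_def sum_distrib_left[symmetric]
    by (subst sum.swap) (simp flip: sum_distrib_right add: mult.commute)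
  also have "\<dots> \<le> u (b t) * (\<Sum>i\<in>I. price b t i * 1)"
    using assms(2) objective_nonneg[OF pick_in] price_ge_1
    by (intro mult_left_mono sum_mono) (force simp: packed_def)+
  finally show ?thesis using assms(3) by (simp add: field_simps)
qed

lemma sum_price_le:
  assumes "best_picks b t" "packed T" "0 < sum u T"
  shows "(\<Sum>i\<in>I. price b t i) \<le> card I * exp ((\<Sum>s<t. u (b s)) / sum u T)"
  using assms(1)
proof (induction t)
  case 0
  show ?case by (simp add: price_def)
next
  case (Suc t)
  then have picks: "best_picks b t" by (simp add: best_picks_def)
  let ?F = "\<Sum>i\<in>I. price b t i" and ?r = "u (b t) / sum u T"
  have F_nonneg: "0 \<le> ?F" using price_bounds(1)[OF picks] by (intro sum_nonneg) force
  have "(\<Sum>i\<in>I. price b (Suc t) i) = ?F + cost b t (b t)"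
    by (simp add: price_Suc cost_def algebra_simps sum.distrib)
  also have "\<dots> \<le> ?F * (1 + ?r)"
    using cost_best_pick_le[OF Suc.prems assms(2,3)] by (simp add: algebra_simps)
  also have "\<dots> \<le> ?F * exp ?r" using F_nonneg by (intro mult_left_mono exp_ge_add_one_self)
  also have "\<dots> \<le> card I * exp ((\<Sum>s<t. u (b s)) / sum u T) * exp ?r"
    using Suc.IH[OF picks] by (intro mult_right_mono) auto
  also have "\<dots> = card I * exp ((\<Sum>s<Suc t. u (b s)) / sum u T)"
    by (simp add: exp_add add_divide_distrib)
  finally show ?case .
qed

theorem multiplicative_weights:
  assumes "best_picks b t" "packed T" "0 < sum u T" "i \<in> I"
  shows "load b t i * ln 2 \<le> ln (card I) + (\<Sum>s<t. u (b s)) / sum u T"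
proof -
  have card: "0 < card I" using assms(4) finite_rows by (auto simp: card_gt_0_iff)
  have "2 powr load b t i \<le> price b t i" using assms by (intro powr_load_le_price)
  also have "\<dots> \<le> (\<Sum>i\<in>I. price b t i)"
    using assms finite_rows price_bounds(1) by (intro member_le_sum) force+
  also have "\<dots> \<le> card I * exp ((\<Sum>s<t. u (b s)) / sum u T)" using assms by (intro sum_price_le)
  finally have "ln (2 powr load b t i) \<le> ln (card I * exp ((\<Sum>s<t. u (b s)) / sum u T))"
    using card by (subst ln_le_cancel_iff) auto
  then show ?thesis using card by (simp add: ln_mult ln_powr)
qed

end

section \<open>Local ratio and greedy selection\<close>

theorem local_ratio:
  fixes u x z \<delta> :: "nat \<Rightarrow> real" and \<kappa> :: "nat \<Rightarrow> nat \<Rightarrow> real"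
  assumes residual: "\<And>a. a < n \<Longrightarrow> \<delta> a = max 0 (u a - (\<Sum>b<a. \<delta> b * \<kappa> b a))"
    and x_nonneg: "\<And>a. a < n \<Longrightarrow> 0 \<le> x a"
    and x_mass: "\<And>a. a < n \<Longrightarrow> x a + (\<Sum>b\<in>{a<..<n}. \<kappa> a b * x b) \<le> \<alpha>"
    and z_mass: "\<And>a. a < n \<Longrightarrow> 0 < \<delta> a \<Longrightarrow> 1 \<le> z a + (\<Sum>b\<in>{a<..<n}. \<kappa> a b * z b)"
    and z_support: "\<And>a. a < n \<Longrightarrow> z a \<noteq> 0 \<Longrightarrow> 0 < \<delta> a"
    and \<alpha>: "0 \<le> \<alpha>"
  shows "(\<Sum>a<n. u a * x a) \<le> \<alpha> * (\<Sum>a<n. u a * z a)"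
proof -
  have \<delta>_nonneg: "0 \<le> \<delta> a" if "a < n" for a using residual[OF that] by simp
  have residual_le: "u a \<le> \<delta> a + (\<Sum>b<a. \<delta> b * \<kappa> b a)" if "a < n" for a
    using residual[OF that] by simp
  have exchange: "(\<Sum>a<n. (\<delta> a + (\<Sum>b<a. \<delta> b * \<kappa> b a)) * y a)
      = (\<Sum>a<n. \<delta> a * (y a + (\<Sum>b\<in>{a<..<n}. \<kappa> a b * y b)))" for y
  proof -
    have "(\<Sum>a<n. \<Sum>b<a. \<delta> b * \<kappa> b a * y a) = (\<Sum>b<n. \<Sum>a\<in>{b<..<n}. \<delta> b * \<kappa> b a * y a)"
      unfolding sum.Sigma[OF finite_lessThan ballI[OF finite_lessThan]]
        sum.Sigma[OF finite_lessThan ballI[OF finite_greaterThanLessThan]]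
      by (rule sum.reindex_bij_witness[of _ prod.swap prod.swap]) auto
    then show ?thesis
      by (simp add: algebra_simps sum.distrib sum_distrib_left)
  qed
  have "(\<Sum>a<n. u a * x a) \<le> (\<Sum>a<n. (\<delta> a + (\<Sum>b<a. \<delta> b * \<kappa> b a)) * x a)"
    by (intro sum_mono mult_right_mono) (simp_all add: residual_le x_nonneg)
  also have "\<dots> \<le> (\<Sum>a<n. \<delta> a * \<alpha>)"
    unfolding exchange using x_mass \<delta>_nonneg by (intro sum_mono mult_left_mono) auto
  also have "\<dots> = \<alpha> * (\<Sum>a<n. \<delta> a)" by (simp add: sum_distrib_left mult.commute)
  also have "(\<Sum>a<n. \<delta> a) \<le> (\<Sum>a<n. \<delta> a * (z a + (\<Sum>b\<in>{a<..<n}. \<kappa> a b * z b)))"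
  proof (intro sum_mono)
    fix a assume "a \<in> {..<n}"
    then have "\<delta> a = 0 \<or> 0 < \<delta> a \<and> 1 \<le> z a + (\<Sum>b\<in>{a<..<n}. \<kappa> a b * z b)"
      using \<delta>_nonneg z_mass by force
    then show "\<delta> a \<le> \<delta> a * (z a + (\<Sum>b\<in>{a<..<n}. \<kappa> a b * z b))" by auto
  qed
  also have "\<dots> = (\<Sum>a<n. u a * z a)"
    unfolding exchange[symmetric]
  proof (intro sum.cong refl)
    fix a assume "a \<in> {..<n}"
    then show "(\<delta> a + (\<Sum>b<a. \<delta> b * \<kappa> b a)) * z a = u a * z a"
      using residual[of a] z_support[of a] by (cases "z a = 0") auto
  qed
  finally show ?thesis using \<alpha> by (simp add: mult_left_mono)
qed

lemma weighted_min_degree_le: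
  fixes x :: "'a \<Rightarrow> real" and \<sigma> :: "'a \<Rightarrow> 'a \<Rightarrow> real"
  assumes "finite A" and x_nonneg: "\<And>l. l \<in> A \<Longrightarrow> 0 \<le> x l"
    and out_degree: "\<And>j. j \<in> A \<Longrightarrow> (\<Sum>l\<in>A. \<sigma> j l * x l) \<le> \<beta>" and "0 \<le> \<beta>"
    and minimal: "\<And>j. j \<in> A \<Longrightarrow> (\<Sum>l\<in>A. (\<sigma> b l + \<sigma> l b) * x l) \<le> (\<Sum>l\<in>A. (\<sigma> j l + \<sigma> l j) * x l)"
  shows "(\<Sum>l\<in>A. (\<sigma> b l + \<sigma> l b) * x l) \<le> 2 * \<beta>"
proof (cases "sum x A = 0")
  case True
  then have "x l = 0" if "l \<in> A" for l
    using assms(1) x_nonneg that by (simp add: sum_nonneg_eq_0_iff)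
  then show ?thesis using \<open>0 \<le> \<beta>\<close> by simp
next
  case False
  then have pos: "0 < sum x A" using x_nonneg sum_nonneg[of A x] by fastforce
  have "sum x A * (\<Sum>l\<in>A. (\<sigma> b l + \<sigma> l b) * x l) \<le> (\<Sum>j\<in>A. x j * (\<Sum>l\<in>A. (\<sigma> j l + \<sigma> l j) * x l))"
    unfolding sum_distrib_right[of x A] by (intro sum_mono mult_left_mono minimal x_nonneg)
  also have "\<dots> = (\<Sum>j\<in>A. \<Sum>l\<in>A. x j * (\<sigma> j l * x l)) + (\<Sum>j\<in>A. \<Sum>l\<in>A. x j * (\<sigma> l j * x l))"
    by (simp add: algebra_simps sum_distrib_left sum.distrib)
  also have "(\<Sum>j\<in>A. \<Sum>l\<in>A. x j * (\<sigma> l j * x l)) = (\<Sum>j\<in>A. \<Sum>l\<in>A. x j * (\<sigma> j l * x l))"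
    by (subst sum.swap) (simp add: mult_ac)
  also have "(\<Sum>j\<in>A. \<Sum>l\<in>A. x j * (\<sigma> j l * x l)) \<le> (\<Sum>j\<in>A. x j * \<beta>)"
    unfolding sum_distrib_left[symmetric] by (intro sum_mono mult_left_mono out_degree x_nonneg)
  also have "(\<Sum>j\<in>A. x j * \<beta>) = sum x A * \<beta>" by (rule sum_distrib_right[symmetric])
  finally have "sum x A * (\<Sum>l\<in>A. (\<sigma> b l + \<sigma> l b) * x l) \<le> sum x A * (2 * \<beta>)"
    by (simp add: mult_ac)
  then show ?thesis using pos by simp
qed

definition greedy :: "('a set \<Rightarrow> bool) \<Rightarrow> 'a list \<Rightarrow> 'a set" where
  "greedy ok xs = foldr (\<lambda>x S. if ok (insert x S) then insert x S else S) xs {}"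

lemma greedy_Nil [simp]: "greedy ok [] = {}"
  by (simp add: greedy_def)

lemma greedy_Cons [simp]:
  "greedy ok (x # xs) =
     (if ok (insert x (greedy ok xs)) then insert x (greedy ok xs) else greedy ok xs)"
  by (simp add: greedy_def)

lemma greedy_subset: "greedy ok xs \<subseteq> set xs"
  by (induction xs) auto

lemma greedy_ok: "ok {} \<Longrightarrow> ok (greedy ok xs)"
  by (induction xs) auto

lemma greedy_append_mono: "greedy ok ys \<subseteq> greedy ok (xs @ ys)"
  by (induction xs) auto

lemma greedy_maximal: "x \<in> greedy ok (xs @ x # ys) \<or> \<not> ok (insert x (greedy ok ys))"
  using greedy_append_mono[of ok "x # ys" xs] by auto

section \<open>Packing with integral data\<close>

lemma real_diff_nat: "real (a - b) = max 0 (real a - real b)"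
  by linarith

lemma min_sum_le: "finite A \<Longrightarrow> min (c::nat) (\<Sum>x\<in>A. f x) \<le> (\<Sum>x\<in>A. min c (f x))"
  by (induction A rule: finite_induct) auto

locale integer_packing =
  fixes n m :: nat and w c :: "nat \<Rightarrow> nat" and d :: "nat \<Rightarrow> nat \<Rightarrow> nat"
  assumes capacity_pos: "i < m \<Longrightarrow> 0 < c i"
begin

definition fits :: "nat set \<Rightarrow> bool" where
  "fits T \<longleftrightarrow> T \<subseteq> {..<n} \<and> (\<forall>i<m. (\<Sum>j\<in>T. d i j) < c i)"

definition profit :: "nat \<Rightarrow> nat" where
  "profit j = (if fits {j} then w j else 0)"

definition scale :: nat where
  "scale = (\<Prod>i<m. c i)"

text \<open>This is \<open>scale \<cdot> min 1 (2 d\<^sub>i\<^sub>j / c\<^sub>i)\<close>.\<close>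

definition phi :: "nat \<Rightarrow> nat \<Rightarrow> nat" where
  "phi i j = scale div c i * min (c i) (2 * d i j)"

text \<open>The rows from \<open>m\<close> on express \<open>x\<^sub>j \<le> 1\<close>.\<close>

definition row_coeff :: "nat \<Rightarrow> nat \<Rightarrow> nat" where
  "row_coeff i j = (if i < m then phi i j else if i = m + j then 2 * scale else 0)"

lemma fits_finite: "fits T \<Longrightarrow> finite T"
  unfolding fits_def using finite_subset by blast

lemma fits_subset:
  assumes "fits T" "S \<subseteq> T"
  shows "fits S"
proof -
  have "(\<Sum>j\<in>S. d i j) \<le> (\<Sum>j\<in>T. d i j)" for i
    using assms fits_finite by (intro sum_mono2) auto
  then show ?thesis using assms unfolding fits_def by (meson le_less_trans order_trans)
qed

lemma fits_empty [simp]: "fits {}"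
  using capacity_pos by (simp add: fits_def)

lemma profit_eq: "fits T \<Longrightarrow> j \<in> T \<Longrightarrow> profit j = w j"
  using fits_subset[of T "{j}"] by (simp add: profit_def)

lemma scale_pos: "0 < scale"
  unfolding scale_def using capacity_pos by (intro prod_pos) auto

lemma capacity_mult_phi:
  assumes "i < m"
  shows "c i * phi i j = scale * min (c i) (2 * d i j)"
proof -
  have "c i dvd scale" unfolding scale_def using assms by (intro dvd_prodI) auto
  then show ?thesis by (simp add: phi_def flip: mult.assoc)
qed

lemma phi_le_scale:
  assumes "i < m"
  shows "phi i j \<le> scale"
proof -
  have "c i * phi i j \<le> c i * scale"
    unfolding capacity_mult_phi[OF assms] by (simp add: mult.commute)
  then show ?thesis using capacity_pos[OF assms] by simp
qed

lemma phi_pos_iff: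
  assumes "i < m"
  shows "0 < phi i j \<longleftrightarrow> 0 < d i j"
  using capacity_mult_phi[OF assms, of j] capacity_pos[OF assms] scale_pos
  by (cases "d i j = 0") (auto intro: gr0I)

lemma row_coeff_le: "row_coeff i j \<le> 2 * scale"
  using phi_le_scale[of i j] by (auto simp: row_coeff_def)

lemma sum_phi_le:
  assumes "fits T" "i < m"
  shows "(\<Sum>j\<in>T. phi i j) \<le> 2 * scale"
proof -
  have "c i * (\<Sum>j\<in>T. phi i j) = scale * (\<Sum>j\<in>T. min (c i) (2 * d i j))"
    by (simp add: sum_distrib_left capacity_mult_phi[OF assms(2)])
  also have "\<dots> \<le> scale * (\<Sum>j\<in>T. 2 * d i j)" by (intro mult_left_mono sum_mono) auto
  also have "\<dots> \<le> scale * (2 * c i)"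
    using assms by (simp add: fits_def less_imp_le flip: sum_distrib_left)
  finally have "c i * (\<Sum>j\<in>T. phi i j) \<le> c i * (2 * scale)" by (simp add: mult_ac)
  then show ?thesis using capacity_pos[OF assms(2)] by simp
qed

lemma sum_row_coeff_le:
  assumes "fits T"
  shows "(\<Sum>j\<in>T. row_coeff i j) \<le> 2 * scale"
proof (cases "i < m")
  case True
  then show ?thesis using sum_phi_le[OF assms] by (simp add: row_coeff_def)
next
  case False
  then have "(\<Sum>j\<in>T. row_coeff i j) = (\<Sum>j\<in>T. if j = i - m then 2 * scale else 0)"
    by (intro sum.cong) (auto simp: row_coeff_def)
  then show ?thesis using fits_finite[OF assms] by simp
qed

subsection \<open>The fractional solution\<close>

definition entry :: "nat \<Rightarrow> nat \<Rightarrow> real" where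
  "entry i j = real (row_coeff i j) / real (2 * scale)"

sublocale lp: packing_lp "{..<m + n}" "{..<n}" entry "\<lambda>j. real (profit j)"
proof
  show "entry i j \<le> 1" for i j
    unfolding entry_def using row_coeff_le[of i j] scale_pos
    by (simp add: divide_le_eq_1 flip: of_nat_mult)
qed (auto simp: entry_def)

lemma fits_packed:
  assumes "fits T"
  shows "lp.packed T"
proof -
  have "(\<Sum>j\<in>T. entry i j) \<le> 1" for i
    unfolding entry_def sum_divide_distrib[symmetric]
    using sum_row_coeff_le[OF assms, of i] scale_pos
    by (simp add: divide_le_eq_1 flip: of_nat_mult of_nat_sum)
  then show ?thesis using assms by (simp add: lp.packed_def fits_def)
qed

text \<open>After \<open>t\<close> rounds, in which the items \<open>b 0, \<dots>, b (t - 1)\<close> were picked, the prices \<open>Y\<close> carry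
  the common factor \<open>(2 \<cdot> scale) ^ t\<close>.\<close>

definition mw_state :: "nat \<Rightarrow> (nat \<Rightarrow> nat) \<Rightarrow> (nat \<Rightarrow> nat) \<Rightarrow> (nat \<Rightarrow> nat) \<Rightarrow> bool" where
  "mw_state t b X Y \<longleftrightarrow> lp.best_picks b t \<and> (\<forall>j<n. X j = card {s. s < t \<and> b s = j}) \<and>
     (\<forall>i<m + n. real (Y i) = real (2 * scale) ^ t * lp.price b t i)"

lemma mw_state_0: "(\<And>j. j < n \<Longrightarrow> X j = 0) \<Longrightarrow> (\<And>i. i < m + n \<Longrightarrow> Y i = 1) \<Longrightarrow> mw_state 0 b X Y"
  by (simp add: mw_state_def lp.price_def)

definition item_cost :: "(nat \<Rightarrow> nat) \<Rightarrow> nat \<Rightarrow> nat" where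
  "item_cost Y j = (\<Sum>i<m + n. row_coeff i j * Y i)"

definition best_item :: "(nat \<Rightarrow> nat) \<Rightarrow> nat \<Rightarrow> bool" where
  "best_item Y j \<longleftrightarrow> j < n \<and> (\<forall>l<n. profit l * item_cost Y j \<le> profit j * item_cost Y l)"

lemma mw_state_Suc:
  assumes state: "mw_state t b X Y" and best: "best_item Y j"
  shows "mw_state (Suc t) (b(t := j)) (X(j := Suc (X j))) (\<lambda>i. Y i * (2 * scale + row_coeff i j))"
proof -
  let ?Q = "real (2 * scale)"
  have Q_pos: "0 < ?Q" using scale_pos by simp
  have j_less: "j < n" using best by (simp add: best_item_def)
  have cost: "real (item_cost Y l) = ?Q ^ Suc t * lp.cost b t l" for l
    using state Q_pos
    by (simp add: item_cost_def mw_state_def lp.cost_def entry_def sum_distrib_left mult_ac)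
  have "real (profit l) * lp.cost b t j \<le> real (profit j) * lp.cost b t l" if "l < n" for l
  proof -
    have "real (profit l * item_cost Y j) \<le> real (profit j * item_cost Y l)"
      using best that by (intro of_nat_mono) (simp add: best_item_def)
    then have "?Q ^ Suc t * (real (profit l) * lp.cost b t j)
        \<le> ?Q ^ Suc t * (real (profit j) * lp.cost b t l)"
      unfolding of_nat_mult cost by (simp only: mult_ac)
    then show ?thesis using Q_pos by (simp only: mult_le_cancel_left_pos zero_less_power)
  qed
  then have "lp.best_picks (b(t := j)) (Suc t)"
    using state j_less by (intro lp.best_picks_Suc) (auto simp: mw_state_def)
  moreover have "(X(j := Suc (X j))) l = card {s. s < Suc t \<and> (b(t := j)) s = l}" if "l < n" for l
  proof -
    have "{s. s < Suc t \<and> (b(t := j)) s = l} =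
        (if l = j then insert t {s. s < t \<and> b s = l} else {s. s < t \<and> b s = l})"
      by auto
    then show ?thesis using state that by (simp add: mw_state_def)
  qed
  moreover have
    "real (Y i * (2 * scale + row_coeff i j)) = ?Q ^ Suc t * lp.price (b(t := j)) (Suc t) i"
    if "i < m + n" for i
    using state that Q_pos by (simp add: mw_state_def lp.price_Suc entry_def field_simps)
  ultimately show ?thesis by (simp add: mw_state_def)
qed

lemma mw_state_price_bounds:
  assumes "mw_state t b X Y" "i < m + n"
  shows "0 < Y i" "Y i \<le> (4 * scale) ^ t"
proof -
  have Y_eq: "real (Y i) = real (2 * scale) ^ t * lp.price b t i"
    and price: "1 \<le> lp.price b t i" "lp.price b t i \<le> 2 ^ t"
    using assms lp.price_bounds by (auto simp: mw_state_def)
  have "0 < real (Y i)" unfolding Y_eq using price(1) scale_pos by (intro mult_pos_pos) auto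
  then show "0 < Y i" by simp
  have "real (Y i) \<le> real (2 * scale) ^ t * 2 ^ t"
    unfolding Y_eq using price(2) by (intro mult_left_mono) auto
  also have "\<dots> = (real (2 * scale) * 2) ^ t" by (rule power_mult_distrib[symmetric])
  also have "\<dots> = real ((4 * scale) ^ t)" by simp
  finally show "Y i \<le> (4 * scale) ^ t" by linarith
qed

lemma item_cost_pos:
  assumes "mw_state t b X Y" "j < n"
  shows "0 < item_cost Y j"
proof -
  have "0 < row_coeff (m + j) j * Y (m + j)"
    using mw_state_price_bounds(1)[OF assms(1), of "m + j"] scale_pos assms(2)
    by (simp add: row_coeff_def)
  also have "\<dots> \<le> item_cost Y j"
    unfolding item_cost_def using assms(2)
    by (intro member_le_sum[of "m + j" _ "\<lambda>i. row_coeff i j * Y i"]) auto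
  finally show ?thesis .
qed

lemma mw_state_sum_picks:
  fixes f :: "nat \<Rightarrow> real"
  assumes "mw_state t b X Y"
  shows "(\<Sum>s<t. f (b s)) = (\<Sum>j<n. f j * real (X j))"
proof -
  have "b ` {..<t} \<subseteq> {..<n}" using assms by (auto simp: mw_state_def dest: lp.best_picks_in)
  then have "(\<Sum>s<t. f (b s)) = (\<Sum>j<n. \<Sum>s\<in>{s \<in> {..<t}. b s = j}. f (b s))"
    by (intro sum.group[symmetric]) auto
  also have "\<dots> = (\<Sum>j<n. f j * real (X j))"
    using assms by (intro sum.cong) (auto simp: mw_state_def)
  finally show ?thesis .
qed

lemma mw_state_count:
  assumes "mw_state t b X Y"
  shows "(\<Sum>j<n. X j) = t"
proof -
  have "real (\<Sum>j<n. X j) = real t" using mw_state_sum_picks[OF assms, of "\<lambda>_. 1"] by simp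
  then show ?thesis by (simp only: of_nat_eq_iff)
qed

lemma mw_state_load:
  assumes "mw_state t b X Y"
  shows "lp.load b t i = (\<Sum>j<n. real (row_coeff i j) * real (X j)) / real (2 * scale)"
  unfolding lp.load_def mw_state_sum_picks[OF assms] by (simp add: entry_def sum_divide_distrib)

lemma mw_state_load_item:
  assumes "mw_state t b X Y" "j < n"
  shows "lp.load b t (m + j) = real (X j)"
proof -
  have "(\<Sum>l<n. real (row_coeff (m + j) l) * real (X l))
      = (\<Sum>l<n. if l = j then real (2 * scale) * real (X j) else 0)"
    by (intro sum.cong) (auto simp: row_coeff_def)
  then show ?thesis using assms(2) scale_pos by (simp add: mw_state_load[OF assms(1)])
qed

abbreviation rounds :: nat where
  "rounds \<equiv> 32 * ((m + n) * n)"

text \<open>The point \<open>X / N\<close> satisfies the relaxation.\<close>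

definition fractional :: "(nat \<Rightarrow> nat) \<Rightarrow> real \<Rightarrow> bool" where
  "fractional X N \<longleftrightarrow> 0 < N \<and> (\<forall>j<n. real (X j) \<le> N) \<and>
     (\<forall>i<m. (\<Sum>j<n. real (phi i j) * real (X j)) \<le> 2 * real scale * N)"

lemma mw_objective_ge:
  assumes state: "mw_state rounds b X Y" and i_less: "i < m + n"
    and large: "32 * real (m + n) \<le> lp.load b rounds i" and T_fits: "fits T"
  shows "5 / 8 * lp.load b rounds i * (\<Sum>j\<in>T. real (profit j))
      \<le> (\<Sum>j<n. real (profit j) * real (X j))"
proof (cases "0 < (\<Sum>j\<in>T. real (profit j))")
  case True
  let ?N = "lp.load b rounds i"
  define r where "r = (\<Sum>j<n. real (profit j) * real (X j)) / (\<Sum>j\<in>T. real (profit j))"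
  have size_pos: "0 < real (m + n)" using i_less by simp
  then have N_pos: "0 < ?N" using large by (intro less_le_trans[OF _ large]) simp
  have "?N * (2 / 3) \<le> ?N * ln 2" using ln2_ge_two_thirds N_pos by (intro mult_left_mono) auto
  also have "\<dots> \<le> ln (real (m + n)) + r"
    using lp.multiplicative_weights[OF _ fits_packed[OF T_fits] True, of b rounds i] state i_less
    by (simp add: mw_state_sum_picks[OF state, of "\<lambda>j. real (profit j)"] mw_state_def r_def)
  also have "\<dots> \<le> real (m + n) + r" using ln_le_minus_one[OF size_pos] by simp
  also have "\<dots> \<le> ?N / 32 + r" using large by simp
  finally have "5 / 8 * ?N \<le> r" using N_pos by simp
  then show ?thesis using True by (simp add: r_def pos_le_divide_eq)
next
  case False
  then have "(\<Sum>j\<in>T. real (profit j)) = 0" by (simp add: sum_nonneg order_antisym)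
  then show ?thesis by (simp add: sum_nonneg)
qed

lemma fractional_solution:
  assumes state: "mw_state rounds b X Y" and n_pos: "0 < n"
  obtains N where "fractional X N"
    "\<And>T. fits T \<Longrightarrow> 5 / 8 * N * (\<Sum>j\<in>T. real (profit j)) \<le> (\<Sum>j<n. real (profit j) * real (X j))"
proof -
  define N where "N = Max (lp.load b rounds ` {..<m + n})"
  have load_le: "lp.load b rounds i \<le> N" if "i < m + n" for i
    unfolding N_def using that by (intro Max_ge) auto
  have "N \<in> lp.load b rounds ` {..<m + n}"
    unfolding N_def using n_pos by (intro Max_in) auto
  then obtain i where max_row: "i < m + n" "lp.load b rounds i = N" by auto
  have X_le: "real (X j) \<le> N" if "j < n" for j
    using load_le[of "m + j"] mw_state_load_item[OF state that] that by simp
  have "real rounds = (\<Sum>j<n. real (X j))"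
    unfolding mw_state_count[OF state, symmetric] by (rule of_nat_sum)
  also have "\<dots> \<le> (\<Sum>j<n. N)" using X_le by (intro sum_mono) auto
  finally have "real n * (32 * real (m + n)) \<le> real n * N" by (simp add: mult_ac)
  then have N_large: "32 * real (m + n) \<le> N" using n_pos by simp
  then have N_pos: "0 < N" using n_pos by (intro less_le_trans[OF _ N_large]) simp
  have rows: "(\<Sum>j<n. real (phi i j) * real (X j)) \<le> 2 * real scale * N" if "i < m" for i
    using load_le[of i] that scale_pos unfolding mw_state_load[OF state]
    by (simp add: row_coeff_def pos_divide_le_eq mult_ac)
  have objective: "5 / 8 * N * (\<Sum>j\<in>T. real (profit j)) \<le> (\<Sum>j<n. real (profit j) * real (X j))"
    if "fits T" for T
    using mw_objective_ge[OF state max_row(1) _ that] N_large by (simp add: max_row(2))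
  have "fractional X N" using N_pos X_le rows by (simp add: fractional_def)
  then show ?thesis using objective by (rule that)
qed

subsection \<open>Rounding\<close>

definition share :: "nat \<Rightarrow> nat \<Rightarrow> nat" where
  "share j l = (\<Sum>i<m. of_bool (0 < phi i j) * phi i l)"

definition kernel :: "nat \<Rightarrow> nat \<Rightarrow> nat" where
  "kernel j l = share j l + share l j"

definition pending :: "(nat \<Rightarrow> nat) \<Rightarrow> nat \<Rightarrow> nat set" where
  "pending q p = {..<n} - q ` {..<p}"

definition kernel_degree :: "(nat \<Rightarrow> nat) \<Rightarrow> nat set \<Rightarrow> nat \<Rightarrow> nat" where
  "kernel_degree X A j = (\<Sum>l\<in>A. X l * kernel j l)"

definition minimal_degree :: "(nat \<Rightarrow> nat) \<Rightarrow> nat set \<Rightarrow> nat \<Rightarrow> bool" where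
  "minimal_degree X A b \<longleftrightarrow> b \<in> A \<and> (\<forall>j\<in>A. kernel_degree X A b \<le> kernel_degree X A j)"

definition residual :: "(nat \<Rightarrow> nat) \<Rightarrow> (nat \<Rightarrow> nat) \<Rightarrow> nat \<Rightarrow> nat \<Rightarrow> real" where
  "residual q U p l = max 0 (real (profit l) -
     (\<Sum>a<p. real (U (q a)) / real scale ^ a * (real (kernel (q a) l) / real scale)))"

text \<open>The items \<open>q 0, \<dots>, q (p - 1)\<close> are processed. The entry \<open>U l\<close> is the residual profit of \<open>l\<close>,
  scaled by \<open>scale ^ p\<close> while \<open>l\<close> is pending and by \<open>scale ^ a\<close> if \<open>l = q a\<close>.\<close>

definition lr_state :: "nat \<Rightarrow> (nat \<Rightarrow> nat) \<Rightarrow> (nat \<Rightarrow> nat) \<Rightarrow> (nat \<Rightarrow> nat) \<Rightarrow> bool" where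
  "lr_state p X q U \<longleftrightarrow> inj_on q {..<p} \<and> q ` {..<p} \<subseteq> {..<n} \<and>
     (\<forall>a<p. real (U (q a)) / real scale ^ a = residual q U a (q a)) \<and>
     (\<forall>l\<in>pending q p. real (U l) / real scale ^ p = residual q U p l) \<and>
     (\<forall>a<p. minimal_degree X (pending q a) (q a))"

lemma share_le: "share j l \<le> m * scale"
proof -
  have "share j l \<le> (\<Sum>i<m. scale)" unfolding share_def using phi_le_scale by (intro sum_mono) auto
  then show ?thesis by simp
qed

lemma kernel_le: "kernel j l \<le> 2 * (m * scale)"
  unfolding kernel_def using share_le[of j l] share_le[of l j] by simp

lemma kernel_eq_sum:
  "kernel j l = (\<Sum>i<m. of_bool (0 < phi i j) * phi i l + of_bool (0 < phi i l) * phi i j)"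
  by (simp add: kernel_def share_def sum.distrib)

lemma phi_le_share: "i < m \<Longrightarrow> 0 < phi i j \<Longrightarrow> phi i l \<le> share j l"
  unfolding share_def using member_le_sum[of i "{..<m}" "\<lambda>i. of_bool (0 < phi i j) * phi i l"]
  by simp

lemma sum_share_le:
  fixes x :: "nat \<Rightarrow> real"
  assumes "card {i. i < m \<and> 0 < d i j} \<le> k"
    and "\<And>i. i < m \<Longrightarrow> (\<Sum>l\<in>A. real (phi i l) * x l) \<le> \<beta>" and "0 \<le> \<beta>"
  shows "(\<Sum>l\<in>A. real (share j l) * x l) \<le> real k * \<beta>"
proof -
  let ?R = "{i \<in> {..<m}. 0 < phi i j}"
  have "?R = {i. i < m \<and> 0 < d i j}" using phi_pos_iff by auto
  then have card: "card ?R \<le> k" using assms(1) by simp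
  have "real (share j l) = (\<Sum>i\<in>?R. real (phi i l))" for l
    unfolding share_def of_nat_sum sum.inter_filter[OF finite_lessThan] by (intro sum.cong) auto
  then have "(\<Sum>l\<in>A. real (share j l) * x l) = (\<Sum>i\<in>?R. \<Sum>l\<in>A. real (phi i l) * x l)"
    by (simp only: sum_distrib_right) (rule sum.swap)
  also have "\<dots> \<le> (\<Sum>i\<in>?R. \<beta>)" using assms(2) by (intro sum_mono) auto
  also have "\<dots> \<le> real k * \<beta>" using card \<open>0 \<le> \<beta>\<close> by (simp add: mult_right_mono)
  finally show ?thesis .
qed

text \<open>If \<open>j\<close> is large in the violated row \<open>i\<close>, that is \<open>phi i j = scale\<close>, then a single other item
  in that row suffices. Otherwise the items in \<open>G\<close> fill more than half of the row.\<close>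

lemma blocked_kernel_ge:
  assumes G_fits: "fits G" and j_fits: "fits {j}" and blocked: "\<not> fits (insert j G)"
  shows "scale \<le> (\<Sum>l\<in>G. kernel j l)"
proof -
  have fin: "finite G" using G_fits by (rule fits_finite)
  have "j \<notin> G" using G_fits blocked by (auto simp: insert_absorb)
  then obtain i where i_less: "i < m" and overflow: "c i \<le> d i j + (\<Sum>l\<in>G. d i l)"
    using G_fits j_fits blocked fin by (auto simp: fits_def not_less)
  have demand_pos: "0 < d i j" using G_fits i_less overflow by (force simp: fits_def)
  then have phi_pos: "0 < phi i j" using phi_pos_iff[OF i_less] by simp
  show ?thesis
  proof (cases "c i \<le> 2 * d i j")
    case True
    have "d i j < c i" using j_fits i_less by (simp add: fits_def)
    then have "(\<Sum>l\<in>G. d i l) \<noteq> 0" using overflow by linarith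
    then obtain l where other: "l \<in> G" "0 < d i l" using fin by auto
    have "c i * phi i j = c i * scale"
      unfolding capacity_mult_phi[OF i_less] using True by (simp add: min_absorb1)
    then have "scale = phi i j" using capacity_pos[OF i_less] by simp
    also have "\<dots> \<le> share l j" using phi_le_share[OF i_less] other(2) phi_pos_iff[OF i_less] by blast
    also have "\<dots> \<le> kernel j l" by (simp add: kernel_def)
    also have "\<dots> \<le> (\<Sum>l\<in>G. kernel j l)" using other(1) fin by (intro member_le_sum) auto
    finally show ?thesis .
  next
    case False
    have "c i \<le> (\<Sum>l\<in>G. 2 * d i l)"
      using False overflow unfolding sum_distrib_left[symmetric] by linarith
    then have "c i * scale = scale * min (c i) (\<Sum>l\<in>G. 2 * d i l)" by (simp add: min_absorb1)
    also have "\<dots> \<le> scale * (\<Sum>l\<in>G. min (c i) (2 * d i l))"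
      using fin by (intro mult_left_mono min_sum_le) auto
    also have "\<dots> = c i * (\<Sum>l\<in>G. phi i l)"
      by (simp add: sum_distrib_left capacity_mult_phi[OF i_less])
    finally have "scale \<le> (\<Sum>l\<in>G. phi i l)" using capacity_pos[OF i_less] by simp
    also have "\<dots> \<le> (\<Sum>l\<in>G. kernel j l)"
      using phi_le_share[OF i_less phi_pos] by (intro sum_mono) (simp add: kernel_def trans_le_add1)
    finally show ?thesis .
  qed
qed

lemma residual_cong:
  "(\<And>a. a < p \<Longrightarrow> q' a = q a \<and> U' (q a) = U (q a)) \<Longrightarrow> residual q' U' p l = residual q U p l"
  by (simp add: residual_def)

lemma residual_Suc:
  "residual q U (Suc p) l =
     max 0 (residual q U p l -
       real (U (q p)) / real scale ^ p * (real (kernel (q p) l) / real scale))"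
proof -
  have "0 \<le> real (U (q p)) / real scale ^ p * (real (kernel (q p) l) / real scale)" by simp
  then show ?thesis unfolding residual_def sum.lessThan_Suc by linarith
qed

lemma residual_le_profit: "residual q U p l \<le> real (profit l)"
  by (simp add: residual_def sum_nonneg)

lemma lr_state_residual_le:
  assumes "lr_state p X q U" "l \<in> pending q p"
  shows "U l \<le> w l * scale ^ p"
proof -
  have "real (U l) / real scale ^ p \<le> real (profit l)"
    using assms residual_le_profit[of q U p l] by (simp add: lr_state_def)
  also have "\<dots> \<le> real (w l)" by (simp add: profit_def)
  finally have "real (U l) \<le> real (w l * scale ^ p)" using scale_pos by (simp add: pos_divide_le_eq)
  then show ?thesis by (simp only: of_nat_le_iff)
qed

lemma lr_state_0: "(\<And>j. j < n \<Longrightarrow> U j = profit j) \<Longrightarrow> lr_state 0 X q U"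
  by (simp add: lr_state_def pending_def residual_def)

lemma pending_fun_upd [simp]: "a \<le> p \<Longrightarrow> pending (q(p := b)) a = pending q a"
  by (auto simp: pending_def)

lemma pending_fun_upd_Suc: "pending (q(p := b)) (Suc p) = pending q p - {b}"
  by (auto simp: pending_def lessThan_Suc)

lemma lr_state_Suc:
  assumes state: "lr_state p X q U" and minimal: "minimal_degree X (pending q p) b"
    and update: "\<And>l. l < n \<Longrightarrow>
       U' l = (if l \<in> pending q p - {b} then U l * scale - U b * kernel b l else U l)"
  shows "lr_state (Suc p) X (q(p := b)) U'"
proof -
  let ?q = "q(p := b)"
  have b_pending: "b \<in> pending q p" using minimal by (simp add: minimal_degree_def)
  have placed: "U' (q a) = U (q a)" if "a < p" for a
    using state update[of "q a"] that by (force simp: lr_state_def pending_def)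
  have update_b: "U' b = U b" using update[of b] b_pending by (simp add: pending_def)
  have old: "residual ?q U' a l = residual q U a l" if "a \<le> p" for a l
    using placed that by (intro residual_cong) auto
  have "real (U' l) / real scale ^ Suc p = residual ?q U' (Suc p) l"
    if l_pending: "l \<in> pending q p - {b}" for l
  proof -
    have "real (U' l) / real scale ^ Suc p
        = max 0 (real (U l) * real scale - real (U b) * real (kernel b l)) / real scale ^ Suc p"
      using update[of l] l_pending by (simp add: real_diff_nat pending_def)
    also have "\<dots> = max 0 (real (U l) / real scale ^ p -
        real (U b) / real scale ^ p * (real (kernel b l) / real scale))"
      using scale_pos by (simp add: max_divide_distrib_right diff_divide_distrib mult.commute)
    also have "\<dots> = residual ?q U' (Suc p) l"
      using state l_pending by (simp add: residual_Suc old update_b lr_state_def)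
    finally show ?thesis .
  qed
  moreover have "real (U' (?q a)) / real scale ^ a = residual ?q U' a (?q a)" if "a < Suc p" for a
    using state b_pending placed update_b that by (cases "a = p") (simp_all add: old lr_state_def)
  moreover have "minimal_degree X (pending ?q a) (?q a)" if "a < Suc p" for a
    using state minimal that by (cases "a = p") (simp_all add: lr_state_def)
  moreover have "inj_on ?q {..<Suc p}"
    using state b_pending inj_on_fun_updI[of q "{..<p}" b p]
    by (simp add: lessThan_Suc lr_state_def pending_def)
  moreover have "?q ` {..<Suc p} \<subseteq> {..<n}"
    using state b_pending by (auto simp: lessThan_Suc lr_state_def pending_def)
  ultimately show ?thesis by (simp add: lr_state_def pending_fun_upd_Suc)
qed

definition selectable :: "(nat \<Rightarrow> nat) \<Rightarrow> nat set \<Rightarrow> bool" where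
  "selectable U S \<longleftrightarrow> fits S \<and> (\<forall>j\<in>S. 0 < U j)"

lemma selectable_empty [simp]: "selectable U {}"
  by (simp add: selectable_def)

lemma selectable_insert_iff:
  assumes "selectable U G" "j < n" "j \<notin> G"
  shows "selectable U (insert j G) \<longleftrightarrow> 0 < U j \<and> (\<forall>i<m. (\<Sum>l\<in>G. d i l) + d i j < c i)"
  using assms fits_finite[of G] by (auto simp: selectable_def fits_def add.commute)

lemma lr_state_bij_betw:
  assumes "lr_state n X q U"
  shows "bij_betw q {..<n} {..<n}"
  using assms endo_inj_surj[of "{..<n}" q] by (simp add: lr_state_def bij_betw_def)

lemma pending_nonempty:
  assumes "p < n"
  shows "pending q p \<noteq> {}"
proof
  assume "pending q p = {}"
  then have "n \<le> card (q ` {..<p})"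
    unfolding pending_def using card_mono[of "q ` {..<p}" "{..<n}"] by auto
  then show False using card_image_le[of "{..<p}" q] assms by simp
qed

lemma pending_eq_image:
  assumes "bij_betw q {..<n} {..<n}" "a \<le> n"
  shows "pending q a = q ` {a..<n}"
proof -
  have "pending q a = q ` ({..<n} - {..<a})"
    using assms by (subst inj_on_image_set_diff[of q "{..<n}"])
      (auto simp: pending_def bij_betw_def)
  then show ?thesis using assms(2) by (simp add: lessThan_minus_lessThan)
qed

lemma fractional_mass_le:
  fixes x :: "nat \<Rightarrow> real"
  assumes state: "lr_state n X q U" and a_less: "a < n"
    and sparse: "\<And>j. j < n \<Longrightarrow> card {i. i < m \<and> 0 < d i j} \<le> k"
    and frac: "fractional X N"
  shows "real (X (q a)) + (\<Sum>b\<in>{a<..<n}. real (kernel (q a) (q b)) / real scale * real (X (q b)))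
    \<le> (4 * real k + 1) * N"
proof -
  let ?A = "pending q a"
  have N_pos: "0 < N" using frac by (simp add: fractional_def)
  have bij: "bij_betw q {..<n} {..<n}" using state by (rule lr_state_bij_betw)
  have pending_items: "finite ?A" "?A \<subseteq> {..<n}" by (auto simp: pending_def)
  have "(\<Sum>l\<in>?A. real (phi i l) * real (X l)) \<le> (\<Sum>j<n. real (phi i j) * real (X j))" for i
    using pending_items by (intro sum_mono2) auto
  then have "(\<Sum>l\<in>?A. real (phi i l) * real (X l)) \<le> 2 * real scale * N" if "i < m" for i
    using frac that order_trans unfolding fractional_def by blast
  then have out_degree: "(\<Sum>l\<in>?A. real (share j l) * real (X l)) \<le> real k * (2 * real scale * N)"
    if "j \<in> ?A" for j
    using sparse[of j] that pending_items(2) N_pos by (intro sum_share_le) auto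
  have degree_eq: "real (kernel_degree X ?A j) =
      (\<Sum>l\<in>?A. (real (share j l) + real (share l j)) * real (X l))" for j
    by (simp add: kernel_degree_def kernel_def mult.commute)
  have "q ` {a<..<n} \<subseteq> ?A" using pending_eq_image[OF bij] a_less by auto
  then have "(\<Sum>l\<in>q ` {a<..<n}. real (kernel (q a) l) * real (X l))
      \<le> (\<Sum>l\<in>?A. real (kernel (q a) l) * real (X l))"
    using pending_items(1) by (intro sum_mono2) auto
  then have "(\<Sum>b\<in>{a<..<n}. real (kernel (q a) (q b)) * real (X (q b)))
      \<le> real (kernel_degree X ?A (q a))"
    using bij by (subst (asm) sum.reindex)
      (auto simp: kernel_degree_def bij_betw_def inj_on_def mult.commute)
  also have "\<dots> \<le> 2 * (real k * (2 * real scale * N))"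
    unfolding degree_eq
  proof (rule weighted_min_degree_le[OF pending_items(1) _ out_degree])
    show "(\<Sum>l\<in>?A. (real (share (q a) l) + real (share l (q a))) * real (X l))
        \<le> (\<Sum>l\<in>?A. (real (share j l) + real (share l j)) * real (X l))" if "j \<in> ?A" for j
      using state a_less that unfolding degree_eq[symmetric] of_nat_le_iff
      by (simp add: lr_state_def minimal_degree_def)
  qed (use N_pos in auto)
  finally have "(\<Sum>b\<in>{a<..<n}. real (kernel (q a) (q b)) / real scale * real (X (q b)))
      \<le> 4 * real k * N"
    using scale_pos by (simp add: field_simps flip: sum_divide_distrib)
  moreover have "real (X (q a)) \<le> N"
    using frac bij a_less by (auto simp: fractional_def bij_betw_def)
  ultimately show ?thesis by (simp add: algebra_simps)
qed

lemma selected_mass_ge: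
  assumes state: "lr_state n X q U" and a_less: "a < n" and U_pos: "0 < U (q a)"
  defines "F \<equiv> greedy (selectable U) (map q [0..<n])"
  shows "1 \<le> of_bool (q a \<in> F) +
    (\<Sum>b\<in>{a<..<n}. real (kernel (q a) (q b)) / real scale * of_bool (q b \<in> F))"
proof (cases "q a \<in> F")
  case True
  then show ?thesis by (simp add: sum_nonneg)
next
  case False
  define G where "G = greedy (selectable U) (map q [Suc a..<n])"
  have bij: "bij_betw q {..<n} {..<n}" using state by (rule lr_state_bij_betw)
  have split: "map q [0..<n] = map q [0..<a] @ q a # map q [Suc a..<n]"
    using upt_add_eq_append[of 0 a "n - a"] upt_conv_Cons[OF a_less] a_less by simp
  have "0 < real (U (q a)) / real scale ^ a" using U_pos scale_pos by simp
  also have "\<dots> \<le> real (profit (q a))"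
    using state a_less residual_le_profit by (simp add: lr_state_def)
  finally have "0 < profit (q a)" by simp
  then have fits_a: "fits {q a}" by (auto simp: profit_def split: if_splits)
  have G_selectable: "selectable U G" unfolding G_def by (rule greedy_ok) simp
  moreover have "\<not> selectable U (insert (q a) G)"
    using greedy_maximal[of "q a" "selectable U" "map q [0..<a]" "map q [Suc a..<n]"] False
    unfolding F_def split G_def by blast
  ultimately have "\<not> fits (insert (q a) G)" "fits G" using U_pos by (auto simp: selectable_def)
  then have "scale \<le> (\<Sum>l\<in>G. kernel (q a) l)" using fits_a by (intro blocked_kernel_ge)
  also have "G \<subseteq> q ` {b\<in>{a<..<n}. q b \<in> F}"
    using greedy_subset[of "selectable U" "map q [Suc a..<n]"]
      greedy_append_mono[of "selectable U" "map q [Suc a..<n]" "map q [0..<a] @ [q a]"]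
    unfolding F_def split G_def by fastforce
  then have "(\<Sum>l\<in>G. kernel (q a) l) \<le> (\<Sum>l\<in>q ` {b\<in>{a<..<n}. q b \<in> F}. kernel (q a) l)"
    by (intro sum_mono2) auto
  also have "\<dots> = (\<Sum>b\<in>{b\<in>{a<..<n}. q b \<in> F}. kernel (q a) (q b))"
    using bij by (intro sum.reindex[unfolded comp_def]) (auto simp: bij_betw_def inj_on_def)
  also have "\<dots> = (\<Sum>b\<in>{a<..<n}. kernel (q a) (q b) * of_bool (q b \<in> F))"
    unfolding sum.inter_filter[OF finite_greaterThanLessThan] by (intro sum.cong) auto
  finally have "real scale \<le> real (\<Sum>b\<in>{a<..<n}. kernel (q a) (q b) * of_bool (q b \<in> F))"
    by (rule of_nat_mono)
  then show ?thesis using scale_pos False by (simp add: pos_le_divide_eq flip: sum_divide_distrib)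
qed

lemma fractional_le_greedy:
  assumes lr: "lr_state n X q U"
    and sparse: "\<And>j. j < n \<Longrightarrow> card {i. i < m \<and> 0 < d i j} \<le> k"
    and frac: "fractional X N"
  defines "F \<equiv> greedy (selectable U) (map q [0..<n])"
  shows "(\<Sum>j<n. real (profit j) * real (X j)) \<le> (4 * real k + 1) * N * (\<Sum>j\<in>F. real (profit j))"
proof -
  have bij: "bij_betw q {..<n} {..<n}" using lr by (rule lr_state_bij_betw)
  have F_selectable: "selectable U F" unfolding F_def by (rule greedy_ok) simp
  then have F_subset: "F \<subseteq> {..<n}" by (simp add: selectable_def fits_def)
  have "(\<Sum>a<n. real (profit (q a)) * real (X (q a))) \<le>
      ((4 * real k + 1) * N) * (\<Sum>a<n. real (profit (q a)) * of_bool (q a \<in> F))"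
  proof (rule local_ratio[where \<delta> = "\<lambda>a. real (U (q a)) / real scale ^ a"
        and \<kappa> = "\<lambda>a b. real (kernel (q a) (q b)) / real scale"])
    show "real (U (q a)) / real scale ^ a = max 0 (real (profit (q a)) -
        (\<Sum>b<a. real (U (q b)) / real scale ^ b * (real (kernel (q b) (q a)) / real scale)))"
      if "a < n" for a
      using lr that unfolding residual_def[symmetric] by (simp add: lr_state_def)
    show "1 \<le> of_bool (q a \<in> F) +
        (\<Sum>b\<in>{a<..<n}. real (kernel (q a) (q b)) / real scale * of_bool (q b \<in> F))"
      if "a < n" "0 < real (U (q a)) / real scale ^ a" for a
      using selected_mass_ge[OF lr that(1)] that(2) scale_pos
      by (simp add: F_def zero_less_divide_iff)
    show "0 < real (U (q a)) / real scale ^ a" if "of_bool (q a \<in> F) \<noteq> (0::real)" for a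
      using F_selectable that scale_pos by (simp add: selectable_def)
  qed (use fractional_mass_le[OF lr _ sparse frac] frac in \<open>auto simp: fractional_def\<close>)
  then have "(\<Sum>j<n. real (profit j) * real (X j)) \<le>
      (4 * real k + 1) * N * (\<Sum>j<n. real (profit j) * of_bool (j \<in> F))"
    by (simp only: sum.reindex_bij_betw[OF bij, of "\<lambda>j. real (profit j) * real (X j)"]
        sum.reindex_bij_betw[OF bij, of "\<lambda>j. real (profit j) * of_bool (j \<in> F)"])
  also have "(\<Sum>j<n. real (profit j) * of_bool (j \<in> F)) = (\<Sum>j\<in>F. real (profit j))"
    using F_subset by (intro sum.mono_neutral_cong_right) auto
  finally show ?thesis .
qed

theorem approximation_ratio:
  assumes mw: "mw_state rounds b X Y" and lr: "lr_state n X q U"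
    and sparse: "\<And>j. j < n \<Longrightarrow> card {i. i < m \<and> 0 < d i j} \<le> k" and k_pos: "1 \<le> k"
    and T_fits: "fits T"
  shows "(\<Sum>j\<in>T. w j) \<le> 8 * k * (\<Sum>j\<in>greedy (selectable U) (map q [0..<n]). w j)"
proof (cases "n = 0")
  case True
  moreover have "T \<subseteq> {..<n}" using T_fits by (simp add: fits_def)
  ultimately show ?thesis by simp
next
  case False
  then have n_pos: "0 < n" by simp
  let ?F = "greedy (selectable U) (map q [0..<n])"
  have F_selectable: "selectable U ?F" by (rule greedy_ok) simp
  obtain N where frac: "fractional X N" and objective: "\<And>T. fits T \<Longrightarrow>
      5 / 8 * N * (\<Sum>j\<in>T. real (profit j)) \<le> (\<Sum>j<n. real (profit j) * real (X j))"
    by (rule fractional_solution[OF mw n_pos]) (rule that)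
  have "N * (5 / 8 * (\<Sum>j\<in>T. real (profit j))) \<le> N * ((4 * real k + 1) * (\<Sum>j\<in>?F. real (profit j)))"
    using order_trans[OF objective[OF T_fits] fractional_le_greedy[OF lr sparse frac]]
    by (simp only: mult_ac)
  then have "5 / 8 * (\<Sum>j\<in>T. real (profit j)) \<le> (4 * real k + 1) * (\<Sum>j\<in>?F. real (profit j))"
    using frac by (simp add: fractional_def)
  also have "\<dots> \<le> 5 * real k * (\<Sum>j\<in>?F. real (profit j))"
    using k_pos by (intro mult_right_mono) (auto intro: sum_nonneg)
  finally have "(\<Sum>j\<in>T. real (profit j)) \<le> 8 * real k * (\<Sum>j\<in>?F. real (profit j))" by simp
  moreover have "(\<Sum>j\<in>S. real (profit j)) = real (\<Sum>j\<in>S. w j)" if "fits S" for S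
    using profit_eq[OF that] by simp
  ultimately have "real (\<Sum>j\<in>T. w j) \<le> real (8 * k * (\<Sum>j\<in>?F. w j))"
    using T_fits F_selectable by (simp add: selectable_def)
  then show ?thesis by (simp only: of_nat_le_iff)
qed

end

section \<open>A Hoare logic with resource bounds\<close>

notation
  Cell ("_\<^bold>[_\<^bold>]" [1000, 0] 999) and
  Add (infixl "\<^bold>+" 65) and
  Sub (infixl "\<^bold>-" 65) and
  Mul (infixl "\<^bold>*" 70) and
  Div (infixl "\<^bold>'/" 70) and
  Less (infix "\<^bold><" 50) and
  Not ("\<^bold>\<not> _" [40] 40) and
  And (infixr "\<^bold>\<and>" 35) and
  Assign ("_\<^bold>[_\<^bold>] ::= _" [1000, 0, 61] 61) and
  Seq (infixr ";;" 60) and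
  Cond ("(IF _/ THEN _/ ELSE _)" [0, 0, 61] 61) and
  While ("(WHILE _/ DO _)" [0, 61] 61)

abbreviation Var :: "string \<Rightarrow> aexp" where
  "Var x \<equiv> x\<^bold>[Const 0\<^bold>]"

abbreviation Assign_Var :: "string \<Rightarrow> aexp \<Rightarrow> com" ("_ ::= _" [1000, 61] 61) where
  "x ::= e \<equiv> x\<^bold>[Const 0\<^bold>] ::= e"

definition For :: "string \<Rightarrow> aexp \<Rightarrow> com \<Rightarrow> com" ("(FOR _ < _/ DO _)" [1000, 51, 61] 61) where
  "FOR v < h DO c =
     v ::= Const 0;; WHILE Var v \<^bold>< h DO (c;; v ::= Var v \<^bold>+ Const 1)"

definition iterate :: "string \<Rightarrow> aexp \<Rightarrow> aexp \<Rightarrow> string \<Rightarrow> aexp \<Rightarrow> aexp \<Rightarrow> com" where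
  "iterate x a z v h e = x\<^bold>[a\<^bold>] ::= z;; FOR v < h DO x\<^bold>[a\<^bold>] ::= e"

definition select :: "string \<Rightarrow> string \<Rightarrow> aexp \<Rightarrow> bexp \<Rightarrow> com" where
  "select b v h g = b ::= Const 0;; FOR v < h DO IF g THEN b ::= Var v ELSE Skip"

subsection \<open>Running time from program size\<close>

fun asize :: "aexp \<Rightarrow> nat" where
  "asize (Const n) = bit_length n"
| "asize (Cell x a) = asize a + 1"
| "asize (Add a b) = asize a + asize b + 1"
| "asize (Sub a b) = asize a + asize b + 1"
| "asize (Mul a b) = asize a + asize b + 1"
| "asize (Div a b) = asize a + asize b + 1"

fun bsize :: "bexp \<Rightarrow> nat" where
  "bsize (Less a b) = (asize a)\<^sup>2 + (asize b)\<^sup>2 + 1"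
| "bsize (Not b) = bsize b + 1"
| "bsize (And b c) = bsize b + bsize c + 1"

fun csize :: "nat \<Rightarrow> com \<Rightarrow> nat" where
  "csize K Skip = 1"
| "csize K (Assign x a e) = (asize a)\<^sup>2 + (asize e)\<^sup>2 + 1"
| "csize K (Flip x) = 1"
| "csize K (Seq c d) = csize K c + csize K d"
| "csize K (Cond b c d) = bsize b + csize K c + csize K d"
| "csize K (While b c) = (K + 1) * bsize b + K * csize K c"

definition bounded_state :: "nat \<Rightarrow> state \<Rightarrow> bool" where
  "bounded_state B s \<longleftrightarrow> (\<forall>x i. s x i < 2 ^ B)"

lemma bit_length_le: "n < 2 ^ k \<Longrightarrow> 0 < k \<Longrightarrow> bit_length n \<le> k"
  unfolding bit_length_def by (auto simp: floorlog_le_iff)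

lemma less_power_bit_length: "n < 2 ^ bit_length n"
proof -
  have "n < 2 ^ floorlog 2 n"
    using floorlog_bounds[of n 2] by (cases "n = 0") auto
  also have "\<dots> \<le> 2 ^ bit_length n"
    unfolding bit_length_def by (intro power_increasing) auto
  finally show ?thesis .
qed

lemma mult_less_power_two:
  fixes x y :: nat
  assumes "x < 2 ^ a" "y \<le> 2 ^ b"
  shows "x * y < 2 ^ (a + b)"
proof -
  have "x * y \<le> x * 2 ^ b" using assms by simp
  also have "\<dots> < 2 ^ a * 2 ^ b" using assms by simp
  finally show ?thesis by (simp add: power_add)
qed

lemma add_less_power_two:
  fixes x y :: nat
  assumes "x < 2 ^ a" "y < 2 ^ b"
  shows "x + y < 2 ^ (a + b + 1)"
proof -
  have "(2::nat) ^ a + 2 ^ b \<le> 2 ^ (a + b) + 2 ^ (a + b)"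
    by (intro add_mono power_increasing) auto
  then show ?thesis using assms by simp
qed

lemma power_two_less: "(a::nat) < 2 ^ e \<Longrightarrow> e \<le> e' \<Longrightarrow> a < 2 ^ e'"
  by (meson less_le_trans one_le_numeral power_increasing)

lemma aval_less:
  assumes "bounded_state B s" "0 < B"
  shows "aval e s < 2 ^ (asize e * B)"
proof (induction e)
  case (Const n)
  show ?case
    using power_two_less[OF less_power_bit_length, of n "bit_length n * B"] assms(2) by simp
next
  case (Cell x a)
  show ?case
    using power_two_less[of "s x (aval a s)" B "asize (Cell x a) * B"] assms(1)
    by (simp add: bounded_state_def)
next
  case (Add a b)
  show ?case
    using power_two_less[OF add_less_power_two[OF Add.IH], of "asize (Add a b) * B"] assms(2)
    by (simp add: algebra_simps)
next
  case (Sub a b)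
  show ?case
    using power_two_less[of "aval a s - aval b s" "asize a * B" "asize (Sub a b) * B"] Sub.IH(1)
    by (simp add: algebra_simps)
next
  case (Mul a b)
  show ?case
    using power_two_less[OF mult_less_power_two[OF Mul.IH(1) less_imp_le[OF Mul.IH(2)]],
        of "asize (Mul a b) * B"]
    by (simp add: algebra_simps)
next
  case (Div a b)
  show ?case
    using power_two_less[OF le_less_trans[OF div_le_dividend Div.IH(1)],
        of "asize (Div a b) * B" "aval b s"]
    by (simp add: algebra_simps)
qed

lemma acost_le:
  assumes "bounded_state B s" "0 < B"
  shows "acost e s \<le> (asize e)\<^sup>2 * B"
proof (induction e)
  case (Const n)
  have "bit_length n * 1 \<le> bit_length n * (bit_length n * B)"
    using assms(2) by (intro mult_left_mono) (auto simp: bit_length_def)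
  then show ?case by (simp add: power2_eq_square mult.assoc)
next
  case (Cell x a)
  have "bit_length (aval (Cell x a) s) \<le> B"
    using assms by (intro bit_length_le) (auto simp: bounded_state_def)
  then have "acost (Cell x a) s \<le> (asize a)\<^sup>2 * B + B" using Cell by (simp del: aval.simps)
  then show ?case by (simp add: power2_eq_square algebra_simps)
next
  have binary: "acost a s + acost b s + bit_length (aval e s) \<le> (asize e)\<^sup>2 * B"
    if "acost a s \<le> (asize a)\<^sup>2 * B" "acost b s \<le> (asize b)\<^sup>2 * B"
      "asize e = asize a + asize b + 1" for a b e
  proof -
    have "bit_length (aval e s) \<le> (asize a + asize b + 1) * B"
      using aval_less[OF assms, of e] that(3) assms(2) by (intro bit_length_le) auto
    then show ?thesis using that by (simp add: power2_eq_square algebra_simps)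
  qed
  case (Add a b)
  then show ?case using binary[of a b "Add a b"] by simp
  case (Sub a b)
  then show ?case using binary[of a b "Sub a b"] by simp
  case (Mul a b)
  then show ?case using binary[of a b "Mul a b"] by simp
  case (Div a b)
  then show ?case using binary[of a b "Div a b"] by simp
qed

lemma bcost_le:
  assumes "bounded_state B s" "0 < B"
  shows "bcost b s \<le> bsize b * B"
proof (induction b)
  case (Less a b)
  show ?case using acost_le[OF assms, of a] acost_le[OF assms, of b] assms(2)
    by (simp add: algebra_simps)
qed (use assms(2) in \<open>auto simp: algebra_simps\<close>)

fun writes :: "com \<Rightarrow> string set" where
  "writes Skip = {}"
| "writes (Assign x a e) = {x}"
| "writes (Flip x) = {x}"
| "writes (Seq c d) = writes c \<union> writes d"
| "writes (Cond b c d) = writes c \<union> writes d"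
| "writes (While b c) = writes c"

lemma writes_For [simp]: "writes (For v h c) = insert v (writes c)"
  by (auto simp: For_def)

lemma writes_iterate [simp]: "writes (iterate x a z v h e) = {v, x}"
  by (auto simp: iterate_def)

lemma writes_select [simp]: "writes (select b v h g) = {v, b}"
  by (auto simp: select_def)

lemma runs_unchanged:
  "runs c s D \<Longrightarrow> (s', t) \<in> set_pmf D \<Longrightarrow> x \<notin> writes c \<Longrightarrow> s' x = s x"
proof (induction arbitrary: s' t rule: runs.induct)
  case (Seq c s D d E)
  then show ?case by (fastforce simp: delay_def)
qed (auto simp: store_def delay_def)

lemma store_same: "store x i v s x = (s x)(i := v)"
  by (simp add: store_def)

lemma store_other: "y \<noteq> x \<Longrightarrow> store x i v s y = s y"
  by (simp add: store_def)

lemmas store_simps = store_same store_other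

lemma delay_return: "delay t (return_pmf (s, t')) = return_pmf (s, t + t')"
  by (simp add: delay_def)

lemma runs_Seq_return:
  assumes "runs c s (return_pmf (s1, t1))" "runs d s1 (return_pmf (s2, t2))"
  shows "runs (c;; d) s (return_pmf (s2, t1 + t2))"
proof -
  have "runs (c;; d) s (bind_pmf (return_pmf (s1, t1)) (\<lambda>(s', t). delay t (return_pmf (s2, t2))))"
    using assms by (intro runs.Seq) auto
  then show ?thesis by (simp add: bind_return_pmf delay_return)
qed

subsection \<open>Total correctness within the bounds\<close>

definition ignores :: "string set \<Rightarrow> (state \<Rightarrow> bool) \<Rightarrow> bool" where
  "ignores V R \<longleftrightarrow> (\<forall>s s'. (\<forall>x. x \<notin> V \<longrightarrow> s' x = s x) \<longrightarrow> R s \<longrightarrow> R s')"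

lemma ignoresD: "ignores V R \<Longrightarrow> R s \<Longrightarrow> (\<And>x. x \<notin> V \<Longrightarrow> s' x = s x) \<Longrightarrow> R s'"
  unfolding ignores_def by blast

lemma ignores_mono: "ignores V R \<Longrightarrow> W \<subseteq> V \<Longrightarrow> ignores W R"
  unfolding ignores_def by (meson subsetD)

lemma ignores_store:
  assumes "ignores V R" "x \<in> V" "R s"
  shows "R (store x i v s)"
  by (rule ignoresD[OF assms(1,3)]) (metis assms(2) store_other)

lemma ignores_conj: "ignores V P \<Longrightarrow> ignores V Q \<Longrightarrow> ignores V (\<lambda>s. P s \<and> Q s)"
  unfolding ignores_def by blast

lemma ignores_array: "x \<notin> V \<Longrightarrow> ignores V (\<lambda>s. P (s x))"
  by (simp add: ignores_def)

locale resource_bounds =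
  fixes B K :: nat
  assumes bits_pos: "0 < B"
    and counters_less: "K < 2 ^ B"
begin

text \<open>All cells stay below \<open>2 ^ B\<close> and every loop makes at most \<open>K\<close> iterations, so that the running
  time follows from the syntax of the program alone.\<close>

definition hoare ::
  "(state \<Rightarrow> bool) \<Rightarrow> com \<Rightarrow> (state \<Rightarrow> bool) \<Rightarrow> bool" ("\<lbrace>_\<rbrace>/ _/ \<lbrace>_\<rbrace>" [0, 0, 0] 60) where
  "\<lbrace>P\<rbrace> c \<lbrace>Q\<rbrace> \<longleftrightarrow> (\<forall>s. bounded_state B s \<longrightarrow> P s \<longrightarrow>
     (\<exists>s' t. runs c s (return_pmf (s', t)) \<and> t \<le> csize K c * B \<and> bounded_state B s' \<and> Q s'))"

lemma hoareE:
  assumes "\<lbrace>P\<rbrace> c \<lbrace>Q\<rbrace>" "bounded_state B s" "P s"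
  obtains s' t where "runs c s (return_pmf (s', t))" "t \<le> csize K c * B" "bounded_state B s'" "Q s'"
  using assms unfolding hoare_def by blast

lemma hoare_conseq:
  "\<lbrace>P\<rbrace> c \<lbrace>Q\<rbrace> \<Longrightarrow> (\<And>s. bounded_state B s \<Longrightarrow> P' s \<Longrightarrow> P s) \<Longrightarrow> (\<And>s. Q s \<Longrightarrow> Q' s) \<Longrightarrow> \<lbrace>P'\<rbrace> c \<lbrace>Q'\<rbrace>"
  unfolding hoare_def by blast

lemma hoare_array: "(\<And>y. \<lbrace>\<lambda>s. P s \<and> s x = y\<rbrace> c \<lbrace>Q\<rbrace>) \<Longrightarrow> \<lbrace>P\<rbrace> c \<lbrace>Q\<rbrace>"
  unfolding hoare_def by blast

lemma hoare_value:
  assumes "\<And>s. P s \<Longrightarrow> A (f s)" and "\<And>a. A a \<Longrightarrow> \<lbrace>\<lambda>s. P s \<and> f s = a\<rbrace> c \<lbrace>Q\<rbrace>"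
  shows "\<lbrace>P\<rbrace> c \<lbrace>Q\<rbrace>"
  using assms unfolding hoare_def by blast

lemma hoare_frame:
  assumes "\<lbrace>P\<rbrace> c \<lbrace>Q\<rbrace>" "ignores (writes c) R"
  shows "\<lbrace>\<lambda>s. P s \<and> R s\<rbrace> c \<lbrace>\<lambda>s. Q s \<and> R s\<rbrace>"
  unfolding hoare_def
proof (intro allI impI)
  fix s assume start: "bounded_state B s" "P s \<and> R s"
  obtain s' t where run: "runs c s (return_pmf (s', t))" "t \<le> csize K c * B" "bounded_state B s'"
    "Q s'"
    using assms(1) start by (elim hoareE) auto
  moreover have "R s'" using assms(2) start(2) runs_unchanged[OF run(1)] by (auto elim: ignoresD)
  ultimately show
    "\<exists>s' t. runs c s (return_pmf (s', t)) \<and> t \<le> csize K c * B \<and> bounded_state B s' \<and> Q s' \<and> R s'"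
    by blast
qed

lemma hoare_Skip: "(\<And>s. P s \<Longrightarrow> Q s) \<Longrightarrow> \<lbrace>P\<rbrace> Skip \<lbrace>Q\<rbrace>"
  unfolding hoare_def using bits_pos by (auto intro!: exI runs.Skip)

lemma hoare_Assign:
  assumes "\<And>s. bounded_state B s \<Longrightarrow> P s \<Longrightarrow> aval e s < 2 ^ B \<and> Q (store x (aval a s) (aval e s) s)"
  shows "\<lbrace>P\<rbrace> x\<^bold>[a\<^bold>] ::= e \<lbrace>Q\<rbrace>"
  unfolding hoare_def
proof (intro allI impI exI conjI)
  fix s assume start: "bounded_state B s" "P s"
  show "runs (x\<^bold>[a\<^bold>] ::= e) s
      (return_pmf (store x (aval a s) (aval e s) s, acost a s + acost e s + 1))"
    by (rule runs.Assign)
  show "acost a s + acost e s + 1 \<le> csize K (x\<^bold>[a\<^bold>] ::= e) * B"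
    using acost_le[OF start(1) bits_pos, of a] acost_le[OF start(1) bits_pos, of e] bits_pos
    by (simp add: algebra_simps)
  show "bounded_state B (store x (aval a s) (aval e s) s)" "Q (store x (aval a s) (aval e s) s)"
    using start assms by (auto simp: bounded_state_def store_def)
qed

lemma hoare_Seq:
  assumes "\<lbrace>P\<rbrace> c \<lbrace>R\<rbrace>" "\<lbrace>R\<rbrace> d \<lbrace>Q\<rbrace>"
  shows "\<lbrace>P\<rbrace> c;; d \<lbrace>Q\<rbrace>"
  unfolding hoare_def
proof (intro allI impI)
  fix s assume start: "bounded_state B s" "P s"
  obtain s1 t1 where first: "runs c s (return_pmf (s1, t1))" "t1 \<le> csize K c * B"
    "bounded_state B s1"
    "R s1"
    using assms(1) start by (elim hoareE)
  obtain s2 t2 where second: "runs d s1 (return_pmf (s2, t2))" "t2 \<le> csize K d * B"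
    "bounded_state B s2"
    "Q s2"
    using assms(2) first(3,4) by (elim hoareE)
  have "t1 + t2 \<le> csize K (c;; d) * B" using first(2) second(2) by (simp add: algebra_simps)
  then show "\<exists>s' t. runs (c;; d) s (return_pmf (s', t)) \<and> t \<le> csize K (c;; d) * B \<and>
      bounded_state B s' \<and> Q s'"
    using runs_Seq_return[OF first(1) second(1)] second(3,4) by blast
qed

lemma hoare_Cond:
  assumes "\<lbrace>\<lambda>s. P s \<and> bval b s\<rbrace> c \<lbrace>Q\<rbrace>" "\<lbrace>\<lambda>s. P s \<and> \<not> bval b s\<rbrace> d \<lbrace>Q\<rbrace>"
  shows "\<lbrace>P\<rbrace> IF b THEN c ELSE d \<lbrace>Q\<rbrace>"
  unfolding hoare_def
proof (intro allI impI)
  fix s assume start: "bounded_state B s" "P s"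
  have guard: "bcost b s \<le> bsize b * B" using bcost_le[OF start(1) bits_pos] .
  obtain s' t where "runs (IF b THEN c ELSE d) s (return_pmf (s', bcost b s + t))"
      "t \<le> (csize K c + csize K d) * B" "bounded_state B s'" "Q s'"
  proof (cases "bval b s")
    case True
    obtain s' t where run: "runs c s (return_pmf (s', t))" "t \<le> csize K c * B" "bounded_state B s'"
      "Q s'"
      using assms(1) start True by (elim hoareE) auto
    show thesis using runs.CondTrue[OF True run(1), of d] run(2-4)
      by (intro that[of s' t]) (simp_all add: delay_return add_mult_distrib)
  next
    case False
    obtain s' t where run: "runs d s (return_pmf (s', t))" "t \<le> csize K d * B" "bounded_state B s'"
      "Q s'"
      using assms(2) start False by (elim hoareE) auto
    show thesis using runs.CondFalse[OF False run(1), of c] run(2-4)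
      by (intro that[of s' t]) (simp_all add: delay_return add_mult_distrib)
  qed
  moreover from this(2) have "bcost b s + t \<le> csize K (IF b THEN c ELSE d) * B"
    using guard by (simp add: algebra_simps)
  ultimately show "\<exists>s' t. runs (IF b THEN c ELSE d) s (return_pmf (s', t)) \<and>
      t \<le> csize K (IF b THEN c ELSE d) * B \<and> bounded_state B s' \<and> Q s'"
    by blast
qed

lemma runs_While_counted:
  assumes body: "\<And>i. i < n \<Longrightarrow> \<lbrace>J i\<rbrace> c \<lbrace>J (Suc i)\<rbrace>"
    and guard: "\<And>i s. i \<le> n \<Longrightarrow> J i s \<Longrightarrow> bval b s \<longleftrightarrow> i < n"
    and "i \<le> n" "bounded_state B s" "J i s"
  shows "\<exists>s' t. runs (WHILE b DO c) s (return_pmf (s', t)) \<and>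
     t \<le> ((n - i + 1) * bsize b + (n - i) * csize K c) * B \<and> bounded_state B s' \<and> J n s'"
  using assms(3-5)
proof (induction i arbitrary: s rule: inc_induct)
  case base
  then show ?case
    using guard[of n s] bcost_le[OF base(1) bits_pos, of b] runs.WhileFalse[of b s c] by fastforce
next
  case (step i)
  obtain s1 t1 where first: "runs c s (return_pmf (s1, t1))" "t1 \<le> csize K c * B"
      "bounded_state B s1" "J (Suc i) s1"
    using body[OF step.hyps(2)] step.prems by (elim hoareE)
  obtain s2 t2 where rest: "runs (WHILE b DO c) s1 (return_pmf (s2, t2))"
      "t2 \<le> ((n - Suc i + 1) * bsize b + (n - Suc i) * csize K c) * B" "bounded_state B s2" "J n s2"
    using step.IH[OF first(3,4)] by blast
  have "bval b s" using guard[OF less_imp_le[OF step.hyps(2)] step.prems(2)] step.hyps(2) by simp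
  then have "runs (WHILE b DO c) s (return_pmf (s2, bcost b s + (t1 + t2)))"
    using runs.WhileTrue[OF _ runs_Seq_return[OF first(1) rest(1)]] by (simp add: delay_return)
  moreover have "bcost b s + (t1 + t2) \<le> ((n - i + 1) * bsize b + (n - i) * csize K c) * B"
  proof -
    have "n - i = Suc (n - Suc i)" using step.hyps(2) by simp
    then show ?thesis
      using bcost_le[OF step.prems(1) bits_pos, of b] first(2) rest(2) by (simp add: algebra_simps)
  qed
  ultimately show ?case using rest(3,4) by blast
qed

lemma hoare_While_counted:
  assumes "n \<le> K" "\<And>i. i < n \<Longrightarrow> \<lbrace>J i\<rbrace> c \<lbrace>J (Suc i)\<rbrace>"
    and "\<And>i s. i \<le> n \<Longrightarrow> J i s \<Longrightarrow> bval b s \<longleftrightarrow> i < n"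
  shows "\<lbrace>J 0\<rbrace> WHILE b DO c \<lbrace>J n\<rbrace>"
  unfolding hoare_def
proof (intro allI impI)
  fix s assume start: "bounded_state B s" "J 0 s"
  have "((n - 0 + 1) * bsize b + (n - 0) * csize K c) * B \<le> csize K (WHILE b DO c) * B"
    using assms(1) unfolding csize.simps(6) by (intro mult_right_mono add_mono) auto
  then show "\<exists>s' t. runs (WHILE b DO c) s (return_pmf (s', t)) \<and> t \<le> csize K (WHILE b DO c) * B \<and>
      bounded_state B s' \<and> J n s'"
    using runs_While_counted[of n J c b 0 s] assms(2,3) start by (fastforce intro: order_trans)
qed

definition loop_context :: "string set \<Rightarrow> aexp \<Rightarrow> nat \<Rightarrow> (state \<Rightarrow> bool) \<Rightarrow> bool" where
  "loop_context V h n R \<longleftrightarrow> n \<le> K \<and> ignores V R \<and> (\<forall>s. R s \<longrightarrow> aval h s = n)"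

lemma hoare_For:
  assumes context_R: "loop_context (insert v (writes c)) h n R" and "v \<notin> writes c"
    and counter: "\<And>i. ignores {v} (I i)"
    and body: "\<And>i. i < n \<Longrightarrow> \<lbrace>\<lambda>s. I i s \<and> R s \<and> s v 0 = i\<rbrace> c \<lbrace>I (Suc i)\<rbrace>"
  shows "\<lbrace>\<lambda>s. I 0 s \<and> R s\<rbrace> FOR v < h DO c \<lbrace>\<lambda>s. I n s \<and> R s\<rbrace>"
proof -
  let ?J = "\<lambda>i s. I i s \<and> R s \<and> s v 0 = i"
  have frame: "ignores (insert v (writes c)) R" and limit: "R s \<Longrightarrow> aval h s = n" and "n \<le> K" for s
    using context_R by (auto simp: loop_context_def)
  have keep: "R s \<Longrightarrow> R (store v 0 a s)" "I i s \<Longrightarrow> I i (store v 0 a s)" for i a s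
    using ignores_store[OF frame, of v s] ignores_store[OF counter, of v _ s] by simp_all
  have "\<lbrace>?J i\<rbrace> c;; v ::= Var v \<^bold>+ Const 1 \<lbrace>?J (Suc i)\<rbrace>" if i_less: "i < n" for i
  proof (rule hoare_Seq)
    have frame_body: "ignores (writes c) (\<lambda>s. R s \<and> s v 0 = i)"
      using ignores_mono[OF frame, of "writes c"] assms(2) unfolding ignores_def by auto
    show "\<lbrace>?J i\<rbrace> c \<lbrace>\<lambda>s. I (Suc i) s \<and> R s \<and> s v 0 = i\<rbrace>"
      by (rule hoare_conseq[OF hoare_frame[OF body[OF i_less] frame_body]]) auto
    show "\<lbrace>\<lambda>s. I (Suc i) s \<and> R s \<and> s v 0 = i\<rbrace> v ::= Var v \<^bold>+ Const 1 \<lbrace>?J (Suc i)\<rbrace>"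
    proof (rule hoare_Assign)
      fix s assume start: "bounded_state B s" "I (Suc i) s \<and> R s \<and> s v 0 = i"
      have "Suc i < 2 ^ B" using i_less \<open>n \<le> K\<close> counters_less by simp
      then show "aval (Var v \<^bold>+ Const 1) s < 2 ^ B \<and>
          ?J (Suc i) (store v (aval (Const 0) s) (aval (Var v \<^bold>+ Const 1) s) s)"
        using start(2) keep by (simp add: store_same)
    qed
  qed
  moreover have "bval (Var v \<^bold>< h) s \<longleftrightarrow> i < n" if "?J i s" for i s
    using limit[of s] that by simp
  ultimately have loop: "\<lbrace>?J 0\<rbrace> WHILE Var v \<^bold>< h DO (c;; v ::= Var v \<^bold>+ Const 1) \<lbrace>?J n\<rbrace>"
    using \<open>n \<le> K\<close> by (intro hoare_While_counted) auto
  have init: "\<lbrace>\<lambda>s. I 0 s \<and> R s\<rbrace> v ::= Const 0 \<lbrace>?J 0\<rbrace>"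
    using keep by (intro hoare_Assign) (simp add: store_same)
  show ?thesis unfolding For_def by (rule hoare_conseq[OF hoare_Seq[OF init loop]]) auto
qed

lemma hoare_update:
  assumes "loop_context (insert v (writes c)) h n R" "v \<notin> writes c" "x \<noteq> v"
    and body: "\<And>i y. i < n \<Longrightarrow> y (k + i) = y0 (k + i) \<Longrightarrow>
      \<lbrace>\<lambda>s. R s \<and> s v 0 = i \<and> s x = y\<rbrace> c \<lbrace>\<lambda>s. s x = y(k + i := f i)\<rbrace>"
  shows "\<lbrace>\<lambda>s. R s \<and> s x = y0\<rbrace> FOR v < h DO c
    \<lbrace>\<lambda>s. R s \<and> (\<forall>l. s x l = (if k \<le> l \<and> l < k + n then f (l - k) else y0 l))\<rbrace>"
proof -
  let ?I = "\<lambda>i s. \<forall>l. s x l = (if k \<le> l \<and> l < k + i then f (l - k) else y0 l)"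
  have "\<lbrace>\<lambda>s. ?I 0 s \<and> R s\<rbrace> FOR v < h DO c \<lbrace>\<lambda>s. ?I n s \<and> R s\<rbrace>"
  proof (rule hoare_For[where I = ?I, OF assms(1,2)])
    show "ignores {v} (?I i)" for i using assms(3) by (simp add: ignores_def)
    show "\<lbrace>\<lambda>s. ?I i s \<and> R s \<and> s v 0 = i\<rbrace> c \<lbrace>?I (Suc i)\<rbrace>" if "i < n" for i
    proof (rule hoare_value[where f = "\<lambda>s. s x" and
          A = "\<lambda>y. \<forall>l. y l = (if k \<le> l \<and> l < k + i then f (l - k) else y0 l)"])
      fix y assume y_eq: "\<forall>l. y l = (if k \<le> l \<and> l < k + i then f (l - k) else y0 l)"
      then have "\<lbrace>\<lambda>s. R s \<and> s v 0 = i \<and> s x = y\<rbrace> c \<lbrace>\<lambda>s. s x = y(k + i := f i)\<rbrace>"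
        using that by (intro body) auto
      then show "\<lbrace>\<lambda>s. (?I i s \<and> R s \<and> s v 0 = i) \<and> s x = y\<rbrace> c \<lbrace>?I (Suc i)\<rbrace>"
        by (rule hoare_conseq) (use y_eq in auto)
    qed auto
  qed
  then show ?thesis by (rule hoare_conseq) auto
qed

lemma hoare_fill:
  assumes "loop_context (insert v (writes c)) h n R" "v \<notin> writes c" "x \<noteq> v"
    and "\<And>i y. i < n \<Longrightarrow> \<lbrace>\<lambda>s. R s \<and> s v 0 = i \<and> s x = y\<rbrace> c \<lbrace>\<lambda>s. s x = y(i := f i)\<rbrace>"
  shows "\<lbrace>R\<rbrace> FOR v < h DO c \<lbrace>\<lambda>s. R s \<and> (\<forall>i<n. s x i = f i)\<rbrace>"
proof (rule hoare_array[where x = x])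
  fix y
  have "\<lbrace>\<lambda>s. R s \<and> s x = y\<rbrace> FOR v < h DO c
      \<lbrace>\<lambda>s. R s \<and> (\<forall>l. s x l = (if 0 \<le> l \<and> l < 0 + n then f (l - 0) else y l))\<rbrace>"
    using assms by (intro hoare_update) auto
  then show "\<lbrace>\<lambda>s. R s \<and> s x = y\<rbrace> FOR v < h DO c \<lbrace>\<lambda>s. R s \<and> (\<forall>i<n. s x i = f i)\<rbrace>"
    by (rule hoare_conseq) auto
qed

lemma hoare_iterate:
  assumes loop: "loop_context {v, x} h n R" and "x \<noteq> v"
    and address: "\<And>s. R s \<Longrightarrow> aval a s = p"
    and init: "\<And>s. R s \<Longrightarrow> aval z s = g 0"
    and step: "\<And>i s. i < n \<Longrightarrow> R s \<Longrightarrow> s v 0 = i \<Longrightarrow> s x p = g i \<Longrightarrow> aval e s = g (Suc i)"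
    and bound: "\<And>i. i \<le> n \<Longrightarrow> g i < 2 ^ B"
  shows "\<lbrace>\<lambda>s. R s \<and> s x = y\<rbrace> iterate x a z v h e \<lbrace>\<lambda>s. R s \<and> s x = y(p := g n)\<rbrace>"
proof -
  let ?I = "\<lambda>i s. s x = y(p := g i)"
  have keep: "R (store x i u s)" if "R s" for i u s
    using loop ignores_store[of "{v, x}" R x s] that by (simp add: loop_context_def)
  have body: "\<lbrace>\<lambda>s. ?I 0 s \<and> R s\<rbrace> FOR v < h DO x\<^bold>[a\<^bold>] ::= e \<lbrace>\<lambda>s. ?I n s \<and> R s\<rbrace>"
  proof (rule hoare_For)
    show "loop_context (insert v (writes (x\<^bold>[a\<^bold>] ::= e))) h n R" using loop by simp
    show "ignores {v} (?I i)" for i using assms(2) by (simp add: ignores_def)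
    show "\<lbrace>\<lambda>s. ?I i s \<and> R s \<and> s v 0 = i\<rbrace> x\<^bold>[a\<^bold>] ::= e \<lbrace>?I (Suc i)\<rbrace>" if "i < n" for i
      using step[OF that] address bound[of "Suc i"] that
      by (intro hoare_Assign) (simp add: store_same)
  qed (use assms(2) in auto)
  have first: "\<lbrace>\<lambda>s. R s \<and> s x = y\<rbrace> x\<^bold>[a\<^bold>] ::= z \<lbrace>\<lambda>s. ?I 0 s \<and> R s\<rbrace>"
    using address init bound[of 0] keep by (intro hoare_Assign) (simp add: store_same)
  show ?thesis unfolding iterate_def by (rule hoare_conseq[OF hoare_Seq[OF first body]]) auto
qed

lemma hoare_select:
  assumes loop: "loop_context {v, b} h n R" and "0 < n" "b \<noteq> v"
    and test: "\<And>j k s. j < n \<Longrightarrow> k < n \<Longrightarrow> R s \<Longrightarrow> s v 0 = j \<Longrightarrow> s b 0 = k \<Longrightarrow> bval g s \<longleftrightarrow> better j k"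
    and irrefl: "\<And>j. \<not> better j j"
    and trans: "\<And>i j k. k < n \<Longrightarrow> better i j \<Longrightarrow> better j k \<Longrightarrow> better i k"
  shows "\<lbrace>R\<rbrace> select b v h g \<lbrace>\<lambda>s. R s \<and> s b 0 < n \<and> (\<forall>j<n. \<not> better j (s b 0))\<rbrace>"
proof -
  let ?I = "\<lambda>i s. s b 0 < n \<and> (\<forall>j<i. \<not> better j (s b 0))"
  have keep: "R (store b i u s)" if "R s" for i u s
    using loop ignores_store[of "{v, b}" R b s] that by (simp add: loop_context_def)
  have body: "\<lbrace>\<lambda>s. ?I 0 s \<and> R s\<rbrace> FOR v < h DO IF g THEN b ::= Var v ELSE Skip \<lbrace>\<lambda>s. ?I n s \<and> R s\<rbrace>"
  proof (rule hoare_For)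
    show "loop_context (insert v (writes (IF g THEN b ::= Var v ELSE Skip))) h n R"
      using loop by simp
    show "ignores {v} (?I i)" for i using assms(3) by (simp add: ignores_def)
    show "\<lbrace>\<lambda>s. ?I i s \<and> R s \<and> s v 0 = i\<rbrace> IF g THEN b ::= Var v ELSE Skip \<lbrace>?I (Suc i)\<rbrace>"
      if i_less: "i < n" for i
    proof (rule hoare_Cond)
      show "\<lbrace>\<lambda>s. (?I i s \<and> R s \<and> s v 0 = i) \<and> bval g s\<rbrace> b ::= Var v \<lbrace>?I (Suc i)\<rbrace>"
      proof (rule hoare_Assign)
        fix s assume start: "bounded_state B s" "(?I i s \<and> R s \<and> s v 0 = i) \<and> bval g s"
        then have "better i (s b 0)" using test[OF i_less, of "s b 0" s] by simp
        then have "\<not> better j i" if "j < Suc i" for j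
          using start(2) irrefl trans[of "s b 0" j i] that by (auto simp: less_Suc_eq)
        moreover have "s v 0 < 2 ^ B" using start(1) by (simp add: bounded_state_def)
        ultimately show
          "aval (Var v) s < 2 ^ B \<and> ?I (Suc i) (store b (aval (Const 0) s) (aval (Var v) s) s)"
          using start(2) i_less by (simp add: store_same)
      qed
      show "\<lbrace>\<lambda>s. (?I i s \<and> R s \<and> s v 0 = i) \<and> \<not> bval g s\<rbrace> Skip \<lbrace>?I (Suc i)\<rbrace>"
        using test[OF i_less] by (intro hoare_Skip) (auto simp: less_Suc_eq)
    qed
  qed (use assms(3) in auto)
  have first: "\<lbrace>R\<rbrace> b ::= Const 0 \<lbrace>\<lambda>s. ?I 0 s \<and> R s\<rbrace>"
    using assms(2) keep by (intro hoare_Assign) (simp add: store_same)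
  show ?thesis unfolding select_def by (rule hoare_conseq[OF hoare_Seq[OF first body]]) auto
qed

end

section \<open>The program\<close>

text \<open>With truncated subtraction, \<open>a - (a - b)\<close> is the minimum of \<open>a\<close> and \<open>b\<close>, and
  \<open>(a - b) + (b - a)\<close> is their distance.\<close>

definition Minimum :: "aexp \<Rightarrow> aexp \<Rightarrow> aexp" where
  "Minimum a b = a \<^bold>- (a \<^bold>- b)"

definition Positive :: "aexp \<Rightarrow> aexp" where
  "Positive a = Minimum (Const 1) a"

definition Equal :: "aexp \<Rightarrow> aexp \<Rightarrow> aexp" where
  "Equal a b = Const 1 \<^bold>- ((a \<^bold>- b) \<^bold>+ (b \<^bold>- a))"

definition Row :: "aexp \<Rightarrow> aexp" where
  "Row t = t \<^bold>/ Var ''n''"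

definition Col :: "aexp \<Rightarrow> aexp" where
  "Col t = t \<^bold>- t \<^bold>/ Var ''n'' \<^bold>* Var ''n''"

lemma aval_Minimum [simp]: "aval (Minimum a b) s = min (aval a s) (aval b s)"
  by (simp add: Minimum_def)

lemma aval_Positive [simp]: "aval (Positive a) s = of_bool (0 < aval a s)"
  by (cases "aval a s") (simp_all add: Positive_def)

lemma aval_Equal [simp]: "aval (Equal a b) s = of_bool (aval a s = aval b s)"
  by (auto simp: Equal_def)

lemma aval_Row [simp]: "aval (Row t) s = aval t s div s ''n'' 0"
  by (simp add: Row_def)

lemma aval_Col [simp]: "aval (Col t) s = aval t s mod s ''n'' 0"
  by (simp add: Col_def minus_div_mult_eq_mod)

abbreviation At :: "aexp \<Rightarrow> aexp \<Rightarrow> aexp" where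
  "At i j \<equiv> i \<^bold>* Var ''n'' \<^bold>+ j"

abbreviation Capacity :: "aexp \<Rightarrow> aexp" where
  "Capacity i \<equiv> ''A''\<^bold>[Var ''n'' \<^bold>+ i\<^bold>]"

abbreviation Demand :: "aexp \<Rightarrow> aexp \<Rightarrow> aexp" where
  "Demand i j \<equiv> ''A''\<^bold>[Var ''n'' \<^bold>+ Var ''m'' \<^bold>+ At i j\<^bold>]"

abbreviation Coeff :: "aexp \<Rightarrow> aexp \<Rightarrow> aexp" where
  "Coeff i j \<equiv> ''E''\<^bold>[At i j\<^bold>]"

definition compute_scale :: com where
  "compute_scale =
     iterate ''P'' (Const 0) (Const 1) ''i'' (Var ''m'') (Var ''P'' \<^bold>* Capacity (Var ''i''))"

definition coeff_entry :: com where
  "coeff_entry = IF Row (Var ''t'') \<^bold>< Var ''m''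
     THEN ''E''\<^bold>[Var ''t''\<^bold>] ::= Var ''P'' \<^bold>/ Capacity (Row (Var ''t'')) \<^bold>*
       Minimum (Capacity (Row (Var ''t''))) (Const 2 \<^bold>* Demand (Row (Var ''t'')) (Col (Var ''t'')))
     ELSE ''E''\<^bold>[Var ''t''\<^bold>] ::=
       Const 2 \<^bold>* Var ''P'' \<^bold>* Equal (Row (Var ''t'')) (Var ''m'' \<^bold>+ Col (Var ''t''))"

definition compute_coeff :: com where
  "compute_coeff = FOR ''t'' < (Var ''m'' \<^bold>+ Var ''n'') \<^bold>* Var ''n'' DO coeff_entry"

definition kernel_entry :: com where
  "kernel_entry = iterate ''K'' (Var ''t'') (Const 0) ''i'' (Var ''m'') (''K''\<^bold>[Var ''t''\<^bold>] \<^bold>+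
     (Positive (Coeff (Var ''i'') (Row (Var ''t''))) \<^bold>* Coeff (Var ''i'') (Col (Var ''t'')) \<^bold>+
      Positive (Coeff (Var ''i'') (Col (Var ''t''))) \<^bold>* Coeff (Var ''i'') (Row (Var ''t''))))"

definition compute_kernel :: com where
  "compute_kernel = FOR ''t'' < Var ''n'' \<^bold>* Var ''n'' DO kernel_entry"

definition profit_entry :: com where
  "profit_entry = iterate ''U'' (Var ''j'') (''A''\<^bold>[Var ''j''\<^bold>]) ''i'' (Var ''m'')
     (''U''\<^bold>[Var ''j''\<^bold>] \<^bold>* Positive (Capacity (Var ''i'') \<^bold>- Demand (Var ''i'') (Var ''j'')))"

definition compute_profit :: com where
  "compute_profit = FOR ''j'' < Var ''n'' DO profit_entry"

definition cost_entry :: com where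
  "cost_entry = iterate ''C'' (Var ''j'') (Const 0) ''i'' (Var ''m'' \<^bold>+ Var ''n'')
     (''C''\<^bold>[Var ''j''\<^bold>] \<^bold>+ Coeff (Var ''i'') (Var ''j'') \<^bold>* ''Y''\<^bold>[Var ''i''\<^bold>])"

definition mw_costs :: com where
  "mw_costs = FOR ''j'' < Var ''n'' DO cost_entry"

definition mw_best :: com where
  "mw_best = select ''b'' ''j'' (Var ''n'')
     (''U''\<^bold>[Var ''b''\<^bold>] \<^bold>* ''C''\<^bold>[Var ''j''\<^bold>] \<^bold>< ''U''\<^bold>[Var ''j''\<^bold>] \<^bold>* ''C''\<^bold>[Var ''b''\<^bold>])"

definition mw_prices :: com where
  "mw_prices = FOR ''i'' < Var ''m'' \<^bold>+ Var ''n'' DO ''Y''\<^bold>[Var ''i''\<^bold>] ::=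
     ''Y''\<^bold>[Var ''i''\<^bold>] \<^bold>* (Const 2 \<^bold>* Var ''P'' \<^bold>+ Coeff (Var ''i'') (Var ''b''))"

definition mw_update :: com where
  "mw_update = ''X''\<^bold>[Var ''b''\<^bold>] ::= ''X''\<^bold>[Var ''b''\<^bold>] \<^bold>+ Const 1;;
     mw_prices"

definition mw :: com where
  "mw = FOR ''j'' < Var ''n'' DO ''X''\<^bold>[Var ''j''\<^bold>] ::= Const 0;;
     FOR ''i'' < Var ''m'' \<^bold>+ Var ''n'' DO ''Y''\<^bold>[Var ''i''\<^bold>] ::= Const 1;;
     FOR ''t'' < Const 32 \<^bold>* ((Var ''m'' \<^bold>+ Var ''n'') \<^bold>* Var ''n'') DO
       (mw_costs;; mw_best;; mw_update)"

definition degree_entry :: com where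
  "degree_entry = iterate ''G'' (Var ''j'') (Const 0) ''l'' (Var ''n'') (''G''\<^bold>[Var ''j''\<^bold>] \<^bold>+
     (Const 1 \<^bold>- ''Z''\<^bold>[Var ''l''\<^bold>]) \<^bold>*
     (''X''\<^bold>[Var ''l''\<^bold>] \<^bold>* ''K''\<^bold>[At (Var ''j'') (Var ''l'')\<^bold>]))"

definition lr_degrees :: com where
  "lr_degrees = FOR ''j'' < Var ''n'' DO degree_entry"

definition lr_best :: com where
  "lr_best = select ''b'' ''j'' (Var ''n'') (''Z''\<^bold>[Var ''j''\<^bold>] \<^bold>< Const 1 \<^bold>\<and>
     \<^bold>\<not> (''Z''\<^bold>[Var ''b''\<^bold>] \<^bold>< Const 1 \<^bold>\<and> \<^bold>\<not> ''G''\<^bold>[Var ''j''\<^bold>] \<^bold>< ''G''\<^bold>[Var ''b''\<^bold>]))"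

definition residual_entry :: com where
  "residual_entry = IF ''Z''\<^bold>[Var ''l''\<^bold>] \<^bold>< Const 1
     THEN ''U''\<^bold>[Var ''l''\<^bold>] ::=
       ''U''\<^bold>[Var ''l''\<^bold>] \<^bold>* Var ''P'' \<^bold>- Var ''v'' \<^bold>* ''K''\<^bold>[At (Var ''b'') (Var ''l'')\<^bold>]
     ELSE Skip"

definition lr_residuals :: com where
  "lr_residuals = FOR ''l'' < Var ''n'' DO residual_entry"

definition lr_update :: com where
  "lr_update = ''q''\<^bold>[Var ''p''\<^bold>] ::= Var ''b'';; ''Z''\<^bold>[Var ''b''\<^bold>] ::= Const 1;;
     ''v'' ::= ''U''\<^bold>[Var ''b''\<^bold>];; lr_residuals"

definition lr :: com where
  "lr = FOR ''j'' < Var ''n'' DO ''Z''\<^bold>[Var ''j''\<^bold>] ::= Const 0;;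
     FOR ''p'' < Var ''n'' DO (lr_degrees;; lr_best;; lr_update)"

definition fit_test :: com where
  "fit_test = iterate ''o'' (Const 0) (Positive (''U''\<^bold>[Var ''e''\<^bold>])) ''i'' (Var ''m'')
     (Var ''o'' \<^bold>* Positive (Capacity (Var ''i'') \<^bold>-
       (''L''\<^bold>[Var ''i''\<^bold>] \<^bold>+ Demand (Var ''i'') (Var ''e''))))"

definition greedy_test :: com where
  "greedy_test = ''e'' ::= ''q''\<^bold>[Var ''n'' \<^bold>- (Var ''p'' \<^bold>+ Const 1)\<^bold>];; fit_test"

definition greedy_loads :: com where
  "greedy_loads = FOR ''i'' < Var ''m'' DO
     ''L''\<^bold>[Var ''i''\<^bold>] ::= ''L''\<^bold>[Var ''i''\<^bold>] \<^bold>+ Var ''o'' \<^bold>* Demand (Var ''i'') (Var ''e'')"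

definition greedy_add :: com where
  "greedy_add = ''out''\<^bold>[Var ''e''\<^bold>] ::= Var ''o'';; greedy_loads"

definition select_greedily :: com where
  "select_greedily = FOR ''j'' < Var ''n'' DO ''out''\<^bold>[Var ''j''\<^bold>] ::= Const 0;;
     FOR ''i'' < Var ''m'' DO ''L''\<^bold>[Var ''i''\<^bold>] ::= Const 0;;
     FOR ''p'' < Var ''n'' DO (greedy_test;; greedy_add)"

definition solve :: com where
  "solve = compute_scale;; compute_coeff;; compute_kernel;; compute_profit;; mw;; lr;;
     select_greedily"

lemma row_col_less:
  fixes t r n :: nat
  assumes "t < r * n"
  shows "t div n < r" "t mod n < n"
  using assms by (cases "n = 0"; auto intro: less_mult_imp_div_less)+

locale bounded_packing = integer_packing n m w c d + resource_bounds B K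
  for n m :: nat and w c :: "nat \<Rightarrow> nat" and d :: "nat \<Rightarrow> nat \<Rightarrow> nat" and B K :: nat +
  assumes magnitude_bound: "(m + n + 1) * (4 * scale) ^ (rounds + 1) < 2 ^ B"
    and profit_bound: "j < n \<Longrightarrow> w j * scale ^ n < 2 ^ B"
    and size_le: "m + n \<le> K"
    and rounds_le: "rounds \<le> K"
begin

lemma less_bits: "x \<le> (m + n + 1) * (4 * scale) ^ (rounds + 1) \<Longrightarrow> x < 2 ^ B"
  by (rule le_less_trans[OF _ magnitude_bound])

lemma rounds_le_power: "rounds \<le> (4 * scale) ^ rounds"
proof -
  have "rounds < 2 ^ rounds" by (rule less_exp)
  also have "\<dots> \<le> (4 * scale) ^ rounds" using scale_pos by (intro power_mono) auto
  finally show ?thesis by simp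
qed

lemma
  shows scale_less: "2 * scale < 2 ^ B"
    and price_less: "t \<le> rounds \<Longrightarrow> x \<le> (4 * scale) ^ t \<Longrightarrow> x < 2 ^ B"
    and cost_less: "x \<le> (m + n) * (2 * scale * (4 * scale) ^ rounds) \<Longrightarrow> x < 2 ^ B"
    and kernel_less: "x \<le> 2 * (m * scale) \<Longrightarrow> x < 2 ^ B"
    and degree_less: "x \<le> rounds * (2 * (m * scale)) \<Longrightarrow> x < 2 ^ B"
    and rounds_less: "x \<le> rounds \<Longrightarrow> x < 2 ^ B"
proof -
  let ?p = "(4 * scale) ^ rounds"
  have p: "1 \<le> ?p" "rounds \<le> ?p" using scale_pos rounds_le_power by (auto simp: one_le_power)
  have total: "x < 2 ^ B" if "x \<le> (m + n + 1) * (4 * scale) * ?p" for x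
    using less_bits[of x] that by (simp only: Suc_eq_plus1[symmetric] power_Suc mult.assoc)
  have size: "1 * (2 * scale) \<le> (m + n + 1) * (4 * scale)"
    "2 * (m * scale) \<le> (m + n + 1) * (4 * scale)"
    "(m + n) * (2 * scale) \<le> (m + n + 1) * (4 * scale)" "1 \<le> (m + n + 1) * (4 * scale)"
    using scale_pos by (auto intro: mult_le_mono simp: algebra_simps)
  show "2 * scale < 2 ^ B" using mult_le_mono[OF size(1) p(1)] by (intro total) simp
  show "x < 2 ^ B" if "x \<le> (m + n) * (2 * scale * ?p)"
    using that mult_le_mono[OF size(3) order_refl, of ?p] by (intro total) (simp only: mult.assoc)
  show "x < 2 ^ B" if "x \<le> 2 * (m * scale)"
    using that mult_le_mono[OF size(2) p(1)] by (intro total) simp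
  show "x < 2 ^ B" if "x \<le> rounds * (2 * (m * scale))"
    using that mult_le_mono[OF size(2) p(2)] by (intro total) (simp only: mult.commute)
  have power: "x < 2 ^ B" if "x \<le> ?p" for x
    using mult_le_mono[OF size(4) that] by (intro total) (simp only: mult_1)
  then show "x < 2 ^ B" if "x \<le> rounds" using that p(2) by simp
  have "(4 * scale) ^ t \<le> ?p" if "t \<le> rounds"
    using that scale_pos by (intro power_increasing) auto
  then show "x < 2 ^ B" if "t \<le> rounds" "x \<le> (4 * scale) ^ t" using that power order_trans by blast
qed

lemma one_less: "1 < (2::nat) ^ B"
  using scale_less scale_pos by linarith

lemma capacity_le_scale:
  assumes "i < m"
  shows "c i \<le> scale"
  unfolding scale_def using assms capacity_pos by (intro dvd_imp_le dvd_prodI prod_pos) auto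

lemma loop_limits: "n \<le> K" "m \<le> K" "n * n \<le> K" "(m + n) * n \<le> K"
  using size_le rounds_le by (auto simp: algebra_simps)

definition stores_matrix :: "string \<Rightarrow> nat \<Rightarrow> (nat \<Rightarrow> nat \<Rightarrow> nat) \<Rightarrow> state \<Rightarrow> bool" where
  "stores_matrix x r f s \<longleftrightarrow> (\<forall>i<r. \<forall>j<n. s x (i * n + j) = f i j)"

definition data :: "state \<Rightarrow> bool" where
  "data s \<longleftrightarrow> s ''n'' 0 = n \<and> s ''m'' 0 = m \<and> (\<forall>j<n. s ''A'' j = w j) \<and>
     (\<forall>i<m. s ''A'' (n + i) = c i) \<and> (\<forall>i<m. \<forall>j<n. s ''A'' (n + m + (i * n + j)) = d i j)"

definition scaled :: "state \<Rightarrow> bool" where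
  "scaled s \<longleftrightarrow> data s \<and> s ''P'' 0 = scale"

definition prepared :: "state \<Rightarrow> bool" where
  "prepared s \<longleftrightarrow> scaled s \<and> stores_matrix ''E'' (m + n) row_coeff s \<and> stores_matrix ''K'' n kernel s"

definition profits :: "state \<Rightarrow> bool" where
  "profits s \<longleftrightarrow> (\<forall>j<n. s ''U'' j = profit j)"

lemma ignores_data: "V \<inter> {''n'', ''m'', ''A''} = {} \<Longrightarrow> ignores V data"
  by (auto simp: ignores_def data_def)

lemma ignores_matrix: "x \<notin> V \<Longrightarrow> ignores V (stores_matrix x r f)"
  by (simp add: ignores_def stores_matrix_def)

lemma ignores_scaled:
  "V \<inter> {''n'', ''m'', ''A'', ''P''} = {} \<Longrightarrow> ignores V scaled"
  unfolding scaled_def by (intro ignores_conj ignores_data ignores_array) auto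

lemma ignores_prepared:
  "V \<inter> {''n'', ''m'', ''A'', ''P'', ''E'', ''K''} = {} \<Longrightarrow> ignores V prepared"
  unfolding prepared_def by (intro ignores_conj ignores_scaled ignores_matrix) auto

lemma ignores_profits: "''U'' \<notin> V \<Longrightarrow> ignores V profits"
  unfolding profits_def by (rule ignores_array)

lemmas ignores_intros = ignores_conj ignores_prepared ignores_scaled ignores_data ignores_matrix
  ignores_profits ignores_array

lemma stores_matrixI:
  assumes "\<And>t. t < r * n \<Longrightarrow> s x t = f (t div n) (t mod n)"
  shows "stores_matrix x r f s"
  unfolding stores_matrix_def
proof (intro allI impI)
  fix i j assume "i < r" "j < n"
  then have "i * n + j < r * n"
    by (metis add_less_cancel_left mult_Suc add.commute mult_le_mono1 order_less_le_trans Suc_leI)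
  then show "s x (i * n + j) = f i j" using assms[of "i * n + j"] \<open>j < n\<close> by simp
qed

lemma stores_matrixD: "stores_matrix x r f s \<Longrightarrow> i < r \<Longrightarrow> j < n \<Longrightarrow> s x (i * n + j) = f i j"
  by (simp add: stores_matrix_def)

lemma data_simps:
  assumes "data s"
  shows "s ''n'' 0 = n" "s ''m'' 0 = m" "j < n \<Longrightarrow> s ''A'' j = w j" "i < m \<Longrightarrow> s ''A'' (n + i) = c i"
    "i < m \<Longrightarrow> j < n \<Longrightarrow> s ''A'' (n + m + (i * n + j)) = d i j"
  using assms by (auto simp: data_def)

lemma data_demand_div_mod:
  assumes "data s" "t div n < m" "t mod n < n"
  shows "s ''A'' (n + m + t) = d (t div n) (t mod n)"
  using data_simps(5)[OF assms] by simp

lemma scaled_simps: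
  assumes "scaled s"
  shows "data s" "s ''P'' 0 = scale"
  using assms by (auto simp: scaled_def)

lemma prepared_simps:
  assumes "prepared s"
  shows "scaled s" "i < m + n \<Longrightarrow> j < n \<Longrightarrow> s ''E'' (i * n + j) = row_coeff i j"
    "i < n \<Longrightarrow> j < n \<Longrightarrow> s ''K'' (i * n + j) = kernel i j"
  using assms by (auto simp: prepared_def stores_matrixD)

lemma prepared_store:
  assumes "prepared s" "x \<notin> {''n'', ''m'', ''A'', ''P'', ''E'', ''K''}"
  shows "prepared (store x i v s)"
  using assms by (intro ignores_store[OF ignores_prepared[of "{x}"]]) auto

lemmas state_simps = data_simps scaled_simps prepared_simps

lemma loop_contextI:
  "n' \<le> K \<Longrightarrow> ignores V R \<Longrightarrow> (\<And>s. R s \<Longrightarrow> aval h s = n') \<Longrightarrow> loop_context V h n' R"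
  by (simp add: loop_context_def)

lemma hoare_compute_scale: "\<lbrace>data\<rbrace> compute_scale \<lbrace>scaled\<rbrace>"
proof (rule hoare_array[where x = "''P''"])
  fix y
  have "\<lbrace>\<lambda>s. data s \<and> s ''P'' = y\<rbrace> compute_scale \<lbrace>\<lambda>s. data s \<and> s ''P'' = y(0 := \<Prod>i<m. c i)\<rbrace>"
    unfolding compute_scale_def
  proof (rule hoare_iterate[where n = m and g = "\<lambda>i. \<Prod>i'<i. c i'"])
    show "(\<Prod>i'<i. c i') < 2 ^ B" if "i \<le> m" for i
    proof -
      have "(\<Prod>i'<i. c i') \<le> scale"
        unfolding scale_def using that scale_pos
        by (intro dvd_imp_le prod_dvd_prod_subset) (auto simp: scale_def)
      then show ?thesis using scale_less by simp
    qed
  qed (auto simp: state_simps intro!: loop_contextI loop_limits ignores_intros)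
  then show "\<lbrace>\<lambda>s. data s \<and> s ''P'' = y\<rbrace> compute_scale \<lbrace>scaled\<rbrace>"
    by (rule hoare_conseq) (auto simp: scaled_def scale_def)
qed

lemma hoare_coeff_entry:
  assumes "t < (m + n) * n"
  shows "\<lbrace>\<lambda>s. scaled s \<and> s ''t'' 0 = t \<and> s ''E'' = y\<rbrace> coeff_entry
    \<lbrace>\<lambda>s. s ''E'' = y(t := row_coeff (t div n) (t mod n))\<rbrace>"
proof -
  have indices: "t div n < m + n" "t mod n < n" using assms by (rule row_col_less)+
  have "row_coeff (t div n) (t mod n) < 2 ^ B" using row_coeff_le scale_less by (rule le_less_trans)
  then show ?thesis
    unfolding coeff_entry_def using indices by (intro hoare_Cond hoare_Assign)
      (auto simp: store_same state_simps data_demand_div_mod row_coeff_def phi_def)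
qed

lemma hoare_compute_coeff:
  "\<lbrace>scaled\<rbrace> compute_coeff \<lbrace>\<lambda>s. scaled s \<and> stores_matrix ''E'' (m + n) row_coeff s\<rbrace>"
proof (rule hoare_conseq)
  show "\<lbrace>scaled\<rbrace> compute_coeff
    \<lbrace>\<lambda>s. scaled s \<and> (\<forall>t<(m + n) * n. s ''E'' t = row_coeff (t div n) (t mod n))\<rbrace>"
    unfolding compute_coeff_def
    by (rule hoare_fill[OF _ _ _ hoare_coeff_entry])
      (auto simp: coeff_entry_def state_simps intro!: loop_contextI loop_limits ignores_intros)
qed (auto intro!: stores_matrixI)

lemma hoare_kernel_entry:
  assumes "t < n * n"
  shows "\<lbrace>\<lambda>s. (scaled s \<and> stores_matrix ''E'' (m + n) row_coeff s) \<and> s ''t'' 0 = t \<and> s ''K'' = y\<rbrace>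
    kernel_entry \<lbrace>\<lambda>s. s ''K'' = y(t := kernel (t div n) (t mod n))\<rbrace>"
proof -
  let ?R = "\<lambda>s. (scaled s \<and> stores_matrix ''E'' (m + n) row_coeff s) \<and> s ''t'' 0 = t"
  let ?term = "\<lambda>i. of_bool (0 < phi i (t div n)) * phi i (t mod n)
      + of_bool (0 < phi i (t mod n)) * phi i (t div n)"
  have indices: "t div n < n" "t mod n < n" using assms by (rule row_col_less)+
  have "\<lbrace>\<lambda>s. ?R s \<and> s ''K'' = y\<rbrace> kernel_entry \<lbrace>\<lambda>s. ?R s \<and> s ''K'' = y(t := \<Sum>i<m. ?term i)\<rbrace>"
    unfolding kernel_entry_def
  proof (rule hoare_iterate[where n = m and g = "\<lambda>i. \<Sum>i'<i. ?term i'"])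
    show "(\<Sum>i'<i. ?term i') < 2 ^ B" if "i \<le> m" for i
    proof -
      have "(\<Sum>i'<i. ?term i') \<le> kernel (t div n) (t mod n)"
        unfolding kernel_eq_sum using that by (intro sum_mono2) auto
      also have "\<dots> \<le> 2 * (m * scale)" by (rule kernel_le)
      finally show ?thesis by (rule kernel_less)
    qed
  qed (use indices in \<open>auto simp: state_simps stores_matrixD row_coeff_def
      intro!: loop_contextI loop_limits ignores_intros\<close>)
  then show ?thesis by (rule hoare_conseq) (auto simp: kernel_eq_sum)
qed

lemma hoare_compute_kernel:
  "\<lbrace>\<lambda>s. scaled s \<and> stores_matrix ''E'' (m + n) row_coeff s\<rbrace> compute_kernel \<lbrace>prepared\<rbrace>"
proof (rule hoare_conseq)
  let ?R = "\<lambda>s. scaled s \<and> stores_matrix ''E'' (m + n) row_coeff s"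
  show "\<lbrace>?R\<rbrace> compute_kernel \<lbrace>\<lambda>s. ?R s \<and> (\<forall>t<n * n. s ''K'' t = kernel (t div n) (t mod n))\<rbrace>"
    unfolding compute_kernel_def
    by (rule hoare_fill[OF _ _ _ hoare_kernel_entry])
      (auto simp: kernel_entry_def state_simps intro!: loop_contextI loop_limits ignores_intros)
qed (auto simp: prepared_def intro!: stores_matrixI)

lemma hoare_profit_entry:
  assumes "j < n"
  shows "\<lbrace>\<lambda>s. prepared s \<and> s ''j'' 0 = j \<and> s ''U'' = y\<rbrace> profit_entry
      \<lbrace>\<lambda>s. s ''U'' = y(j := profit j)\<rbrace>"
proof -
  let ?g = "\<lambda>i. if \<forall>i'<i. d i' j < c i' then w j else 0"
  have "w j \<le> w j * scale ^ n" using scale_pos by simp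
  then have "w j < 2 ^ B" using profit_bound[OF assms] by (rule le_less_trans)
  then have "\<lbrace>\<lambda>s. (prepared s \<and> s ''j'' 0 = j) \<and> s ''U'' = y\<rbrace> profit_entry
      \<lbrace>\<lambda>s. (prepared s \<and> s ''j'' 0 = j) \<and> s ''U'' = y(j := ?g m)\<rbrace>"
    unfolding profit_entry_def using assms by (intro hoare_iterate[where n = m and g = ?g])
      (auto simp: state_simps less_Suc_eq intro!: loop_contextI loop_limits ignores_intros)
  then show ?thesis by (rule hoare_conseq) (use assms in \<open>auto simp: profit_def fits_def\<close>)
qed

lemma hoare_compute_profit: "\<lbrace>prepared\<rbrace> compute_profit \<lbrace>\<lambda>s. prepared s \<and> profits s\<rbrace>"
  unfolding compute_profit_def profits_def
  by (rule hoare_fill[OF _ _ _ hoare_profit_entry])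
    (auto simp: profit_entry_def state_simps intro!: loop_contextI loop_limits ignores_intros)

lemma hoare_cost_entry:
  assumes j_less: "j < n" and Y_le: "\<And>i. i < m + n \<Longrightarrow> Y i \<le> (4 * scale) ^ rounds"
    and frame: "ignores {''i'', ''C''} R" "\<And>s. R s \<Longrightarrow> prepared s \<and> s ''Y'' = Y"
  shows "\<lbrace>\<lambda>s. R s \<and> s ''j'' 0 = j \<and> s ''C'' = y\<rbrace> cost_entry \<lbrace>\<lambda>s. s ''C'' = y(j := item_cost Y j)\<rbrace>"
proof -
  have "\<lbrace>\<lambda>s. (R s \<and> s ''j'' 0 = j) \<and> s ''C'' = y\<rbrace> cost_entry
      \<lbrace>\<lambda>s. (R s \<and> s ''j'' 0 = j) \<and> s ''C'' = y(j := \<Sum>i<m + n. row_coeff i j * Y i)\<rbrace>"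
    unfolding cost_entry_def
  proof (rule hoare_iterate[where n = "m + n" and g = "\<lambda>i. \<Sum>i'<i. row_coeff i' j * Y i'"])
    show "(\<Sum>i'<i. row_coeff i' j * Y i') < 2 ^ B" if "i \<le> m + n" for i
    proof (rule cost_less)
      have "(\<Sum>i'<i. row_coeff i' j * Y i') \<le> (\<Sum>i'<i. 2 * scale * (4 * scale) ^ rounds)"
        using that row_coeff_le Y_le by (intro sum_mono mult_mono) auto
      also have "\<dots> \<le> (m + n) * (2 * scale * (4 * scale) ^ rounds)"
        using that by (simp add: mult_right_mono)
      finally show "(\<Sum>i'<i. row_coeff i' j * Y i') \<le> (m + n) * (2 * scale * (4 * scale) ^ rounds)" .
    qed
  qed (use j_less frame in \<open>auto simp: state_simps intro!: loop_contextI size_le ignores_intros\<close>)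
  then show ?thesis unfolding item_cost_def by (rule hoare_conseq) auto
qed

lemma hoare_mw_costs:
  assumes Y_le: "\<And>i. i < m + n \<Longrightarrow> Y i \<le> (4 * scale) ^ rounds"
    and frame: "ignores {''i'', ''j'', ''C''} R" "\<And>s. R s \<Longrightarrow> prepared s \<and> s ''Y'' = Y"
  shows "\<lbrace>R\<rbrace> mw_costs \<lbrace>\<lambda>s. R s \<and> (\<forall>j<n. s ''C'' j = item_cost Y j)\<rbrace>"
  unfolding mw_costs_def
  using ignores_mono[OF frame(1), of "{''i'', ''C''}"] frame
  by (intro hoare_fill hoare_cost_entry Y_le)
    (auto simp: cost_entry_def state_simps insert_commute intro!: loop_contextI loop_limits)

lemma hoare_mw_best:
  assumes n_pos: "0 < n" and cost_pos: "\<And>j. j < n \<Longrightarrow> 0 < item_cost Y j"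
    and frame: "ignores {''j'', ''b''} R"
      "\<And>s. R s \<Longrightarrow> prepared s \<and> profits s \<and> (\<forall>j<n. s ''C'' j = item_cost Y j)"
  shows "\<lbrace>R\<rbrace> mw_best \<lbrace>\<lambda>s. R s \<and> best_item Y (s ''b'' 0)\<rbrace>"
proof -
  let ?C = "item_cost Y"
  let ?better = "\<lambda>j k. j < n \<and> profit k * ?C j < profit j * ?C k"
  have trans: "?better i k" if "k < n" "?better i j" "?better j k" for i j k
  proof -
    have "?C j * (profit k * ?C i) = (profit k * ?C j) * ?C i" by simp
    also have "\<dots> \<le> (profit j * ?C k) * ?C i" using that by (intro mult_right_mono) auto
    also have "\<dots> = (profit j * ?C i) * ?C k" by simp
    also have "\<dots> < (profit i * ?C j) * ?C k"
      using that cost_pos by (intro mult_strict_right_mono) auto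
    finally have "?C j * (profit k * ?C i) < ?C j * (profit i * ?C k)" by (simp add: mult_ac)
    then show ?thesis using that by simp
  qed
  have "\<lbrace>R\<rbrace> mw_best \<lbrace>\<lambda>s. R s \<and> s ''b'' 0 < n \<and> (\<forall>j<n. \<not> ?better j (s ''b'' 0))\<rbrace>"
    unfolding mw_best_def
  proof (rule hoare_select[OF _ n_pos])
    show "loop_context {''j'', ''b''} (Var ''n'') n R"
      using frame by (intro loop_contextI loop_limits) (simp_all add: state_simps)
    show "bval (''U''\<^bold>[Var ''b''\<^bold>] \<^bold>* ''C''\<^bold>[Var ''j''\<^bold>] \<^bold><
        ''U''\<^bold>[Var ''j''\<^bold>] \<^bold>* ''C''\<^bold>[Var ''b''\<^bold>]) s \<longleftrightarrow> ?better j k"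
      if "j < n" "k < n" "R s" "s ''j'' 0 = j" "s ''b'' 0 = k" for j k s
      using frame(2)[OF that(3)] that by (simp add: profits_def)
  qed (use trans in auto)
  then show ?thesis by (rule hoare_conseq) (auto simp: best_item_def not_less)
qed

lemma hoare_mw_prices:
  assumes b_less: "b < n" and price: "\<And>i. i < m + n \<Longrightarrow> Y i * (2 * scale + row_coeff i b) < 2 ^ B"
    and frame: "ignores {''i'', ''Y''} R" "\<And>s. R s \<Longrightarrow> prepared s \<and> s ''b'' 0 = b"
  shows "\<lbrace>\<lambda>s. R s \<and> s ''Y'' = Y\<rbrace> mw_prices
    \<lbrace>\<lambda>s. R s \<and> (\<forall>i<m + n. s ''Y'' i = Y i * (2 * scale + row_coeff i b))\<rbrace>"
proof -
  let ?f = "\<lambda>i. Y i * (2 * scale + row_coeff i b)"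
  have "\<lbrace>\<lambda>s. R s \<and> s ''Y'' = Y\<rbrace> mw_prices
      \<lbrace>\<lambda>s. R s \<and> (\<forall>l. s ''Y'' l = (if 0 \<le> l \<and> l < 0 + (m + n) then ?f (l - 0) else Y l))\<rbrace>"
    unfolding mw_prices_def using b_less price frame
    by (intro hoare_update[where k = 0 and f = ?f] hoare_Assign)
      (auto simp: state_simps store_same intro!: loop_contextI size_le)
  then show ?thesis by (rule hoare_conseq) auto
qed

lemma hoare_mw_update:
  assumes state: "mw_state t b X Y" and t_less: "t < rounds"
  shows "\<lbrace>\<lambda>s. (prepared s \<and> s ''X'' = X \<and> s ''Y'' = Y) \<and> best_item Y (s ''b'' 0)\<rbrace> mw_update
    \<lbrace>\<lambda>s. \<exists>b. mw_state (Suc t) b (s ''X'') (s ''Y'')\<rbrace>"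
proof (rule hoare_value[where f = "\<lambda>s. s ''b'' 0" and A = "best_item Y"])
  fix j assume best: "best_item Y j"
  then have j_less: "j < n" by (simp add: best_item_def)
  let ?X = "X(j := Suc (X j))"
  let ?R = "\<lambda>s. prepared s \<and> s ''b'' 0 = j \<and> s ''X'' = ?X"
  note state' = mw_state_Suc[OF state best]
  have "Suc (X j) \<le> (\<Sum>l<n. ?X l)" using j_less member_le_sum[of j "{..<n}" ?X] by simp
  also have "\<dots> = Suc t" by (rule mw_state_count[OF state'])
  finally have "Suc (X j) < 2 ^ B" using t_less by (intro rounds_less) simp
  then have count: "\<lbrace>\<lambda>s. (prepared s \<and> s ''X'' = X \<and> s ''Y'' = Y) \<and> s ''b'' 0 = j\<rbrace>
      ''X''\<^bold>[Var ''b''\<^bold>] ::= ''X''\<^bold>[Var ''b''\<^bold>] \<^bold>+ Const 1 \<lbrace>\<lambda>s. ?R s \<and> s ''Y'' = Y\<rbrace>"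
    by (intro hoare_Assign) (auto simp: store_simps prepared_store)
  have "Y i * (2 * scale + row_coeff i j) < 2 ^ B" if "i < m + n" for i
    using t_less by (intro price_less[OF _ mw_state_price_bounds(2)[OF state' that]]) simp
  then have prices: "\<lbrace>\<lambda>s. ?R s \<and> s ''Y'' = Y\<rbrace> mw_prices
      \<lbrace>\<lambda>s. ?R s \<and> (\<forall>i<m + n. s ''Y'' i = Y i * (2 * scale + row_coeff i j))\<rbrace>"
    by (rule hoare_mw_prices[OF j_less]) (auto intro!: ignores_intros)
  show "\<lbrace>\<lambda>s. ((prepared s \<and> s ''X'' = X \<and> s ''Y'' = Y) \<and> best_item Y (s ''b'' 0)) \<and> s ''b'' 0 = j\<rbrace>
      mw_update \<lbrace>\<lambda>s. \<exists>b. mw_state (Suc t) b (s ''X'') (s ''Y'')\<rbrace>"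
    unfolding mw_update_def
    by (rule hoare_conseq[OF hoare_Seq[OF count prices]]) (use state' in \<open>auto simp: mw_state_def\<close>)
qed auto

lemma hoare_mw_round:
  assumes t_less: "t < rounds"
  shows "\<lbrace>\<lambda>s. (\<exists>b. mw_state t b (s ''X'') (s ''Y'')) \<and> prepared s \<and> profits s\<rbrace>
    mw_costs;; mw_best;; mw_update \<lbrace>\<lambda>s. \<exists>b. mw_state (Suc t) b (s ''X'') (s ''Y'')\<rbrace>"
    (is "\<lbrace>?P\<rbrace> ?c \<lbrace>?Q\<rbrace>")
proof (rule hoare_value[where f = "\<lambda>s. (s ''X'', s ''Y'')" and A = "\<lambda>(X, Y). \<exists>b. mw_state t b X Y"])
  fix XY :: "(nat \<Rightarrow> nat) \<times> (nat \<Rightarrow> nat)"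
  assume "case XY of (X, Y) \<Rightarrow> \<exists>b. mw_state t b X Y"
  then obtain X Y b where memory_eq: "XY = (X, Y)" and state: "mw_state t b X Y" by auto
  have n_pos: "0 < n" using t_less by (intro gr0I) simp
  let ?R = "\<lambda>s. prepared s \<and> profits s \<and> s ''X'' = X \<and> s ''Y'' = Y"
  let ?S = "\<lambda>s. ?R s \<and> (\<forall>j<n. s ''C'' j = item_cost Y j)"
  have "(4 * scale) ^ t \<le> (4 * scale) ^ rounds"
    using t_less scale_pos by (intro power_increasing) auto
  then have price_le: "Y i \<le> (4 * scale) ^ rounds" if "i < m + n" for i
    using mw_state_price_bounds(2)[OF state that] by simp
  have costs: "\<lbrace>?R\<rbrace> mw_costs \<lbrace>?S\<rbrace>"
    by (rule hoare_mw_costs[OF price_le]) (auto intro!: ignores_intros)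
  have best: "\<lbrace>?S\<rbrace> mw_best \<lbrace>\<lambda>s. ?S s \<and> best_item Y (s ''b'' 0)\<rbrace>"
    by (rule hoare_mw_best[OF n_pos item_cost_pos[OF state]]) (auto intro!: ignores_intros)
  show "\<lbrace>\<lambda>s. ?P s \<and> (s ''X'', s ''Y'') = XY\<rbrace> ?c \<lbrace>?Q\<rbrace>"
    by (rule hoare_conseq[OF hoare_Seq[OF costs hoare_Seq[OF best
          hoare_conseq[OF hoare_mw_update[OF state t_less]]]]]) (auto simp: memory_eq)
qed auto

lemma hoare_mw:
  "\<lbrace>\<lambda>s. prepared s \<and> profits s\<rbrace> mw
   \<lbrace>\<lambda>s. (\<exists>b Y. mw_state rounds b (s ''X'') Y) \<and> prepared s \<and> profits s\<rbrace>"
proof -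
  let ?R = "\<lambda>s. prepared s \<and> profits s"
  have init_picks: "\<lbrace>?R\<rbrace> FOR ''j'' < Var ''n'' DO ''X''\<^bold>[Var ''j''\<^bold>] ::= Const 0
      \<lbrace>\<lambda>s. ?R s \<and> (\<forall>j<n. s ''X'' j = 0)\<rbrace>"
    by (intro hoare_fill hoare_Assign)
      (auto simp: state_simps store_same intro!: loop_contextI loop_limits ignores_intros)
  have init_prices: "\<lbrace>\<lambda>s. ?R s \<and> (\<forall>j<n. s ''X'' j = 0)\<rbrace>
      FOR ''i'' < Var ''m'' \<^bold>+ Var ''n'' DO ''Y''\<^bold>[Var ''i''\<^bold>] ::= Const 1
      \<lbrace>\<lambda>s. (?R s \<and> (\<forall>j<n. s ''X'' j = 0)) \<and> (\<forall>i<m + n. s ''Y'' i = 1)\<rbrace>"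
    using one_less by (intro hoare_fill hoare_Assign)
      (auto simp: state_simps store_same intro!: loop_contextI size_le ignores_intros)
  have rounds: "\<lbrace>\<lambda>s. (\<exists>b. mw_state 0 b (s ''X'') (s ''Y'')) \<and> ?R s\<rbrace>
      FOR ''t'' < Const 32 \<^bold>* ((Var ''m'' \<^bold>+ Var ''n'') \<^bold>* Var ''n'') DO
        (mw_costs;; mw_best;; mw_update)
      \<lbrace>\<lambda>s. (\<exists>b. mw_state rounds b (s ''X'') (s ''Y'')) \<and> ?R s\<rbrace>"
  proof (rule hoare_For[where I = "\<lambda>t s. \<exists>b. mw_state t b (s ''X'') (s ''Y'')"])
    show "\<lbrace>\<lambda>s. (\<exists>b. mw_state t b (s ''X'') (s ''Y'')) \<and> ?R s \<and> s ''t'' 0 = t\<rbrace>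
        mw_costs;; mw_best;; mw_update \<lbrace>\<lambda>s. \<exists>b. mw_state (Suc t) b (s ''X'') (s ''Y'')\<rbrace>"
      if "t < rounds" for t
      by (rule hoare_conseq[OF hoare_mw_round[OF that]]) auto
  qed (auto simp: mw_costs_def cost_entry_def mw_best_def mw_update_def mw_prices_def state_simps
      ignores_def[of "{''t''}"] intro!: loop_contextI rounds_le ignores_intros)
  show ?thesis unfolding mw_def
    by (rule hoare_conseq[OF hoare_Seq[OF init_picks
          hoare_Seq[OF hoare_conseq[OF init_prices] rounds]]])
      (blast intro: mw_state_0)+
qed

lemma hoare_degree_entry:
  assumes j_less: "j < n" and count: "(\<Sum>l<n. X l) = rounds"
    and frame: "ignores {''l'', ''G''} R" "\<And>s. R s \<Longrightarrow> prepared s \<and> s ''X'' = X \<and> s ''Z'' = Z"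
  shows "\<lbrace>\<lambda>s. R s \<and> s ''j'' 0 = j \<and> s ''G'' = y\<rbrace> degree_entry
    \<lbrace>\<lambda>s. s ''G'' = y(j := kernel_degree X {l \<in> {..<n}. Z l = 0} j)\<rbrace>"
proof -
  let ?g = "\<lambda>i. \<Sum>l<i. of_bool (Z l = 0) * (X l * kernel j l)"
  have total: "?g n = kernel_degree X {l \<in> {..<n}. Z l = 0} j"
    unfolding kernel_degree_def sum.inter_filter[OF finite_lessThan] by (intro sum.cong) auto
  have available: "Suc 0 - a = of_bool (a = 0)" for a by (cases a) simp_all
  have "\<lbrace>\<lambda>s. (R s \<and> s ''j'' 0 = j) \<and> s ''G'' = y\<rbrace> degree_entry
      \<lbrace>\<lambda>s. (R s \<and> s ''j'' 0 = j) \<and> s ''G'' = y(j := ?g n)\<rbrace>"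
    unfolding degree_entry_def
  proof (rule hoare_iterate[where n = n and g = ?g])
    show "?g i < 2 ^ B" if "i \<le> n" for i
    proof (rule degree_less)
      have "?g i \<le> (\<Sum>l<n. of_bool (Z l = 0) * (X l * kernel j l))"
        using that by (intro sum_mono2) auto
      also have "\<dots> \<le> (\<Sum>l<n. X l * (2 * (m * scale)))"
        using kernel_le by (intro sum_mono) (simp add: mult_le_mono)
      also have "\<dots> = rounds * (2 * (m * scale))" by (simp only: count flip: sum_distrib_right)
      finally show "?g i \<le> rounds * (2 * (m * scale))" .
    qed
  qed (use j_less frame in \<open>auto simp: state_simps available
      intro!: loop_contextI loop_limits ignores_intros\<close>)
  then show ?thesis unfolding total by (rule hoare_conseq) auto
qed

lemma hoare_lr_degrees:
  assumes count: "(\<Sum>l<n. X l) = rounds"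
    and frame: "ignores {''j'', ''l'', ''G''} R" "\<And>s. R s \<Longrightarrow> prepared s \<and> s ''X'' = X \<and> s ''Z'' = Z"
  shows "\<lbrace>R\<rbrace> lr_degrees \<lbrace>\<lambda>s. R s \<and> (\<forall>j<n. s ''G'' j = kernel_degree X {l \<in> {..<n}. Z l = 0} j)\<rbrace>"
  unfolding lr_degrees_def
  using ignores_mono[OF frame(1), of "{''l'', ''G''}"] frame
  by (intro hoare_fill hoare_degree_entry count)
    (auto simp: degree_entry_def state_simps insert_commute intro!: loop_contextI loop_limits)

lemma hoare_lr_best:
  assumes available: "l < n" "Z l = 0"
    and frame: "ignores {''j'', ''b''} R"
      "\<And>s. R s \<Longrightarrow> prepared s \<and> s ''Z'' = Z \<and> (\<forall>j<n. s ''G'' j = D j)"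
  shows "\<lbrace>R\<rbrace> lr_best
    \<lbrace>\<lambda>s. R s \<and> s ''b'' 0 < n \<and> Z (s ''b'' 0) = 0 \<and> (\<forall>j<n. Z j = 0 \<longrightarrow> D (s ''b'' 0) \<le> D j)\<rbrace>"
proof -
  let ?better = "\<lambda>j k. Z j = 0 \<and> (Z k = 0 \<longrightarrow> D j < D k)"
  have "\<lbrace>R\<rbrace> lr_best \<lbrace>\<lambda>s. R s \<and> s ''b'' 0 < n \<and> (\<forall>j<n. \<not> ?better j (s ''b'' 0))\<rbrace>"
    unfolding lr_best_def
  proof (rule hoare_select)
    show "loop_context {''j'', ''b''} (Var ''n'') n R"
      using frame by (intro loop_contextI loop_limits) (simp_all add: state_simps)
    show "bval (''Z''\<^bold>[Var ''j''\<^bold>] \<^bold>< Const 1 \<^bold>\<and>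
        \<^bold>\<not> (''Z''\<^bold>[Var ''b''\<^bold>] \<^bold>< Const 1 \<^bold>\<and> \<^bold>\<not> ''G''\<^bold>[Var ''j''\<^bold>] \<^bold>< ''G''\<^bold>[Var ''b''\<^bold>])) s
        \<longleftrightarrow> ?better j k"
      if "j < n" "k < n" "R s" "s ''j'' 0 = j" "s ''b'' 0 = k" for j k s
      using frame(2)[OF that(3)] that by auto
  qed (use available in auto)
  then show ?thesis by (rule hoare_conseq) (use available in \<open>auto simp: not_less\<close>)
qed

definition lr_memory :: "nat \<Rightarrow> (nat \<Rightarrow> nat) \<Rightarrow> state \<Rightarrow> bool" where
  "lr_memory p X s \<longleftrightarrow>
     lr_state p X (s ''q'') (s ''U'') \<and> (\<forall>l<n. s ''Z'' l = 0 \<longleftrightarrow> l \<in> pending (s ''q'') p)"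

lemma hoare_residual_entry:
  assumes b_less: "b < n" and l_less: "l < n" and y_eq: "y l = U l"
    and bits: "Z l = 0 \<Longrightarrow> U l * scale - U b * kernel b l < 2 ^ B"
    and frame: "\<And>s. R s \<Longrightarrow> prepared s \<and> s ''b'' 0 = b \<and> s ''v'' 0 = U b \<and> s ''Z'' = Z"
  shows "\<lbrace>\<lambda>s. R s \<and> s ''l'' 0 = l \<and> s ''U'' = y\<rbrace> residual_entry
    \<lbrace>\<lambda>s. s ''U'' = y(l := if Z l = 0 then U l * scale - U b * kernel b l else U l)\<rbrace>"
    (is "\<lbrace>?P\<rbrace> _ \<lbrace>?Q\<rbrace>")
  unfolding residual_entry_def
proof (intro hoare_Cond hoare_Assign hoare_Skip)
  fix s assume guarded: "?P s \<and> bval (''Z''\<^bold>[Var ''l''\<^bold>] \<^bold>< Const 1) s"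
  let ?e = "''U''\<^bold>[Var ''l''\<^bold>] \<^bold>* Var ''P'' \<^bold>- Var ''v'' \<^bold>* ''K''\<^bold>[At (Var ''b'') (Var ''l'')\<^bold>]"
  have "aval ?e s = U l * scale - U b * kernel b l"
    using guarded l_less y_eq b_less frame[of s] by (simp add: state_simps)
  moreover have "Z l = 0" using guarded frame[of s] by auto
  ultimately show "aval ?e s < 2 ^ B \<and> ?Q (store ''U'' (aval (Var ''l'') s) (aval ?e s) s)"
    using guarded bits frame[of s] by (simp add: store_same)
next
  fix s assume "?P s \<and> \<not> bval (''Z''\<^bold>[Var ''l''\<^bold>] \<^bold>< Const 1) s"
  then show "?Q s" using y_eq frame[of s] by auto
qed

lemma hoare_lr_residuals:
  assumes b_less: "b < n" and state: "lr_state p X q U" and p_less: "p < n"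
    and Z_pending: "\<And>l. l < n \<Longrightarrow> Z l = 0 \<Longrightarrow> l \<in> pending q p"
    and frame: "ignores {''l'', ''U''} R"
      "\<And>s. R s \<Longrightarrow> prepared s \<and> s ''b'' 0 = b \<and> s ''v'' 0 = U b \<and> s ''Z'' = Z"
  shows "\<lbrace>\<lambda>s. R s \<and> s ''U'' = U\<rbrace> lr_residuals
    \<lbrace>\<lambda>s. R s \<and> (\<forall>l<n. s ''U'' l = (if Z l = 0 then U l * scale - U b * kernel b l else U l))\<rbrace>"
proof -
  let ?f = "\<lambda>l. if Z l = 0 then U l * scale - U b * kernel b l else U l"
  have bits: "U l * scale - U b * kernel b l < 2 ^ B" if "l < n" "Z l = 0" for l
  proof -
    have "U l * scale \<le> w l * scale ^ p * scale"
      using lr_state_residual_le[OF state Z_pending[OF that]] by simp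
    also have "\<dots> = w l * scale ^ Suc p" by simp
    also have "\<dots> \<le> w l * scale ^ n"
      using p_less scale_pos by (intro mult_left_mono power_increasing) auto
    finally show ?thesis using profit_bound[OF that(1)] by (meson diff_le_self le_less_trans)
  qed
  have entry: "\<lbrace>\<lambda>s. R s \<and> s ''l'' 0 = l \<and> s ''U'' = y\<rbrace> residual_entry
      \<lbrace>\<lambda>s. s ''U'' = y(0 + l := ?f l)\<rbrace>"
    if "l < n" "y (0 + l) = U (0 + l)" for l y
    unfolding add_0 using that by (intro hoare_residual_entry b_less bits frame(2)) simp_all
  have "loop_context {''l'', ''U''} (Var ''n'') n R"
    using frame by (intro loop_contextI loop_limits) (simp_all add: state_simps)
  then have "\<lbrace>\<lambda>s. R s \<and> s ''U'' = U\<rbrace> lr_residuals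
      \<lbrace>\<lambda>s. R s \<and> (\<forall>l. s ''U'' l = (if 0 \<le> l \<and> l < 0 + n then ?f (l - 0) else U l))\<rbrace>"
    unfolding lr_residuals_def using entry
    by (intro hoare_update[where k = 0 and f = ?f]) (simp_all add: residual_entry_def)
  then show ?thesis by (rule hoare_conseq) auto
qed

lemma hoare_lr_update_item:
  assumes state: "lr_state p X q U" and p_less: "p < n"
    and Z_iff: "\<And>l. l < n \<Longrightarrow> Z l = 0 \<longleftrightarrow> l \<in> pending q p"
    and minimal: "minimal_degree X (pending q p) b"
  shows "\<lbrace>\<lambda>s. prepared s \<and> s ''q'' = q \<and> s ''U'' = U \<and> s ''Z'' = Z \<and> s ''p'' 0 = p \<and> s ''b'' 0 = b\<rbrace>
    lr_update \<lbrace>lr_memory (Suc p) X\<rbrace>" (is "\<lbrace>?P\<rbrace> _ \<lbrace>_\<rbrace>")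
proof -
  let ?Z = "Z(b := 1)"
  let ?R = "\<lambda>s. prepared s \<and> s ''b'' 0 = b \<and> s ''v'' 0 = U b \<and> s ''Z'' = ?Z \<and> s ''q'' = q(p := b)"
  have "b < n" using minimal by (simp add: minimal_degree_def pending_def)
  then have "\<lbrace>\<lambda>s. ?R s \<and> s ''U'' = U\<rbrace> lr_residuals
      \<lbrace>\<lambda>s. ?R s \<and> (\<forall>l<n. s ''U'' l = (if ?Z l = 0 then U l * scale - U b * kernel b l else U l))\<rbrace>"
    using Z_iff by (intro hoare_lr_residuals[OF _ state p_less])
      (auto intro!: ignores_intros split: if_splits)
  then have residuals: "\<lbrace>\<lambda>s. ?R s \<and> s ''U'' = U\<rbrace> lr_residuals \<lbrace>lr_memory (Suc p) X\<rbrace>"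
  proof (rule hoare_conseq)
    fix s
    assume final: "?R s \<and>
        (\<forall>l<n. s ''U'' l = (if ?Z l = 0 then U l * scale - U b * kernel b l else U l))"
    then have "lr_state (Suc p) X (q(p := b)) (s ''U'')"
      using Z_iff by (intro lr_state_Suc[OF state minimal]) auto
    then show "lr_memory (Suc p) X s"
      using final Z_iff by (auto simp: lr_memory_def pending_fun_upd_Suc)
  qed
  let ?S = "\<lambda>s. prepared s \<and> s ''b'' 0 = b \<and> s ''q'' = q(p := b) \<and> s ''U'' = U"
  have order: "\<lbrace>?P\<rbrace> ''q''\<^bold>[Var ''p''\<^bold>] ::= Var ''b'' \<lbrace>\<lambda>s. ?S s \<and> s ''Z'' = Z\<rbrace>"
    by (intro hoare_Assign) (auto simp: store_simps prepared_store bounded_state_def)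
  have flag: "\<lbrace>\<lambda>s. ?S s \<and> s ''Z'' = Z\<rbrace> ''Z''\<^bold>[Var ''b''\<^bold>] ::= Const 1 \<lbrace>\<lambda>s. ?S s \<and> s ''Z'' = ?Z\<rbrace>"
    using one_less by (intro hoare_Assign) (auto simp: store_simps prepared_store)
  have amount: "\<lbrace>\<lambda>s. ?S s \<and> s ''Z'' = ?Z\<rbrace> ''v'' ::= ''U''\<^bold>[Var ''b''\<^bold>] \<lbrace>\<lambda>s. ?R s \<and> s ''U'' = U\<rbrace>"
    by (intro hoare_Assign) (auto simp: store_simps prepared_store bounded_state_def)
  show ?thesis
    unfolding lr_update_def
    by (intro hoare_Seq[OF order] hoare_Seq[OF flag] hoare_Seq[OF amount] residuals)
qed

lemma hoare_lr_update:
  assumes "lr_state p X q U" "p < n" "\<And>l. l < n \<Longrightarrow> Z l = 0 \<longleftrightarrow> l \<in> pending q p"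
  shows "\<lbrace>\<lambda>s. (prepared s \<and> s ''q'' = q \<and> s ''U'' = U \<and> s ''Z'' = Z \<and> s ''p'' 0 = p) \<and>
      minimal_degree X (pending q p) (s ''b'' 0)\<rbrace>
    lr_update \<lbrace>lr_memory (Suc p) X\<rbrace>" (is "\<lbrace>?P\<rbrace> _ \<lbrace>?Q\<rbrace>")
proof (rule hoare_value[where f = "\<lambda>s. s ''b'' 0" and A = "minimal_degree X (pending q p)"])
  show "\<lbrace>\<lambda>s. ?P s \<and> s ''b'' 0 = b\<rbrace> lr_update \<lbrace>?Q\<rbrace>" if "minimal_degree X (pending q p) b" for b
    by (rule hoare_conseq[OF hoare_lr_update_item[OF assms that]]) auto
qed auto

lemma hoare_lr_round:
  assumes p_less: "p < n" and count: "(\<Sum>l<n. X l) = rounds"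
  shows "\<lbrace>\<lambda>s. lr_memory p X s \<and> (prepared s \<and> s ''X'' = X) \<and> s ''p'' 0 = p\<rbrace>
    lr_degrees;; lr_best;; lr_update \<lbrace>lr_memory (Suc p) X\<rbrace>" (is "\<lbrace>?P\<rbrace> ?c \<lbrace>?Q\<rbrace>")
proof (rule hoare_value[where f = "\<lambda>s. (s ''q'', s ''U'', s ''Z'')" and
      A = "\<lambda>(q, U, Z). lr_state p X q U \<and> (\<forall>l<n. Z l = 0 \<longleftrightarrow> l \<in> pending q p)"])
  fix memory :: "(nat \<Rightarrow> nat) \<times> (nat \<Rightarrow> nat) \<times> (nat \<Rightarrow> nat)"
  assume "case memory of (q, U, Z) \<Rightarrow> lr_state p X q U \<and> (\<forall>l<n. Z l = 0 \<longleftrightarrow> l \<in> pending q p)"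
  then obtain q U Z where memory_eq: "memory = (q, U, Z)"
    and state: "lr_state p X q U" and Z_iff: "\<And>l. l < n \<Longrightarrow> Z l = 0 \<longleftrightarrow> l \<in> pending q p"
    by auto
  have pending: "{l \<in> {..<n}. Z l = 0} = pending q p" using Z_iff by (auto simp: pending_def)
  have "pending q p \<noteq> {}" using p_less by (rule pending_nonempty)
  then obtain l where available: "l < n" "Z l = 0" unfolding pending[symmetric] by auto
  let ?R = "\<lambda>s. prepared s \<and> s ''X'' = X \<and> s ''q'' = q \<and> s ''U'' = U \<and> s ''Z'' = Z \<and> s ''p'' 0 = p"
  let ?D = "kernel_degree X (pending q p)"
  let ?S = "\<lambda>s. ?R s \<and> (\<forall>j<n. s ''G'' j = ?D j)"
  have degrees: "\<lbrace>?R\<rbrace> lr_degrees \<lbrace>?S\<rbrace>"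
    unfolding pending[symmetric] by (rule hoare_lr_degrees[OF count]) (auto intro!: ignores_intros)
  have best: "\<lbrace>?S\<rbrace> lr_best \<lbrace>\<lambda>s. ?S s \<and> s ''b'' 0 < n \<and> Z (s ''b'' 0) = 0 \<and>
      (\<forall>j<n. Z j = 0 \<longrightarrow> ?D (s ''b'' 0) \<le> ?D j)\<rbrace>"
    by (rule hoare_lr_best[where Z = Z, OF available]) (auto intro!: ignores_intros)
  have minimal: "minimal_degree X (pending q p) b"
    if "b < n" "Z b = 0" "\<forall>j<n. Z j = 0 \<longrightarrow> ?D b \<le> ?D j" for b
    using that pending by (auto simp: minimal_degree_def)
  show "\<lbrace>\<lambda>s. ?P s \<and> (s ''q'', s ''U'', s ''Z'') = memory\<rbrace> ?c \<lbrace>?Q\<rbrace>"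
    by (rule hoare_conseq[OF hoare_Seq[OF degrees hoare_Seq[OF best
          hoare_conseq[OF hoare_lr_update[OF state p_less Z_iff]]]]]) (auto simp: memory_eq minimal)
qed (auto simp: lr_memory_def)

lemma hoare_lr:
  assumes count: "(\<Sum>l<n. X l) = rounds"
  shows "\<lbrace>\<lambda>s. (prepared s \<and> profits s) \<and> s ''X'' = X\<rbrace> lr
    \<lbrace>\<lambda>s. prepared s \<and> s ''X'' = X \<and> lr_state n X (s ''q'') (s ''U'')\<rbrace>"
proof -
  let ?R = "\<lambda>s. prepared s \<and> s ''X'' = X"
  have init_flags: "\<lbrace>\<lambda>s. ?R s \<and> profits s\<rbrace> FOR ''j'' < Var ''n'' DO ''Z''\<^bold>[Var ''j''\<^bold>] ::= Const 0
      \<lbrace>\<lambda>s. (?R s \<and> profits s) \<and> (\<forall>j<n. s ''Z'' j = 0)\<rbrace>"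
    by (intro hoare_fill hoare_Assign)
      (auto simp: state_simps store_same intro!: loop_contextI loop_limits ignores_intros)
  have rounds: "\<lbrace>\<lambda>s. lr_memory 0 X s \<and> ?R s\<rbrace>
      FOR ''p'' < Var ''n'' DO (lr_degrees;; lr_best;; lr_update)
      \<lbrace>\<lambda>s. lr_memory n X s \<and> ?R s\<rbrace>"
    by (rule hoare_For[where I = "\<lambda>p. lr_memory p X", OF _ _ _ hoare_lr_round])
      (auto simp: lr_degrees_def degree_entry_def lr_best_def lr_update_def lr_residuals_def
        residual_entry_def state_simps lr_memory_def ignores_def[of "{''p''}"] count
        intro!: loop_contextI loop_limits ignores_intros)
  show ?thesis unfolding lr_def
  proof (rule hoare_conseq[OF hoare_Seq[OF init_flags hoare_conseq[OF rounds]]])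
    show "lr_memory 0 X s \<and> ?R s" if "(?R s \<and> profits s) \<and> (\<forall>j<n. s ''Z'' j = 0)" for s
      using that lr_state_0 by (auto simp: lr_memory_def profits_def pending_def)
  qed (auto simp: lr_memory_def)
qed

lemma hoare_greedy_test:
  assumes p_less: "p < n" and j_less: "q (n - Suc p) < n"
    and frame: "ignores {''e'', ''i'', ''o''} R"
      "\<And>s. R s \<Longrightarrow> data s \<and> s ''q'' = q \<and> s ''U'' = U \<and> s ''L'' = L \<and> s ''p'' 0 = p"
  shows "\<lbrace>R\<rbrace> greedy_test \<lbrace>\<lambda>s. R s \<and> s ''e'' 0 = q (n - Suc p) \<and>
    s ''o'' 0 = of_bool (0 < U (q (n - Suc p)) \<and> (\<forall>i<m. L i + d i (q (n - Suc p)) < c i))\<rbrace>"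
    (is "\<lbrace>_\<rbrace> _ \<lbrace>?Q\<rbrace>")
proof (rule hoare_array[where x = "''o''"])
  fix y
  let ?j = "q (n - Suc p)"
  let ?S = "\<lambda>s. (R s \<and> s ''e'' 0 = ?j) \<and> s ''o'' = y"
  let ?g = "\<lambda>i. of_bool (0 < U ?j \<and> (\<forall>i'<i. L i' + d i' ?j < c i'))"
  let ?e = "''q''\<^bold>[Var ''n'' \<^bold>- (Var ''p'' \<^bold>+ Const 1)\<^bold>]"
  have keep: "R (store ''e'' 0 v s)" if "R s" for v s
    using ignores_store[OF frame(1) _ that] by simp
  have item: "\<lbrace>\<lambda>s. R s \<and> s ''o'' = y\<rbrace> ''e'' ::= ?e \<lbrace>?S\<rbrace>"
  proof (rule hoare_Assign)
    fix s assume start: "bounded_state B s" "R s \<and> s ''o'' = y"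
    have "q (n - Suc p) < 2 ^ B" using start frame(2)[of s] unfolding bounded_state_def by metis
    then show "aval ?e s < 2 ^ B \<and> ?S (store ''e'' (aval (Const 0) s) (aval ?e s) s)"
      using start frame(2)[of s] keep by (simp add: store_simps state_simps)
  qed
  have "ignores {''i'', ''o''} (\<lambda>s. R s \<and> s ''e'' 0 = ?j)"
    using ignores_mono[OF frame(1), of "{''i'', ''o''}"] by (auto intro!: ignores_intros)
  then have test: "\<lbrace>?S\<rbrace> fit_test \<lbrace>\<lambda>s. (R s \<and> s ''e'' 0 = ?j) \<and> s ''o'' = y(0 := ?g m)\<rbrace>"
    unfolding fit_test_def using frame(2) j_less one_less
    by (intro hoare_iterate[where n = m and g = ?g])
      (auto simp: state_simps less_Suc_eq intro!: loop_contextI loop_limits)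
  show "\<lbrace>\<lambda>s. R s \<and> s ''o'' = y\<rbrace> greedy_test \<lbrace>?Q\<rbrace>"
    unfolding greedy_test_def by (rule hoare_conseq[OF hoare_Seq[OF item test]]) auto
qed

lemma hoare_greedy_add:
  assumes j_less: "j < n" and fitting: "\<And>i. i < m \<Longrightarrow> L i + of_bool ok * d i j < c i"
  shows "\<lbrace>\<lambda>s. data s \<and> s ''out'' = x \<and> s ''L'' = L \<and> s ''e'' 0 = j \<and> s ''o'' 0 = of_bool ok\<rbrace>
    greedy_add \<lbrace>\<lambda>s. s ''out'' = x(j := of_bool ok) \<and> (\<forall>i<m. s ''L'' i = L i + of_bool ok * d i j)\<rbrace>"
proof -
  let ?R = "\<lambda>s. data s \<and> s ''e'' 0 = j \<and> s ''o'' 0 = of_bool ok \<and> s ''out'' = x(j := of_bool ok)"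
  let ?f = "\<lambda>i. L i + of_bool ok * d i j"
  have out: "\<lbrace>\<lambda>s. data s \<and> s ''out'' = x \<and> s ''L'' = L \<and> s ''e'' 0 = j \<and> s ''o'' 0 = of_bool ok\<rbrace>
      ''out''\<^bold>[Var ''e''\<^bold>] ::= Var ''o'' \<lbrace>\<lambda>s. ?R s \<and> s ''L'' = L\<rbrace>"
    using one_less by (intro hoare_Assign)
      (auto simp: store_simps intro!: ignores_store[OF ignores_data[of "{''out''}"]])
  have bits: "?f i < 2 ^ B" if "i < m" for i
    using fitting[OF that] capacity_le_scale[OF that] scale_less by linarith
  have loads: "\<lbrace>\<lambda>s. ?R s \<and> s ''L'' = L\<rbrace> greedy_loads
      \<lbrace>\<lambda>s. ?R s \<and> (\<forall>l. s ''L'' l = (if 0 \<le> l \<and> l < 0 + m then ?f (l - 0) else L l))\<rbrace>"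
    unfolding greedy_loads_def using j_less bits
    by (intro hoare_update[where k = 0 and f = ?f] hoare_Assign)
      (auto simp: state_simps store_same intro!: loop_contextI loop_limits ignores_intros)
  show ?thesis unfolding greedy_add_def by (rule hoare_conseq[OF hoare_Seq[OF out loads]]) auto
qed

definition greedy_suffix :: "(nat \<Rightarrow> nat) \<Rightarrow> (nat \<Rightarrow> nat) \<Rightarrow> nat \<Rightarrow> nat set" where
  "greedy_suffix q U p = greedy (selectable U) (map q [n - p..<n])"

definition greedy_memory :: "(nat \<Rightarrow> nat) \<Rightarrow> (nat \<Rightarrow> nat) \<Rightarrow> nat \<Rightarrow> state \<Rightarrow> bool" where
  "greedy_memory q U p s \<longleftrightarrow> (\<forall>j<n. s ''out'' j = of_bool (j \<in> greedy_suffix q U p)) \<and>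
     (\<forall>i<m. s ''L'' i = (\<Sum>l\<in>greedy_suffix q U p. d i l))"

lemma selectable_greedy_suffix: "selectable U (greedy_suffix q U p)"
  unfolding greedy_suffix_def by (rule greedy_ok) simp

lemma greedy_suffix_Suc:
  fixes q U :: "nat \<Rightarrow> nat"
  assumes "p < n" "inj_on q {..<n}" "q (n - Suc p) < n"
  defines "G \<equiv> greedy_suffix q U p" and "j \<equiv> q (n - Suc p)"
  defines "ok \<equiv> 0 < U j \<and> (\<forall>i<m. (\<Sum>l\<in>G. d i l) + d i j < c i)"
  shows "j \<notin> G" "greedy_suffix q U (Suc p) = (if ok then insert j G else G)"
proof -
  have "G \<subseteq> q ` {n - p..<n}" unfolding G_def greedy_suffix_def using greedy_subset by force
  moreover have "j \<notin> q ` {n - p..<n}"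
    unfolding j_def using assms(1) by (subst inj_on_image_mem_iff[OF assms(2)]) auto
  ultimately show "j \<notin> G" by blast
  then have "selectable U (insert j G) \<longleftrightarrow> ok"
    unfolding ok_def using assms(3)
    by (intro selectable_insert_iff) (simp_all add: G_def j_def selectable_greedy_suffix)
  moreover have "[n - Suc p..<n] = (n - Suc p) # [n - p..<n]"
    using assms(1) by (subst upt_conv_Cons) (auto simp: Suc_diff_Suc)
  ultimately show "greedy_suffix q U (Suc p) = (if ok then insert j G else G)"
    by (simp add: greedy_suffix_def G_def j_def)
qed

lemma hoare_greedy_round:
  assumes p_less: "p < n" and order: "inj_on q {..<n}" "q ` {..<n} \<subseteq> {..<n}"
  shows "\<lbrace>\<lambda>s. greedy_memory q U p s \<and> (data s \<and> s ''q'' = q \<and> s ''U'' = U) \<and> s ''p'' 0 = p\<rbrace>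
    greedy_test;; greedy_add \<lbrace>greedy_memory q U (Suc p)\<rbrace>" (is "\<lbrace>?P\<rbrace> ?c \<lbrace>?Q\<rbrace>")
proof -
  let ?G = "greedy_suffix q U p" and ?j = "q (n - Suc p)"
  let ?stored = "\<lambda>(x, L). (\<forall>j<n. x j = of_bool (j \<in> ?G)) \<and> (\<forall>i<m. L i = (\<Sum>l\<in>?G. d i l))"
  show ?thesis
  proof (rule hoare_value[where f = "\<lambda>s. (s ''out'', s ''L'')" and A = ?stored])
    fix memory :: "(nat \<Rightarrow> nat) \<times> (nat \<Rightarrow> nat)"
    assume "?stored memory"
    then obtain x L where memory_eq: "memory = (x, L)"
      and x_eq: "\<And>j. j < n \<Longrightarrow> x j = of_bool (j \<in> ?G)" and L_eq: "\<And>i. i < m \<Longrightarrow> L i = (\<Sum>l\<in>?G. d i l)"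
      by auto
    let ?ok = "0 < U ?j \<and> (\<forall>i<m. L i + d i ?j < c i)"
    let ?R = "\<lambda>s. data s \<and> s ''q'' = q \<and> s ''U'' = U \<and> s ''L'' = L \<and> s ''p'' 0 = p \<and> s ''out'' = x"
    have j_less: "?j < n" using order(2) p_less by (auto simp: image_subset_iff)
    have fin: "finite ?G" using selectable_greedy_suffix fits_finite by (auto simp: selectable_def)
    have fitting: "L i + of_bool ?ok * d i ?j < c i" if "i < m" for i
      using L_eq[OF that] selectable_greedy_suffix[of U q p] that
      by (cases ?ok) (auto simp: selectable_def fits_def)
    have test: "\<lbrace>?R\<rbrace> greedy_test \<lbrace>\<lambda>s. ?R s \<and> s ''e'' 0 = ?j \<and> s ''o'' 0 = of_bool ?ok\<rbrace>"
      by (rule hoare_greedy_test[where q = q, OF p_less j_less]) (auto intro!: ignores_intros)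
    note suffix = greedy_suffix_Suc[OF p_less order(1) j_less, of U]
    have "?ok \<longleftrightarrow> 0 < U ?j \<and> (\<forall>i<m. (\<Sum>l\<in>?G. d i l) + d i ?j < c i)" using L_eq by auto
    then have "greedy_suffix q U (Suc p) = (if ?ok then insert ?j ?G else ?G)"
      using suffix(2) by simp
    then have "?Q s"
      if "s ''out'' = x(?j := of_bool ?ok) \<and> (\<forall>i<m. s ''L'' i = L i + of_bool ?ok * d i ?j)" for s
      using that x_eq L_eq suffix(1) fin by (cases ?ok) (auto simp: greedy_memory_def)
    then show "\<lbrace>\<lambda>s. ?P s \<and> (s ''out'', s ''L'') = memory\<rbrace> ?c \<lbrace>?Q\<rbrace>"
      by (intro hoare_conseq[OF hoare_Seq[OF test
            hoare_conseq[OF hoare_greedy_add[OF j_less fitting]]]])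
        (auto simp: memory_eq)
  qed (auto simp: greedy_memory_def)
qed

lemma hoare_select_greedily:
  assumes order: "inj_on q {..<n}" "q ` {..<n} \<subseteq> {..<n}"
  shows "\<lbrace>\<lambda>s. data s \<and> s ''q'' = q \<and> s ''U'' = U\<rbrace> select_greedily
    \<lbrace>\<lambda>s. \<forall>j<n. s ''out'' j = of_bool (j \<in> greedy (selectable U) (map q [0..<n]))\<rbrace>"
proof -
  let ?R = "\<lambda>s. data s \<and> s ''q'' = q \<and> s ''U'' = U"
  have out: "\<lbrace>?R\<rbrace> FOR ''j'' < Var ''n'' DO ''out''\<^bold>[Var ''j''\<^bold>] ::= Const 0
      \<lbrace>\<lambda>s. ?R s \<and> (\<forall>j<n. s ''out'' j = 0)\<rbrace>"
    by (intro hoare_fill hoare_Assign)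
      (auto simp: state_simps store_same intro!: loop_contextI loop_limits ignores_intros)
  have loads: "\<lbrace>\<lambda>s. ?R s \<and> (\<forall>j<n. s ''out'' j = 0)\<rbrace>
      FOR ''i'' < Var ''m'' DO ''L''\<^bold>[Var ''i''\<^bold>] ::= Const 0
      \<lbrace>\<lambda>s. (?R s \<and> (\<forall>j<n. s ''out'' j = 0)) \<and> (\<forall>i<m. s ''L'' i = 0)\<rbrace>"
    by (intro hoare_fill hoare_Assign)
      (auto simp: state_simps store_same intro!: loop_contextI loop_limits ignores_intros)
  have rounds: "\<lbrace>\<lambda>s. greedy_memory q U 0 s \<and> ?R s\<rbrace>
      FOR ''p'' < Var ''n'' DO (greedy_test;; greedy_add)
      \<lbrace>\<lambda>s. greedy_memory q U n s \<and> ?R s\<rbrace>"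
    by (rule hoare_For[where I = "greedy_memory q U", OF _ _ _ hoare_greedy_round[OF _ order]])
      (auto simp: greedy_test_def fit_test_def greedy_add_def greedy_loads_def state_simps
        greedy_memory_def ignores_def[of "{''p''}"]
        intro!: loop_contextI loop_limits ignores_intros)
  show ?thesis
    unfolding select_greedily_def
    by (rule hoare_conseq[OF hoare_Seq[OF out hoare_Seq[OF loads hoare_conseq[OF rounds]]]])
      (auto simp: greedy_memory_def greedy_suffix_def)
qed

definition solved :: "state \<Rightarrow> bool" where
  "solved s \<longleftrightarrow> (\<exists>b X Y q U. mw_state rounds b X Y \<and> lr_state n X q U \<and>
     (\<forall>j<n. s ''out'' j = of_bool (j \<in> greedy (selectable U) (map q [0..<n]))))"

lemma hoare_select_greedily_solved:
  assumes mw: "mw_state rounds b X Y"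
  shows "\<lbrace>\<lambda>s. prepared s \<and> s ''X'' = X \<and> lr_state n X (s ''q'') (s ''U'')\<rbrace> select_greedily \<lbrace>solved\<rbrace>"
    (is "\<lbrace>?P\<rbrace> _ \<lbrace>_\<rbrace>")
proof (rule hoare_value[where f = "\<lambda>s. (s ''q'', s ''U'')" and A = "\<lambda>(q, U). lr_state n X q U"])
  fix memory :: "(nat \<Rightarrow> nat) \<times> (nat \<Rightarrow> nat)"
  assume "case memory of (q, U) \<Rightarrow> lr_state n X q U"
  then obtain q U where memory_eq: "memory = (q, U)" and lr: "lr_state n X q U" by auto
  show "\<lbrace>\<lambda>s. ?P s \<and> (s ''q'', s ''U'') = memory\<rbrace> select_greedily \<lbrace>solved\<rbrace>"
    by (rule hoare_conseq[OF hoare_select_greedily[of q U]])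
      (use lr mw in \<open>auto simp: memory_eq solved_def lr_state_def state_simps\<close>)
qed auto

lemma hoare_round_fractional:
  "\<lbrace>\<lambda>s. (\<exists>b Y. mw_state rounds b (s ''X'') Y) \<and> prepared s \<and> profits s\<rbrace>
   lr;; select_greedily \<lbrace>solved\<rbrace>"
    (is "\<lbrace>?P\<rbrace> _ \<lbrace>_\<rbrace>")
proof (rule hoare_value[where f = "\<lambda>s. s ''X''" and A = "\<lambda>X. \<exists>b Y. mw_state rounds b X Y"])
  fix X assume "\<exists>b Y. mw_state rounds b X Y"
  then obtain b Y where mw: "mw_state rounds b X Y" by blast
  show "\<lbrace>\<lambda>s. ?P s \<and> s ''X'' = X\<rbrace> lr;; select_greedily \<lbrace>solved\<rbrace>"
    by (rule hoare_conseq[OF hoare_Seq[OF hoare_lr[OF mw_state_count[OF mw]]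
          hoare_select_greedily_solved[OF mw]]]) auto
qed auto

theorem hoare_solve: "\<lbrace>data\<rbrace> solve \<lbrace>solved\<rbrace>"
  unfolding solve_def
  by (intro hoare_Seq[OF hoare_compute_scale] hoare_Seq[OF hoare_compute_coeff]
      hoare_Seq[OF hoare_compute_kernel] hoare_Seq[OF hoare_compute_profit]
      hoare_Seq[OF hoare_mw] hoare_round_fractional)

end

section \<open>Instances with rational data\<close>

lemma length_encode_number [simp]: "length (encode_number r) = 2"
  by (simp add: encode_number_def split: prod.split)

lemma encode_number_rational:
  assumes "r \<in> \<rat>" "0 \<le> r"
  shows "0 < encode_number r ! 1" "r = real (encode_number r ! 0) / real (encode_number r ! 1)"
proof -
  obtain x where r_eq: "r = real_of_rat x" using assms(1) by (auto elim: Rats_cases)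
  obtain a b where quotient: "quotient_of x = (a, b)" by (cases "quotient_of x")
  have "inv real_of_rat r = x" unfolding r_eq by (intro inv_f_f injI) simp
  then have encoding: "encode_number r = [nat a, nat b]" by (simp add: encode_number_def quotient)
  have denominator_pos: "0 < b" using quotient by (rule quotient_of_denom_pos)
  have "x = of_int a / of_int b" using quotient by (rule quotient_of_div)
  then have fraction: "r = of_int a / of_int b" unfolding r_eq by (simp add: of_rat_divide)
  then have "0 \<le> a" using assms(2) denominator_pos by (simp add: zero_le_divide_iff)
  then show "0 < encode_number r ! 1" "r = real (encode_number r ! 0) / real (encode_number r ! 1)"
    unfolding encoding using denominator_pos fraction by simp_all
qed

lemma length_concat_encode: "length (concat (map encode_number rs)) = 2 * length rs"
  by (induction rs) auto

lemma nth_concat_encode: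
  "t < length rs \<Longrightarrow> e < 2 \<Longrightarrow> concat (map encode_number rs) ! (2 * t + e) = encode_number (rs ! t) ! e"
proof (induction rs arbitrary: t)
  case (Cons r rs)
  then show ?case by (cases t) (auto simp: nth_append)
qed simp

lemma length_concat_rows: "length (concat (map (\<lambda>i. map (f i) [0..<n]) [0..<m])) = m * n"
  by (induction m) auto

lemma row_col_index_less:
  fixes i j r n :: nat
  assumes "i < r" "j < n"
  shows "i * n + j < r * n"
proof -
  have "i * n + j < Suc i * n" using assms(2) by simp
  also have "\<dots> \<le> r * n" using assms(1) by (intro mult_right_mono) auto
  finally show ?thesis .
qed

lemma nth_concat_rows:
  assumes "i < m" "j < n"
  shows "concat (map (\<lambda>i. map (f i) [0..<n]) [0..<m]) ! (i * n + j) = f i j"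
  using assms(1)
proof (induction m)
  case (Suc m)
  show ?case
  proof (cases "i = m")
    case True
    then show ?thesis using assms(2) by (simp add: nth_append length_concat_rows)
  next
    case False
    then have "i < m" using Suc.prems by simp
    then show ?thesis
      using Suc.IH row_col_index_less[OF _ assms(2)] by (simp add: nth_append length_concat_rows)
  qed
qed simp

definition numbers :: "pip \<Rightarrow> real list" where
  "numbers I = map (weight I) [0..<items I] @ map (capacity I) [0..<rows I] @
     concat (map (\<lambda>i. map (demand I i) [0..<items I]) [0..<rows I])"

lemma length_numbers: "length (numbers I) = rows I + items I + rows I * items I"
  by (simp add: numbers_def length_concat_rows del: length_concat)

lemma nth_numbers:
  "j < items I \<Longrightarrow> numbers I ! j = weight I j"
  "i < rows I \<Longrightarrow> numbers I ! (items I + i) = capacity I i"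
  "i < rows I \<Longrightarrow> j < items I \<Longrightarrow> numbers I ! (items I + rows I + (i * items I + j)) = demand I i j"
  by (simp_all add: numbers_def nth_append nth_concat_rows add.assoc)

lemma numbers_rational:
  assumes "k_CS_PIP k I" "rational_data I" "r \<in> set (numbers I)"
  shows "r \<in> \<rat>" "0 \<le> r"
  using assms by (auto simp: numbers_def k_CS_PIP_def rational_data_def)

lemma encode_eq: "encode I = items I # rows I # concat (map encode_number (numbers I))"
  by (simp add: encode_def numbers_def)

lemma length_encode: "length (encode I) = 2 + 2 * length (numbers I)"
  using length_concat_encode[of "numbers I"] by (simp add: encode_eq)

lemma nth_encode:
  assumes "t < length (numbers I)"
  shows "encode I ! (2 * t + 2) = encode_number (numbers I ! t) ! 0"
    "encode I ! (2 * t + 3) = encode_number (numbers I ! t) ! 1"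
  using nth_concat_encode[OF assms, of 0] nth_concat_encode[OF assms, of 1]
  by (simp_all add: encode_eq numeral_3_eq_3)

lemma length_le_input_size: "length xs \<le> input_size xs"
proof (induction xs)
  case (Cons x xs)
  have "1 \<le> bit_length x" by (simp add: bit_length_def)
  then show ?case using Cons by (simp add: input_size_def)
qed (simp add: input_size_def)

lemma nth_less_input_size:
  assumes "i < length xs"
  shows "xs ! i < 2 ^ input_size xs"
proof -
  have "bit_length (xs ! i) \<le> input_size xs"
    unfolding input_size_def using assms by (intro member_le_sum_list) auto
  with less_power_bit_length show ?thesis by (rule power_two_less)
qed

lemma prod_list_le_input_size: "prod_list (map (max 1) xs) \<le> 2 ^ input_size xs"
proof (induction xs)
  case (Cons x xs)
  have "max 1 x \<le> 2 ^ bit_length x" using less_power_bit_length[of x] by (simp add: Suc_leI)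
  then have "max 1 x * prod_list (map (max 1) xs) \<le> 2 ^ bit_length x * 2 ^ input_size xs"
    using Cons by (intro mult_mono) auto
  then show ?case by (simp add: input_size_def power_add)
qed (simp add: input_size_def)

lemma prod_nth_le_input_size:
  assumes "inj_on f A" "f ` A \<subseteq> {..<length xs}" "\<And>a. a \<in> A \<Longrightarrow> 0 < xs ! f a"
  shows "(\<Prod>a\<in>A. xs ! f a) \<le> 2 ^ input_size xs"
proof -
  have "(\<Prod>a\<in>A. xs ! f a) = (\<Prod>a\<in>A. max 1 (xs ! f a))"
    using assms(3) by (intro prod.cong) (auto simp: max_def Suc_le_eq)
  also have "\<dots> = (\<Prod>i\<in>f ` A. max 1 (xs ! i))" using assms(1) by (simp add: prod.reindex)
  also have "\<dots> \<le> (\<Prod>i<length xs. max 1 (xs ! i))"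
    using assms(2) by (intro dvd_imp_le prod_dvd_prod_subset prod_pos) auto
  also have "\<dots> = prod_list (map (max 1) xs)"
    by (simp add: prod.list_conv_set_nth atLeast0LessThan)
  also have "\<dots> \<le> 2 ^ input_size xs" by (rule prod_list_le_input_size)
  finally show ?thesis .
qed

abbreviation Count :: aexp where
  "Count \<equiv> Var ''m'' \<^bold>+ Var ''n'' \<^bold>+ Var ''m'' \<^bold>* Var ''n''"

abbreviation Numerator :: "aexp \<Rightarrow> aexp" where
  "Numerator t \<equiv> ''in''\<^bold>[Const 2 \<^bold>* t \<^bold>+ Const 2\<^bold>]"

abbreviation Denominator :: "aexp \<Rightarrow> aexp" where
  "Denominator t \<equiv> ''in''\<^bold>[Const 2 \<^bold>* t \<^bold>+ Const 3\<^bold>]"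

definition read_header :: com where
  "read_header = ''n'' ::= ''in''\<^bold>[Const 0\<^bold>];; ''m'' ::= ''in''\<^bold>[Const 1\<^bold>]"

definition compute_common_denominator :: com where
  "compute_common_denominator =
     iterate ''D'' (Const 0) (Const 1) ''t'' Count (Var ''D'' \<^bold>* Denominator (Var ''t''))"

definition scale_numbers :: com where
  "scale_numbers = FOR ''t'' < Count DO
     ''A''\<^bold>[Var ''t''\<^bold>] ::= Numerator (Var ''t'') \<^bold>* (Var ''D'' \<^bold>/ Denominator (Var ''t''))"

definition increment_capacities :: com where
  "increment_capacities = FOR ''i'' < Var ''m'' DO
     ''A''\<^bold>[Var ''n'' \<^bold>+ Var ''i''\<^bold>] ::= Capacity (Var ''i'') \<^bold>+ Const 1"

definition algorithm :: com where
  "algorithm = read_header;; compute_common_denominator;; scale_numbers;; increment_capacities;;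
     solve"

definition loop_bound :: "nat \<Rightarrow> nat" where
  "loop_bound L = 32 * L\<^sup>2 + L"

definition bit_bound :: "nat \<Rightarrow> nat" where
  "bit_bound L = (L + (2 * L\<^sup>2 + 2) * (32 * L\<^sup>2 + 1)) + (2 * L + 2 * L ^ 3) + loop_bound L + 1"

lemma less_two_power: "a \<le> b \<Longrightarrow> a < 2 ^ (b::nat)"
  by (rule le_less_trans[OF _ less_exp])

lemma bounded_packingI:
  assumes size: "m + n \<le> L" and weight_less: "\<And>j. j < n \<Longrightarrow> w j < 2 ^ (2 * L)"
    and capacity: "\<And>i. i < m \<Longrightarrow> 0 < c i" "\<And>i. i < m \<Longrightarrow> c i \<le> 2 ^ (2 * L)"
  shows "bounded_packing n m w c (bit_bound L) (loop_bound L)"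
proof -
  interpret integer_packing n m w c d for d by standard (rule capacity(1))
  have "(m + n) * n \<le> L\<^sup>2" unfolding power2_eq_square using size by (intro mult_mono) auto
  then have rounds_bound: "rounds \<le> 32 * L\<^sup>2" by simp
  have "scale \<le> (\<Prod>i<m. 2 ^ (2 * L))" unfolding scale_def using capacity(2) by (intro prod_mono) auto
  also have "\<dots> = 2 ^ (2 * L * m)" by (simp add: power_mult)
  also have "\<dots> \<le> 2 ^ (2 * L\<^sup>2)" using size by (intro power_increasing) (auto simp: power2_eq_square)
  finally have scale_bound: "scale \<le> 2 ^ (2 * L\<^sup>2)" .
  show ?thesis
  proof
    show "0 < bit_bound L" by (simp add: bit_bound_def)
    show "loop_bound L < 2 ^ bit_bound L" by (rule less_two_power) (simp add: bit_bound_def)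
    show "m + n \<le> loop_bound L" "rounds \<le> loop_bound L"
      using size rounds_bound by (simp_all add: loop_bound_def)
    have "(4 * scale) ^ (rounds + 1) \<le> (2 ^ (2 * L\<^sup>2 + 2)) ^ (rounds + 1)"
      using scale_bound by (intro power_mono) (auto simp: power_add)
    also have "\<dots> \<le> 2 ^ ((2 * L\<^sup>2 + 2) * (32 * L\<^sup>2 + 1))"
      unfolding power_mult[symmetric] using rounds_bound
      by (intro power_increasing mult_left_mono) auto
    finally have "(4 * scale) ^ (rounds + 1) \<le> 2 ^ ((2 * L\<^sup>2 + 2) * (32 * L\<^sup>2 + 1))" .
    moreover have "m + n + 1 \<le> 2 ^ L" using less_two_power[OF size] by simp
    ultimately have
      "(m + n + 1) * (4 * scale) ^ (rounds + 1) \<le> 2 ^ (L + (2 * L\<^sup>2 + 2) * (32 * L\<^sup>2 + 1))"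
      unfolding power_add[of _ L] by (intro mult_le_mono)
    also have "\<dots> < 2 ^ bit_bound L" by (rule power_strict_increasing) (simp_all add: bit_bound_def)
    finally show "(m + n + 1) * (4 * scale) ^ (rounds + 1) < 2 ^ bit_bound L" .
    fix j assume "j < n"
    have "scale ^ n \<le> (2 ^ (2 * L\<^sup>2)) ^ n" using scale_bound by (intro power_mono) auto
    also have "\<dots> \<le> 2 ^ (2 * L ^ 3)"
      unfolding power_mult[symmetric] using size
      by (intro power_increasing) (auto simp: power2_eq_square power3_eq_cube)
    finally have "w j * scale ^ n < 2 ^ (2 * L + 2 * L ^ 3)"
      by (rule mult_less_power_two[OF weight_less[OF \<open>j < n\<close>]])
    then show "w j * scale ^ n < 2 ^ bit_bound L" by (rule power_two_less) (simp add: bit_bound_def)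
  qed
qed

lemma sum_mult_zero_one:
  fixes x :: "'a \<Rightarrow> nat" and f :: "'a \<Rightarrow> real"
  assumes "finite A" "\<And>j. j \<in> A \<Longrightarrow> x j \<in> {0, 1}"
  shows "(\<Sum>j\<in>A. f j * real (x j)) = (\<Sum>j\<in>{j \<in> A. x j = 1}. f j)"
  unfolding sum.inter_filter[OF assms(1)] using assms(2) by (intro sum.cong) fastforce+

lemma OPT_le:
  assumes "k_CS_PIP k I" "\<And>x. feasible I x \<Longrightarrow> total_weight I x \<le> b"
  shows "OPT I \<le> b"
  unfolding OPT_def
proof (rule Max.boundedI)
  have "{total_weight I x |x. feasible I x} \<subseteq> (\<lambda>T. \<Sum>j\<in>T. weight I j) ` Pow {..<items I}"
  proof safe
    fix x assume "feasible I x"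
    then have "total_weight I x = (\<Sum>j\<in>{j \<in> {..<items I}. x j = 1}. weight I j)"
      unfolding total_weight_def by (intro sum_mult_zero_one) (auto simp: feasible_def)
    then show "total_weight I x \<in> (\<lambda>T. \<Sum>j\<in>T. weight I j) ` Pow {..<items I}" by blast
  qed
  then show "finite {total_weight I x |x. feasible I x}" by (rule finite_subset) simp
  have "feasible I (\<lambda>_. 0)" using assms(1) by (simp add: feasible_def k_CS_PIP_def)
  then show "{total_weight I x |x. feasible I x} \<noteq> {}" by blast
qed (use assms(2) in auto)

locale rational_cs_pip =
  fixes k :: nat and I :: pip
  assumes sparsity_pos: "1 \<le> k" and cs_pip: "k_CS_PIP k I" and rational: "rational_data I"
begin

definition numerator :: "nat \<Rightarrow> nat" where
  "numerator t = encode I ! (2 * t + 2)"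

definition denominator :: "nat \<Rightarrow> nat" where
  "denominator t = encode I ! (2 * t + 3)"

definition common_denominator :: nat where
  "common_denominator = (\<Prod>t<length (numbers I). denominator t)"

definition scaled_number :: "nat \<Rightarrow> nat" where
  "scaled_number t = numerator t * (common_denominator div denominator t)"

abbreviation L :: nat where
  "L \<equiv> input_size (encode I)"

text \<open>The capacity is increased by 1 because \<open>integer_packing\<close> demands positive capacities that are
  not attained.\<close>

definition integer_capacity :: "nat \<Rightarrow> nat" where
  "integer_capacity i = scaled_number (items I + i) + 1"

definition integer_demand :: "nat \<Rightarrow> nat \<Rightarrow> nat" where
  "integer_demand i j = scaled_number (items I + rows I + (i * items I + j))"

lemma length_bound: "2 + 2 * length (numbers I) \<le> L"
  using length_le_input_size[of "encode I"] by (simp add: length_encode)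

lemma demand_index_less:
  "i < rows I \<Longrightarrow> j < items I \<Longrightarrow> items I + rows I + (i * items I + j) < length (numbers I)"
  using row_col_index_less[of i "rows I" j "items I"] by (simp add: length_numbers)

lemma number_eq_fraction:
  assumes "t < length (numbers I)"
  shows "0 < denominator t" "numbers I ! t = real (numerator t) / real (denominator t)"
  using numbers_rational[OF cs_pip rational nth_mem[OF assms]] nth_encode[OF assms]
    encode_number_rational
  by (simp_all add: numerator_def denominator_def)

lemma common_denominator_pos: "0 < common_denominator"
  unfolding common_denominator_def using number_eq_fraction by (intro prod_pos) auto

lemma common_denominator_le: "common_denominator \<le> 2 ^ L"
  unfolding common_denominator_def denominator_def
proof (rule prod_nth_le_input_size)
  show "0 < encode I ! (2 * t + 3)" if "t \<in> {..<length (numbers I)}" for t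
    using number_eq_fraction(1)[of t] that by (simp add: denominator_def)
qed (auto simp: inj_on_def length_encode)

lemma real_scaled_number:
  assumes "t < length (numbers I)"
  shows "real (scaled_number t) = real common_denominator * numbers I ! t"
proof -
  have "denominator t dvd common_denominator"
    unfolding common_denominator_def using assms by (intro dvd_prodI) auto
  then show ?thesis
    using number_eq_fraction[OF assms] by (simp add: scaled_number_def real_of_nat_div)
qed

lemma scaled_number_less:
  assumes "t < length (numbers I)"
  shows "scaled_number t < 2 ^ (2 * L)"
proof -
  have "numerator t < 2 ^ L"
    unfolding numerator_def using assms by (intro nth_less_input_size) (simp add: length_encode)
  moreover have "common_denominator div denominator t \<le> 2 ^ L"
    using common_denominator_le div_le_dividend order_trans by blast
  ultimately have "scaled_number t < 2 ^ (L + L)"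
    unfolding scaled_number_def by (rule mult_less_power_two)
  then show ?thesis by (simp add: mult_2)
qed

sublocale bounded_packing "items I" "rows I" scaled_number integer_capacity integer_demand
    "bit_bound L" "loop_bound L"
proof (rule bounded_packingI)
  show "rows I + items I \<le> L" using length_bound by (simp add: length_numbers)
  show "scaled_number j < 2 ^ (2 * L)" if "j < items I" for j
    using that by (intro scaled_number_less) (simp add: length_numbers)
  show "integer_capacity i \<le> 2 ^ (2 * L)" if "i < rows I" for i
    using scaled_number_less[of "items I + i"] that
    by (simp add: integer_capacity_def length_numbers Suc_le_eq)
qed (simp add: integer_capacity_def)

subsection \<open>The program on encoded instances\<close>

notation hoare ("\<lbrace>_\<rbrace>/ _/ \<lbrace>_\<rbrace>" [0, 0, 0] 60)

definition header :: "state \<Rightarrow> bool" where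
  "header s \<longleftrightarrow> s ''in'' = input_state (encode I) ''in'' \<and> s ''n'' 0 = items I \<and> s ''m'' 0 = rows I"

lemma header_simps:
  assumes "header s"
  shows "s ''n'' 0 = items I" "s ''m'' 0 = rows I"
    "t < length (numbers I) \<Longrightarrow> s ''in'' (2 * t + 2) = numerator t"
    "t < length (numbers I) \<Longrightarrow> s ''in'' (2 * t + 3) = denominator t"
  using assms by (auto simp: header_def input_state_def length_encode numerator_def denominator_def)

lemma ignores_header: "V \<inter> {''in'', ''n'', ''m''} = {} \<Longrightarrow> ignores V header"
  by (auto simp: ignores_def header_def)

lemma count_le: "length (numbers I) \<le> loop_bound L"
  using length_bound by (simp add: loop_bound_def)

lemma input_size_le_bit_bound: "2 * L \<le> bit_bound L"
  by (simp add: bit_bound_def)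

lemma hoare_read_header:
  "\<lbrace>\<lambda>s. s = input_state (encode I)\<rbrace> read_header \<lbrace>header\<rbrace>"
  unfolding read_header_def
proof (rule hoare_Seq)
  have small: "items I < 2 ^ bit_bound L" "rows I < 2 ^ bit_bound L"
    using length_bound input_size_le_bit_bound by (auto intro!: less_two_power simp: length_numbers)
  show "\<lbrace>\<lambda>s. s = input_state (encode I)\<rbrace> ''n'' ::= ''in''\<^bold>[Const 0\<^bold>]
      \<lbrace>\<lambda>s. s ''in'' = input_state (encode I) ''in'' \<and> s ''n'' 0 = items I\<rbrace>"
    using small by (intro hoare_Assign) (simp add: store_simps input_state_def encode_eq)
  show "\<lbrace>\<lambda>s. s ''in'' = input_state (encode I) ''in'' \<and> s ''n'' 0 = items I\<rbrace>
      ''m'' ::= ''in''\<^bold>[Const 1\<^bold>] \<lbrace>header\<rbrace>"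
    using small by (intro hoare_Assign) (simp add: store_simps header_def input_state_def encode_eq)
qed

lemma hoare_common_denominator:
  "\<lbrace>header\<rbrace> compute_common_denominator \<lbrace>\<lambda>s. header s \<and> s ''D'' 0 = common_denominator\<rbrace>"
proof (rule hoare_array[where x = "''D''"])
  fix y
  let ?g = "\<lambda>i. \<Prod>t<i. denominator t"
  have bits: "?g i < 2 ^ bit_bound L" if "i \<le> length (numbers I)" for i
  proof -
    have "?g i \<le> common_denominator"
      using common_denominator_pos that unfolding common_denominator_def
      by (intro dvd_imp_le prod_dvd_prod_subset) auto
    also have "\<dots> \<le> 2 ^ L" by (rule common_denominator_le)
    also have "\<dots> < 2 ^ bit_bound L" by (rule power_strict_increasing) (simp_all add: bit_bound_def)
    finally show ?thesis .
  qed
  have "\<lbrace>\<lambda>s. header s \<and> s ''D'' = y\<rbrace> compute_common_denominator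
      \<lbrace>\<lambda>s. header s \<and> s ''D'' = y(0 := ?g (length (numbers I)))\<rbrace>"
    unfolding compute_common_denominator_def using bits
    by (intro hoare_iterate[where n = "length (numbers I)" and g = ?g])
      (auto simp: header_simps length_numbers[symmetric]
        intro!: loop_contextI count_le ignores_header)
  then show "\<lbrace>\<lambda>s. header s \<and> s ''D'' = y\<rbrace> compute_common_denominator
      \<lbrace>\<lambda>s. header s \<and> s ''D'' 0 = common_denominator\<rbrace>"
    by (rule hoare_conseq) (auto simp: common_denominator_def)
qed

lemma scaled_number_bits: "t < length (numbers I) \<Longrightarrow> scaled_number t < 2 ^ bit_bound L"
  using scaled_number_less input_size_le_bit_bound by (rule power_two_less)

lemma hoare_scale_numbers:
  "\<lbrace>\<lambda>s. header s \<and> s ''D'' 0 = common_denominator\<rbrace>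
   scale_numbers
   \<lbrace>\<lambda>s. header s \<and> (\<forall>t<length (numbers I). s ''A'' t = scaled_number t)\<rbrace>"
proof (rule hoare_conseq)
  let ?R = "\<lambda>s. header s \<and> s ''D'' 0 = common_denominator"
  show "\<lbrace>?R\<rbrace> scale_numbers \<lbrace>\<lambda>s. ?R s \<and> (\<forall>t<length (numbers I). s ''A'' t = scaled_number t)\<rbrace>"
    unfolding scale_numbers_def using scaled_number_bits by (intro hoare_fill hoare_Assign)
      (auto simp: header_simps header_simps(3)[simplified] store_same length_numbers[symmetric]
        scaled_number_def
        intro!: loop_contextI count_le ignores_conj ignores_header ignores_array)
qed auto

lemma hoare_increment_capacities:
  "\<lbrace>\<lambda>s. header s \<and> (\<forall>t<length (numbers I). s ''A'' t = scaled_number t)\<rbrace>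
   increment_capacities \<lbrace>data\<rbrace>" (is "\<lbrace>?P\<rbrace> _ \<lbrace>_\<rbrace>")
proof (rule hoare_value[where f = "\<lambda>s. s ''A''" and
      A = "\<lambda>y. \<forall>t<length (numbers I). y t = scaled_number t"])
  fix y assume y_eq: "\<forall>t<length (numbers I). y t = scaled_number t"
  have "integer_capacity i < 2 ^ bit_bound L" if "i < rows I" for i
    using capacity_le_scale[OF that] scale_less by linarith
  then have "\<lbrace>\<lambda>s. header s \<and> s ''A'' = y\<rbrace> increment_capacities \<lbrace>\<lambda>s. header s \<and> (\<forall>l. s ''A'' l =
      (if items I \<le> l \<and> l < items I + rows I then integer_capacity (l - items I) else y l))\<rbrace>"
    unfolding increment_capacities_def using y_eq by (intro hoare_update hoare_Assign)
      (auto simp: header_simps store_same integer_capacity_def length_numbers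
        intro!: loop_contextI loop_limits ignores_header)
  then show "\<lbrace>\<lambda>s. ?P s \<and> s ''A'' = y\<rbrace> increment_capacities \<lbrace>data\<rbrace>"
    by (rule hoare_conseq)
      (use y_eq demand_index_less in \<open>auto simp: data_def header_simps integer_demand_def
        length_numbers\<close>)
qed auto

lemma hoare_algorithm: "\<lbrace>\<lambda>s. s = input_state (encode I)\<rbrace> algorithm \<lbrace>solved\<rbrace>"
  unfolding algorithm_def
  by (intro hoare_Seq[OF hoare_read_header] hoare_Seq[OF hoare_common_denominator]
      hoare_Seq[OF hoare_scale_numbers] hoare_Seq[OF hoare_increment_capacities] hoare_solve)

subsection \<open>Approximation ratio\<close>

lemma real_sum_weight:
  assumes "S \<subseteq> {..<items I}"
  shows "real (\<Sum>j\<in>S. scaled_number j) = real common_denominator * (\<Sum>j\<in>S. weight I j)"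
proof -
  have "real (scaled_number j) = real common_denominator * weight I j" if "j \<in> S" for j
    using real_scaled_number[of j] nth_numbers(1)[of j I] that assms by (auto simp: length_numbers)
  then show ?thesis by (simp add: sum_distrib_left)
qed

lemma real_integer_demand:
  "i < rows I \<Longrightarrow> j < items I \<Longrightarrow> real (integer_demand i j) = real common_denominator * demand I i j"
  using real_scaled_number[OF demand_index_less] nth_numbers(3) by (simp add: integer_demand_def)

lemma sum_demand_less_iff:
  assumes i_less: "i < rows I" and S_subset: "S \<subseteq> {..<items I}"
  shows "(\<Sum>j\<in>S. integer_demand i j) < integer_capacity i \<longleftrightarrow> (\<Sum>j\<in>S. demand I i j) \<le> capacity I i"
proof -
  have "(\<Sum>j\<in>S. integer_demand i j) < integer_capacity i \<longleftrightarrow>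
      real (\<Sum>j\<in>S. integer_demand i j) \<le> real (scaled_number (items I + i))"
    unfolding of_nat_le_iff by (simp add: integer_capacity_def less_Suc_eq_le)
  also have "real (\<Sum>j\<in>S. integer_demand i j) = real common_denominator * (\<Sum>j\<in>S. demand I i j)"
    unfolding of_nat_sum sum_distrib_left using i_less S_subset
    by (intro sum.cong) (auto simp: real_integer_demand)
  also have "real (scaled_number (items I + i)) = real common_denominator * capacity I i"
    using real_scaled_number[of "items I + i"] nth_numbers(2)[OF i_less] i_less
    by (simp add: length_numbers)
  finally show ?thesis using common_denominator_pos by simp
qed

definition chosen :: "(nat \<Rightarrow> nat) \<Rightarrow> nat set" where
  "chosen x = {j \<in> {..<items I}. x j = 1}"

lemma chosen_subset: "chosen x \<subseteq> {..<items I}"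
  by (auto simp: chosen_def)

lemma feasible_iff_fits:
  assumes "\<And>j. j < items I \<Longrightarrow> x j \<in> {0, 1}"
  shows "feasible I x \<longleftrightarrow> fits (chosen x)"
proof -
  have "(\<Sum>j<items I. demand I i j * real (x j)) = (\<Sum>j\<in>chosen x. demand I i j)" for i
    unfolding chosen_def using assms by (intro sum_mult_zero_one) auto
  then show ?thesis
    using assms chosen_subset by (auto simp: feasible_def fits_def sum_demand_less_iff)
qed

lemma real_sum_chosen:
  assumes "feasible I x"
  shows "real (\<Sum>j\<in>chosen x. scaled_number j) = real common_denominator * total_weight I x"
proof -
  have "total_weight I x = (\<Sum>j\<in>chosen x. weight I j)"
    unfolding total_weight_def chosen_def using assms
    by (intro sum_mult_zero_one) (auto simp: feasible_def)
  then show ?thesis using real_sum_weight[OF chosen_subset] by simp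
qed

lemma card_integer_demand_le:
  assumes "j < items I"
  shows "card {i. i < rows I \<and> 0 < integer_demand i j} \<le> k"
proof -
  have "0 < integer_demand i j \<longleftrightarrow> demand I i j \<noteq> 0" if "i < rows I" for i
    using real_integer_demand[OF that assms] common_denominator_pos
    by (cases "integer_demand i j = 0") auto
  then have "{i. i < rows I \<and> 0 < integer_demand i j} = {i. i < rows I \<and> demand I i j \<noteq> 0}" by auto
  then show ?thesis using cs_pip assms by (simp add: k_CS_PIP_def)
qed

lemma solved_approximates:
  assumes "solved s"
  shows "feasible I (solution s)" "OPT I / (8 * real k) \<le> total_weight I (solution s)"
proof -
  obtain b X Y q U where mw: "mw_state rounds b X Y" and lr: "lr_state (items I) X q U"
    and out: "\<And>j. j < items I \<Longrightarrow>
      solution s j = of_bool (j \<in> greedy (selectable U) (map q [0..<items I]))"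
    using assms by (auto simp: solved_def solution_def)
  let ?F = "greedy (selectable U) (map q [0..<items I])"
  have F_fits: "fits ?F" using greedy_ok[of "selectable U"] by (auto simp: selectable_def)
  have chosen_eq: "chosen (solution s) = ?F"
    using F_fits out by (auto simp: chosen_def fits_def of_bool_def split: if_splits)
  show feasible: "feasible I (solution s)"
    using F_fits out by (subst feasible_iff_fits) (simp_all add: chosen_eq)
  have "OPT I \<le> 8 * real k * total_weight I (solution s)"
  proof (rule OPT_le[OF cs_pip])
    fix x assume x_feasible: "feasible I x"
    then have "fits (chosen x)" by (subst feasible_iff_fits[symmetric]) (auto simp: feasible_def)
    then have "(\<Sum>j\<in>chosen x. scaled_number j) \<le> 8 * k * (\<Sum>j\<in>chosen (solution s). scaled_number j)"
      unfolding chosen_eq using approximation_ratio[OF mw lr card_integer_demand_le sparsity_pos]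
      by simp
    then have "real (\<Sum>j\<in>chosen x. scaled_number j)
        \<le> real (8 * k * (\<Sum>j\<in>chosen (solution s). scaled_number j))"
      by (rule of_nat_mono)
    then have "real common_denominator * total_weight I x
        \<le> real common_denominator * (8 * real k * total_weight I (solution s))"
      unfolding of_nat_mult real_sum_chosen[OF x_feasible] real_sum_chosen[OF feasible]
      by (simp add: mult_ac)
    then show "total_weight I x \<le> 8 * real k * total_weight I (solution s)"
      using common_denominator_pos by simp
  qed
  then show "OPT I / (8 * real k) \<le> total_weight I (solution s)"
    using sparsity_pos by (simp add: field_simps)
qed

theorem algorithm_correct:
  obtains s t where "runs algorithm (input_state (encode I)) (return_pmf (s, t))"
    "t \<le> csize (loop_bound L) algorithm * bit_bound L"
    "feasible I (solution s)" "OPT I / (8 * real k) \<le> total_weight I (solution s)"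
proof -
  have "bounded_state (bit_bound L) (input_state (encode I))"
    unfolding bounded_state_def
  proof (intro allI)
    fix x i
    have "encode I ! i < 2 ^ bit_bound L" if "i < length (encode I)"
      using nth_less_input_size[OF that] by (rule power_two_less) (simp add: bit_bound_def)
    then show "input_state (encode I) x i < 2 ^ bit_bound L" by (simp add: input_state_def)
  qed
  then show thesis using hoare_algorithm that solved_approximates by (elim hoareE) auto
qed

end

subsection \<open>Polynomial running time\<close>

definition poly_bounded :: "(nat \<Rightarrow> nat) \<Rightarrow> bool" where
  "poly_bounded f \<longleftrightarrow> (\<exists>p :: nat poly. \<forall>x. f x \<le> poly p x)"

lemma poly_bounded_const: "poly_bounded (\<lambda>x. c)"
  unfolding poly_bounded_def by (intro exI[of _ "[:c:]"]) auto

lemma poly_bounded_ident: "poly_bounded (\<lambda>x. x)"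
  unfolding poly_bounded_def by (intro exI[of _ "[:0, 1:]"]) auto

lemma poly_bounded_add: "poly_bounded f \<Longrightarrow> poly_bounded g \<Longrightarrow> poly_bounded (\<lambda>x. f x + g x)"
  unfolding poly_bounded_def by (metis add_mono poly_add)

lemma poly_bounded_mult: "poly_bounded f \<Longrightarrow> poly_bounded g \<Longrightarrow> poly_bounded (\<lambda>x. f x * g x)"
  unfolding poly_bounded_def by (metis mult_mono poly_mult zero_le)

lemma poly_bounded_power: "poly_bounded f \<Longrightarrow> poly_bounded (\<lambda>x. f x ^ e)"
  by (induction e) (auto intro: poly_bounded_mult poly_bounded_const)

lemma poly_bounded_csize: "poly_bounded g \<Longrightarrow> poly_bounded (\<lambda>x. csize (g x) c)"
  by (induction c)
    (auto intro!: poly_bounded_const poly_bounded_add poly_bounded_mult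
       simp del: add_Suc add_Suc_right mult_Suc)

lemma poly_bounded_running_time: "poly_bounded (\<lambda>L. csize (loop_bound L) algorithm * bit_bound L)"
  unfolding bit_bound_def loop_bound_def
  by (intro poly_bounded_mult poly_bounded_csize poly_bounded_add poly_bounded_const
      poly_bounded_power poly_bounded_ident)

lemma algorithm_poly_time:
  "randomized_poly_time_on algorithm {encode I | I k. k \<ge> 1 \<and> k_CS_PIP k I \<and> rational_data I}"
proof -
  obtain p where poly_bound: "\<And>L. csize (loop_bound L) algorithm * bit_bound L \<le> poly p L"
    using poly_bounded_running_time by (auto simp: poly_bounded_def)
  show ?thesis
    unfolding randomized_poly_time_on_def
  proof (intro exI[of _ p] ballI)
    fix xs assume "xs \<in> {encode I | I k. k \<ge> 1 \<and> k_CS_PIP k I \<and> rational_data I}"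
    then obtain I k where xs_eq: "xs = encode I" and "rational_cs_pip k I"
      by (blast intro: rational_cs_pip.intro)
    then obtain s t where "runs algorithm (input_state xs) (return_pmf (s, t))"
      "t \<le> poly p (input_size xs)"
      using poly_bound order_trans by (metis rational_cs_pip.algorithm_correct)
    then show "\<exists>D. runs algorithm (input_state xs) D \<and>
        (\<forall>(s, t)\<in>set_pmf D. t \<le> poly p (input_size xs))"
      by (intro exI[of _ "return_pmf (s, t)"]) simp
  qed
qed

theorem theorem2:
  "\<exists>A :: com.
     randomized_poly_time_on A {encode I | I k. k \<ge> 1 \<and> k_CS_PIP k I \<and> rational_data I} \<and>
     (\<forall>k I D. k \<ge> 1 \<longrightarrow> k_CS_PIP k I \<longrightarrow> rational_data I \<longrightarrow>
        runs A (input_state (encode I)) D \<longrightarrow>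
          (\<forall>(s, t)\<in>set_pmf D. feasible I (solution s)) \<and>
          measure_pmf.expectation D (\<lambda>(s, t). total_weight I (solution s)) \<ge> OPT I / (8 * real k))"
proof (intro exI[of _ algorithm] conjI allI impI)
  show "randomized_poly_time_on algorithm {encode I | I k. k \<ge> 1 \<and> k_CS_PIP k I \<and> rational_data I}"
    by (rule algorithm_poly_time)
next
  fix k I D
  assume "1 \<le> k" "k_CS_PIP k I" "rational_data I"
    and run_D: "runs algorithm (input_state (encode I)) D"
  then interpret rational_cs_pip k I by unfold_locales
  obtain s t where run: "runs algorithm (input_state (encode I)) (return_pmf (s, t))"
    "feasible I (solution s)" "OPT I / (8 * real k) \<le> total_weight I (solution s)"
    by (rule algorithm_correct)
  have "D = return_pmf (s, t)" by (rule runs_deterministic[OF run_D run(1)])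
  then show "\<forall>(s, t)\<in>set_pmf D. feasible I (solution s)"
    and "OPT I / (8 * real k) \<le> measure_pmf.expectation D (\<lambda>(s, t). total_weight I (solution s))"
    using run by simp_all
qed

end
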